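(* Let $K$ be an algebraically closed field and let $\mathcal{C}$ be a small category in which idempotents split and such that $\mathcal{C}(x,x)$ is a finite set for every object $x$. Then there is a bijection $$\bigsqcup_{[x]\in\mathrm{Iso}(\mathcal{C})}\mathrm{Irr}(K[\mathrm{Aut}_{\mathcal{C}}(x)]\text{-}\mathbf{Mod})\;\xrightarrow{\ \simeq\ }\;\mathrm{Irr}(\mathcal{F}(\mathcal{C};K)).$$
   Context: $\mathcal{F}(\mathcal{C};K)$ is the abelian category of functors from $\mathcal{C}$ to $K$-vector spaces. $\mathrm{Irr}(\mathcal{E})$ is the set of isomorphism classes of simple objects of an abelian category $\mathcal{E}$ with a generator, $\mathrm{Iso}(\mathcal{C})$ is the set of isomorphism classes of objects of $\mathcal{C}$, and $K[G]\text{-}\mathbf{Mod}$ is the category of left modules over the group algebra $K[G]$. "Small" means essentially small (the isomorphism classes of objects form a set). *)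

theory Defs
  imports "HOL-Algebra.Algebra"
begin

section \<open>Categories\<close>

text \<open>
  Hom-sets for different pairs of objects need not be disjoint, so composition is indexed by
  objects: \<open>Cmp C x y z g f\<close> is the composite of \<open>f : x \<rightarrow> y\<close> followed by \<open>g : y \<rightarrow> z\<close>. The objects
  form a set in the sense of HOL, so the isomorphism classes of objects do as well.
\<close>

record ('o, 'm) cat =
  Obj :: "'o set"
  Hom :: "'o \<Rightarrow> 'o \<Rightarrow> 'm set"
  Cmp :: "'o \<Rightarrow> 'o \<Rightarrow> 'o \<Rightarrow> 'm \<Rightarrow> 'm \<Rightarrow> 'm"
  Idn :: "'o \<Rightarrow> 'm"

locale category =
  fixes C :: "('o, 'm) cat"
  assumes Idn_Hom: "x \<in> Obj C \<Longrightarrow> Idn C x \<in> Hom C x x"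
    and Cmp_Hom: "\<lbrakk>x \<in> Obj C; y \<in> Obj C; z \<in> Obj C; f \<in> Hom C x y; g \<in> Hom C y z\<rbrakk>
      \<Longrightarrow> Cmp C x y z g f \<in> Hom C x z"
    and Cmp_Idn_right: "\<lbrakk>x \<in> Obj C; y \<in> Obj C; f \<in> Hom C x y\<rbrakk> \<Longrightarrow> Cmp C x x y f (Idn C x) = f"
    and Cmp_Idn_left: "\<lbrakk>x \<in> Obj C; y \<in> Obj C; f \<in> Hom C x y\<rbrakk> \<Longrightarrow> Cmp C x y y (Idn C y) f = f"
    and Cmp_assoc: "\<lbrakk>w \<in> Obj C; x \<in> Obj C; y \<in> Obj C; z \<in> Obj C;
        f \<in> Hom C w x; g \<in> Hom C x y; h \<in> Hom C y z\<rbrakk>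
      \<Longrightarrow> Cmp C w x z (Cmp C x y z h g) f = Cmp C w y z h (Cmp C w x y g f)"

definition iso_arrow :: "('o, 'm) cat \<Rightarrow> 'o \<Rightarrow> 'o \<Rightarrow> 'm \<Rightarrow> bool" where
  "iso_arrow C x y f \<longleftrightarrow> f \<in> Hom C x y \<and>
     (\<exists>g\<in>Hom C y x. Cmp C x y x g f = Idn C x \<and> Cmp C y x y f g = Idn C y)"

definition iso_rel :: "('o, 'm) cat \<Rightarrow> 'o rel" where
  "iso_rel C = {(x, y). x \<in> Obj C \<and> y \<in> Obj C \<and> (\<exists>f. iso_arrow C x y f)}"

definition Iso :: "('o, 'm) cat \<Rightarrow> 'o set set" where
  "Iso C = Obj C // iso_rel C"

definition Aut :: "('o, 'm) cat \<Rightarrow> 'o \<Rightarrow> 'm monoid" where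
  "Aut C x = \<lparr>carrier = {f. iso_arrow C x x f}, monoid.mult = Cmp C x x x, monoid.one = Idn C x\<rparr>"

definition idempotents_split :: "('o, 'm) cat \<Rightarrow> bool" where
  "idempotents_split C \<longleftrightarrow>
     (\<forall>x\<in>Obj C. \<forall>e\<in>Hom C x x. Cmp C x x x e e = e \<longrightarrow>
        (\<exists>y\<in>Obj C. \<exists>r\<in>Hom C x y. \<exists>s\<in>Hom C y x.
           Cmp C x y x s r = e \<and> Cmp C y x y r s = Idn C y))"

definition monic :: "('o, 'm) cat \<Rightarrow> 'o \<Rightarrow> 'o \<Rightarrow> 'm \<Rightarrow> bool" where
  "monic C x y i \<longleftrightarrow> i \<in> Hom C x y \<and>
     (\<forall>w\<in>Obj C. \<forall>g\<in>Hom C w x. \<forall>h\<in>Hom C w x. Cmp C w x y i g = Cmp C w x y i h \<longrightarrow> g = h)"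

definition zero_object :: "('o, 'm) cat \<Rightarrow> 'o \<Rightarrow> bool" where
  "zero_object C z \<longleftrightarrow> z \<in> Obj C \<and>
     (\<forall>x\<in>Obj C. (\<exists>!f. f \<in> Hom C z x) \<and> (\<exists>!f. f \<in> Hom C x z))"

definition simple_object :: "('o, 'm) cat \<Rightarrow> 'o \<Rightarrow> bool" where
  "simple_object C s \<longleftrightarrow> s \<in> Obj C \<and> \<not> zero_object C s \<and>
     (\<forall>a\<in>Obj C. \<forall>i. monic C a s i \<longrightarrow> zero_object C a \<or> iso_arrow C a s i)"

definition Irr :: "('o, 'm) cat \<Rightarrow> 'o set set" where
  "Irr C = {s. simple_object C s} // iso_rel C"


section \<open>Functor categories\<close>

record ('o, 'm, 'p, 'n) fctr =
  Fob :: "'o \<Rightarrow> 'p"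
  Far :: "'o \<Rightarrow> 'o \<Rightarrow> 'm \<Rightarrow> 'n"

definition is_fctr :: "('o, 'm) cat \<Rightarrow> ('p, 'n) cat \<Rightarrow> ('o, 'm, 'p, 'n) fctr \<Rightarrow> bool" where
  "is_fctr C D F \<longleftrightarrow>
     (\<forall>x\<in>Obj C. Fob F x \<in> Obj D) \<and>
     (\<forall>x\<in>Obj C. \<forall>y\<in>Obj C. \<forall>f\<in>Hom C x y. Far F x y f \<in> Hom D (Fob F x) (Fob F y)) \<and>
     (\<forall>x\<in>Obj C. Far F x x (Idn C x) = Idn D (Fob F x)) \<and>
     (\<forall>x\<in>Obj C. \<forall>y\<in>Obj C. \<forall>z\<in>Obj C. \<forall>f\<in>Hom C x y. \<forall>g\<in>Hom C y z.
        Far F x z (Cmp C x y z g f) =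
          Cmp D (Fob F x) (Fob F y) (Fob F z) (Far F y z g) (Far F x y f))"

definition nat_trans ::
    "('o, 'm) cat \<Rightarrow> ('p, 'n) cat \<Rightarrow> ('o, 'm, 'p, 'n) fctr \<Rightarrow> ('o, 'm, 'p, 'n) fctr \<Rightarrow> ('o \<Rightarrow> 'n) set"
  where
  "nat_trans C D F G =
     {\<alpha> \<in> (\<Pi>\<^sub>E x\<in>Obj C. Hom D (Fob F x) (Fob G x)).
        \<forall>x\<in>Obj C. \<forall>y\<in>Obj C. \<forall>f\<in>Hom C x y.
          Cmp D (Fob F x) (Fob F y) (Fob G y) (\<alpha> y) (Far F x y f) =
          Cmp D (Fob F x) (Fob G x) (Fob G y) (Far G x y f) (\<alpha> x)}"

definition functor_category ::
    "('o, 'm) cat \<Rightarrow> ('p, 'n) cat \<Rightarrow> (('o, 'm, 'p, 'n) fctr, 'o \<Rightarrow> 'n) cat" where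
  "functor_category C D =
     \<lparr>Obj = {F. is_fctr C D F},
      Hom = nat_trans C D,
      Cmp = (\<lambda>F G H \<beta> \<alpha>. \<lambda>x\<in>Obj C. Cmp D (Fob F x) (Fob G x) (Fob H x) (\<beta> x) (\<alpha> x)),
      Idn = (\<lambda>F. \<lambda>x\<in>Obj C. Idn D (Fob F x))\<rparr>"


section \<open>Left modules and group algebras\<close>

text \<open>The library locale \<open>module\<close> requires a commutative ring of scalars.\<close>

locale left_module = R?: ring R + M?: abelian_group M
  for R :: "('r, 'a) ring_scheme" (structure) and M :: "('r, 'v, 'b) module_scheme" (structure) +
  assumes smult_closed [simp, intro]:
      "\<lbrakk>a \<in> carrier R; x \<in> carrier M\<rbrakk> \<Longrightarrow> a \<odot>\<^bsub>M\<^esub> x \<in> carrier M"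
    and smult_l_distr:
      "\<lbrakk>a \<in> carrier R; b \<in> carrier R; x \<in> carrier M\<rbrakk> \<Longrightarrow>
      (a \<oplus> b) \<odot>\<^bsub>M\<^esub> x = a \<odot>\<^bsub>M\<^esub> x \<oplus>\<^bsub>M\<^esub> b \<odot>\<^bsub>M\<^esub> x"
    and smult_r_distr:
      "\<lbrakk>a \<in> carrier R; x \<in> carrier M; y \<in> carrier M\<rbrakk> \<Longrightarrow>
      a \<odot>\<^bsub>M\<^esub> (x \<oplus>\<^bsub>M\<^esub> y) = a \<odot>\<^bsub>M\<^esub> x \<oplus>\<^bsub>M\<^esub> a \<odot>\<^bsub>M\<^esub> y"
    and smult_assoc1:
      "\<lbrakk>a \<in> carrier R; b \<in> carrier R; x \<in> carrier M\<rbrakk> \<Longrightarrow>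
      (a \<otimes> b) \<odot>\<^bsub>M\<^esub> x = a \<odot>\<^bsub>M\<^esub> (b \<odot>\<^bsub>M\<^esub> x)"
    and smult_one [simp]:
      "x \<in> carrier M \<Longrightarrow> \<one> \<odot>\<^bsub>M\<^esub> x = x"

lemma left_module_iff_module: "cring R \<Longrightarrow> left_module R M \<longleftrightarrow> module R M"
  unfolding left_module_def left_module_axioms_def module_def module_axioms_def
  by (auto simp: cring.axioms)

definition linear_maps :: "('r, 'a) ring_scheme \<Rightarrow> ('r, 'v) module \<Rightarrow> ('r, 'v) module \<Rightarrow> ('v \<Rightarrow> 'v) set"
  where
  "linear_maps R M N =
     {\<phi> \<in> carrier M \<rightarrow>\<^sub>E carrier N.
        (\<forall>u\<in>carrier M. \<forall>v\<in>carrier M. \<phi> (u \<oplus>\<^bsub>M\<^esub> v) = \<phi> u \<oplus>\<^bsub>N\<^esub> \<phi> v) \<and>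
        (\<forall>a\<in>carrier R. \<forall>v\<in>carrier M. \<phi> (a \<odot>\<^bsub>M\<^esub> v) = a \<odot>\<^bsub>N\<^esub> \<phi> v)}"

text \<open>
  The type \<open>'v\<close> plays the role of a universe: it bounds the underlying sets of the modules. It
  must not be too small; over an infinite field \<open>K\<close>, an injection of the underlying set of \<open>K\<close>
  into \<open>'v\<close> ensures that every finite-dimensional vector space has an isomorphic copy over \<open>'v\<close>. The
  multiplicative fields \<open>mult\<close> and \<open>one\<close> which the record type \<open>module\<close> inherits from \<open>ring\<close> are
  not constrained for a module, and morphisms ignore them.
\<close>

definition left_modules :: "('r, 'a) ring_scheme \<Rightarrow> (('r, 'v) module, 'v \<Rightarrow> 'v) cat" where
  "left_modules R =
     \<lparr>Obj = {M. left_module R M},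
      Hom = linear_maps R,
      Cmp = (\<lambda>L M N. compose (carrier L)),
      Idn = (\<lambda>M. \<lambda>v\<in>carrier M. v)\<rparr>"

text \<open>
  Elements of the group algebra are the finitely supported functions on the group, multiplied by
  convolution: \<open>(p q)(g) = \<Sum>\<^sub>h p(h) q(h\<^sup>-\<^sup>1g)\<close>.
\<close>

definition group_algebra :: "('k, 'a) ring_scheme \<Rightarrow> ('g, 'b) monoid_scheme \<Rightarrow> ('g \<Rightarrow> 'k) ring" where
  "group_algebra K G =
     \<lparr>carrier = {p \<in> carrier G \<rightarrow>\<^sub>E carrier K. finite {g \<in> carrier G. p g \<noteq> \<zero>\<^bsub>K\<^esub>}},
      monoid.mult = (\<lambda>p q. \<lambda>g\<in>carrier G.
        \<Oplus>\<^bsub>K\<^esub>h\<in>{h \<in> carrier G. p h \<noteq> \<zero>\<^bsub>K\<^esub>}. p h \<otimes>\<^bsub>K\<^esub> q (inv\<^bsub>G\<^esub> h \<otimes>\<^bsub>G\<^esub> g)),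
      monoid.one = (\<lambda>g\<in>carrier G. if g = \<one>\<^bsub>G\<^esub> then \<one>\<^bsub>K\<^esub> else \<zero>\<^bsub>K\<^esub>),
      ring.zero = (\<lambda>g\<in>carrier G. \<zero>\<^bsub>K\<^esub>),
      ring.add = (\<lambda>p q. \<lambda>g\<in>carrier G. p g \<oplus>\<^bsub>K\<^esub> q g)\<rparr>"

text \<open>The category of functors from \<open>C\<close> to vector spaces over the field \<open>K\<close>.\<close>

definition \<F> ::
    "('o, 'm) cat \<Rightarrow> ('k, 'a) ring_scheme \<Rightarrow>
      (('o, 'm, ('k, 'v) module, 'v \<Rightarrow> 'v) fctr, 'o \<Rightarrow> 'v \<Rightarrow> 'v) cat" where
  "\<F> C K = functor_category C (left_modules K)"

end

theory Submission
  imports Defs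
begin

text \<open>
A simple functor \<open>F\<close> is determined by its value at one well chosen object. Among the objects where \<open>F\<close>
does not vanish, take \<open>x\<close> with the fewest endomorphisms. A noninvertible endomorphism of \<open>x\<close> has an
idempotent power different from the identity; this idempotent splits through an object with fewer
endomorphisms, where \<open>F\<close> vanishes, so the endomorphism acts nilpotently on \<open>F(x)\<close>. The noninvertible
endomorphisms form a finite two-sided ideal, and a finite semigroup of nilpotent maps annihilates
some nonzero vector. The vectors annihilated by the whole ideal are stable under all endomorphisms
of \<open>x\<close>, hence fill \<open>F(x)\<close>. So the noninvertible endomorphisms act as zero and \<open>F(x)\<close> is merely a
representation of \<open>Aut(x)\<close>. An object with this property and with \<open>F(x) \<noteq> 0\<close> is called an apex of
\<open>F\<close> here; lemma \<open>apex_exists\<close> carries out this argument.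

Everything else about the passage from \<open>F\<close> to \<open>F(x)\<close> rests on the subfunctor of those
\<open>s \<in> F(y)\<close> which every arrow \<open>y \<rightarrow> x\<close> sends into a given subspace \<open>U\<close> of \<open>F(x)\<close>
(\<open>residual_subfctr\<close>). Since it is zero or everything, \<open>F(x)\<close> has no proper nonzero
subspace stable under endomorphisms (\<open>simple_functor_eval\<close>), and the arrows into \<open>x\<close> jointly
detect the elements of \<open>F\<close> (\<open>simple_functor_separated\<close>). It follows that two apexes are
isomorphic (\<open>apex_unique\<close>), that \<open>F(x)\<close> is a simple module over the group algebra
(\<open>value_rep_simple\<close>), and that an isomorphism \<open>F(x) \<cong> G(x)\<close> of representations extends to
\<open>F \<cong> G\<close> (\<open>extend_iso_from_apex\<close>).

Conversely, let \<open>W\<close> be a simple representation of \<open>Aut(x)\<close>, with noninvertible endomorphisms of \<open>x\<close>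
acting as zero. The functions \<open>h \<mapsto> (h \<circ> g) w\<close> on \<open>C(y, x)\<close>, for \<open>g : x \<rightarrow> y\<close> and \<open>w \<in> W\<close>, span a
simple functor with apex \<open>x\<close> and value \<open>W\<close> there (\<open>ext_simple_functor\<close>). Its values consist of
\<open>W\<close>-valued functions, whereas the values of the functors being classified are carried by subsets of a
fixed type. They can be moved there: such a function is determined by its values at finitely many
arrows, one for each idempotent of \<open>y\<close> that splits through \<open>x\<close>, and a finite power of \<open>W\<close> embeds into
\<open>W\<close> because \<open>K\<close>, being algebraically closed, is infinite (\<open>generated_embeds\<close>,
\<open>simple_functor_exists\<close>).

The simple objects of both kinds of categories are defined by their monomorphisms; the locale
\<open>concrete_category\<close> translates this into the absence of proper nonzero submodules or subfunctors.
\<close>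


section \<open>Isomorphism in a category\<close>

context category
begin

lemma iso_arrow_Hom: "iso_arrow C x y f \<Longrightarrow> f \<in> Hom C x y"
  by (simp add: iso_arrow_def)

lemma iso_arrow_Idn: "x \<in> Obj C \<Longrightarrow> iso_arrow C x x (Idn C x)"
  unfolding iso_arrow_def using Idn_Hom Cmp_Idn_left by blast

lemma iso_arrow_Cmp:
  assumes o: "x \<in> Obj C" "y \<in> Obj C" "z \<in> Obj C"
    and "iso_arrow C x y f" "iso_arrow C y z g"
  shows "iso_arrow C x z (Cmp C x y z g f)"
proof -
  obtain f' where f: "f \<in> Hom C x y" "f' \<in> Hom C y x"
      "Cmp C x y x f' f = Idn C x" "Cmp C y x y f f' = Idn C y"
    using assms by (auto simp: iso_arrow_def)
  obtain g' where g: "g \<in> Hom C y z" "g' \<in> Hom C z y"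
      "Cmp C y z y g' g = Idn C y" "Cmp C z y z g g' = Idn C z"
    using assms by (auto simp: iso_arrow_def)
  have gf: "Cmp C x y z g f \<in> Hom C x z" and fg: "Cmp C z y x f' g' \<in> Hom C z x"
    using o f g by (auto intro: Cmp_Hom)
  have "Cmp C x z x (Cmp C z y x f' g') (Cmp C x y z g f)
      = Cmp C x y x f' (Cmp C x z y g' (Cmp C x y z g f))"
    using o f g gf by (simp add: Cmp_assoc)
  also have "Cmp C x z y g' (Cmp C x y z g f) = f"
    using o f g Cmp_assoc[of x y z y f g g'] by (simp add: Cmp_Idn_left)
  finally have 1: "Cmp C x z x (Cmp C z y x f' g') (Cmp C x y z g f) = Idn C x"
    using f by simp
  have "Cmp C z x z (Cmp C x y z g f) (Cmp C z y x f' g')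
      = Cmp C z y z g (Cmp C z x y f (Cmp C z y x f' g'))"
    using o f g fg by (simp add: Cmp_assoc)
  also have "Cmp C z x y f (Cmp C z y x f' g') = g'"
    using o f g Cmp_assoc[of z y x y g' f' f] by (simp add: Cmp_Idn_left)
  finally have 2: "Cmp C z x z (Cmp C x y z g f) (Cmp C z y x f' g') = Idn C z"
    using g by simp
  show ?thesis unfolding iso_arrow_def using gf fg 1 2 by blast
qed

lemma iso_rel_equiv: "equiv (Obj C) (iso_rel C)"
proof (rule equivI)
  show "iso_rel C \<subseteq> Obj C \<times> Obj C" by (auto simp: iso_rel_def)
  show "refl_on (Obj C) (iso_rel C)"
    using iso_arrow_Idn by (auto simp: iso_rel_def refl_on_def)
  show "sym (iso_rel C)"
    by (rule symI) (auto simp: iso_rel_def iso_arrow_def)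
  show "trans (iso_rel C)"
    using iso_arrow_Cmp by (intro transI) (unfold iso_rel_def, blast)
qed

text \<open>
The composite \<open>f g\<close> is idempotent, and an invertible idempotent is an identity.
\<close>

lemma split_mono_iso_arrow:
  assumes o: "x \<in> Obj C" "y \<in> Obj C" and f: "f \<in> Hom C x y" and g: "g \<in> Hom C y x"
    and "Cmp C x y x g f = Idn C x" "iso_arrow C y y (Cmp C y x y f g)"
  shows "iso_arrow C x y f"
proof -
  let ?e = "Cmp C y x y f g"
  have e: "?e \<in> Hom C y y" using assms Cmp_Hom by blast
  have ge: "Cmp C y y x g ?e = g"
    using Cmp_assoc[of y x y x g f g] assms by (simp add: Cmp_Idn_left)
  have ee: "Cmp C y y y ?e ?e = ?e"
    using Cmp_assoc[of y y x y ?e g f] assms ge e by simp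
  obtain u where u: "u \<in> Hom C y y" "Cmp C y y y u ?e = Idn C y"
    using assms by (auto simp: iso_arrow_def)
  have "?e = Cmp C y y y (Cmp C y y y u ?e) ?e" using u e o by (simp add: Cmp_Idn_left)
  also have "\<dots> = Idn C y" using Cmp_assoc[of y y y y ?e ?e u] o e u ee by simp
  finally show ?thesis using assms by (auto simp: iso_arrow_def)
qed

end

section \<open>Simple objects of concrete categories\<close>

text \<open>
Categories whose objects have underlying families of pointed sets, indexed by \<open>I\<close>, with enough
kernels, images and subobjects to read off simplicity from elements. Modules need a single
underlying set, functors to modules one for each object of the source; hence the index. The family
\<open>Z\<close> gives the zero elements, and \<open>Sub b N\<close> says that \<open>N\<close> is the underlying family of a subobject
of \<open>b\<close>.
\<close>

locale concrete_category = category D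
  for D :: "('p, 'n) cat" +
  fixes I :: "'i set"
    and U :: "'p \<Rightarrow> 'i \<Rightarrow> 'u set"
    and act :: "'n \<Rightarrow> 'i \<Rightarrow> 'u \<Rightarrow> 'u"
    and Z :: "'p \<Rightarrow> 'i \<Rightarrow> 'u"
    and Sub :: "'p \<Rightarrow> ('i \<Rightarrow> 'u set) \<Rightarrow> bool"
  assumes Z_in: "\<lbrakk>a \<in> Obj D; i \<in> I\<rbrakk> \<Longrightarrow> Z a i \<in> U a i"
    and act_in: "\<lbrakk>a \<in> Obj D; b \<in> Obj D; f \<in> Hom D a b; i \<in> I; u \<in> U a i\<rbrakk> \<Longrightarrow> act f i u \<in> U b i"
    and act_Z: "\<lbrakk>a \<in> Obj D; b \<in> Obj D; f \<in> Hom D a b; i \<in> I\<rbrakk> \<Longrightarrow> act f i (Z a i) = Z b i"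
    and act_Cmp: "\<lbrakk>a \<in> Obj D; b \<in> Obj D; c \<in> Obj D; f \<in> Hom D a b; g \<in> Hom D b c; i \<in> I; u \<in> U a i\<rbrakk>
      \<Longrightarrow> act (Cmp D a b c g f) i u = act g i (act f i u)"
    and act_Idn: "\<lbrakk>a \<in> Obj D; i \<in> I; u \<in> U a i\<rbrakk> \<Longrightarrow> act (Idn D a) i u = u"
    and faithful: "\<lbrakk>a \<in> Obj D; b \<in> Obj D; f \<in> Hom D a b; g \<in> Hom D a b;
        \<And>i u. i \<in> I \<Longrightarrow> u \<in> U a i \<Longrightarrow> act f i u = act g i u\<rbrakk> \<Longrightarrow> f = g"
    and zero_map: "\<lbrakk>a \<in> Obj D; b \<in> Obj D\<rbrakk> \<Longrightarrow> \<exists>f\<in>Hom D a b. \<forall>i\<in>I. \<forall>u\<in>U a i. act f i u = Z b i"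
    and bij_iso: "\<lbrakk>a \<in> Obj D; b \<in> Obj D; f \<in> Hom D a b; \<And>i. i \<in> I \<Longrightarrow> bij_betw (act f i) (U a i) (U b i)\<rbrakk>
      \<Longrightarrow> iso_arrow D a b f"
    and ker_inj: "\<lbrakk>a \<in> Obj D; b \<in> Obj D; f \<in> Hom D a b; i \<in> I;
        \<And>u. u \<in> U a i \<Longrightarrow> act f i u = Z b i \<Longrightarrow> u = Z a i\<rbrakk> \<Longrightarrow> inj_on (act f i) (U a i)"
    and Sub_incl: "\<lbrakk>b \<in> Obj D; Sub b N\<rbrakk> \<Longrightarrow> \<exists>a\<in>Obj D. \<exists>f\<in>Hom D a b.
        \<forall>i\<in>I. U a i = N i \<and> (\<forall>u\<in>N i. act f i u = u)"
    and Sub_subset: "\<lbrakk>b \<in> Obj D; Sub b N; i \<in> I\<rbrakk> \<Longrightarrow> Z b i \<in> N i \<and> N i \<subseteq> U b i"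
    and Sub_ker: "\<lbrakk>a \<in> Obj D; b \<in> Obj D; f \<in> Hom D a b\<rbrakk>
      \<Longrightarrow> Sub a (\<lambda>i. {u \<in> U a i. act f i u = Z b i})"
    and Sub_im: "\<lbrakk>a \<in> Obj D; b \<in> Obj D; f \<in> Hom D a b\<rbrakk> \<Longrightarrow> Sub b (\<lambda>i. act f i ` U a i)"
begin

lemma zero_object_iff:
  assumes a: "a \<in> Obj D"
  shows "zero_object D a \<longleftrightarrow> (\<forall>i\<in>I. U a i = {Z a i})"
proof
  assume z: "zero_object D a"
  obtain f where f: "f \<in> Hom D a a" "\<forall>i\<in>I. \<forall>u\<in>U a i. act f i u = Z a i"
    using zero_map[OF a a] by blast
  have "f = Idn D a"
    using z f(1) a Idn_Hom[OF a] unfolding zero_object_def by blast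
  then show "\<forall>i\<in>I. U a i = {Z a i}"
    using f(2) act_Idn[OF a] Z_in[OF a] by (metis equalityI insert_subset singleton_iff subsetI empty_subsetI)
next
  assume z: "\<forall>i\<in>I. U a i = {Z a i}"
  show "zero_object D a"
    unfolding zero_object_def
  proof (intro conjI ballI)
    fix b assume b: "b \<in> Obj D"
    obtain f where f: "f \<in> Hom D a b" using zero_map[OF a b] by blast
    obtain g where g: "g \<in> Hom D b a" using zero_map[OF b a] by blast
    show "\<exists>!f. f \<in> Hom D a b"
    proof (rule ex1I[of _ f])
      fix f' assume f': "f' \<in> Hom D a b"
      show "f' = f"
        by (rule faithful[OF a b f' f]) (use z act_Z[OF a b f] act_Z[OF a b f'] in auto)
    qed (fact f)
    show "\<exists>!f. f \<in> Hom D b a"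
    proof (rule ex1I[of _ g])
      fix g' assume g': "g' \<in> Hom D b a"
      show "g' = g"
      proof (rule faithful[OF b a g' g])
        fix i u assume "i \<in> I" "u \<in> U b i"
        then show "act g' i u = act g i u"
          using z act_in[OF b a g, of i u] act_in[OF b a g', of i u] by auto
      qed
    qed (fact g)
  qed (fact a)
qed

text \<open>
A monic arrow does not distinguish the inclusion of its kernel from the zero map, so that its kernel
vanishes.
\<close>

lemma monic_iff:
  assumes a: "a \<in> Obj D" and b: "b \<in> Obj D" and f: "f \<in> Hom D a b"
  shows "monic D a b f \<longleftrightarrow> (\<forall>i\<in>I. inj_on (act f i) (U a i))"
proof
  assume m: "monic D a b f"
  let ?K = "\<lambda>i. {u \<in> U a i. act f i u = Z b i}"
  obtain k j where k: "k \<in> Obj D" "j \<in> Hom D k a"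
    "\<forall>i\<in>I. U k i = ?K i \<and> (\<forall>u\<in>?K i. act j i u = u)"
    using Sub_incl[OF a Sub_ker[OF a b f]] by auto
  obtain z where z: "z \<in> Hom D k a" "\<forall>i\<in>I. \<forall>u\<in>U k i. act z i u = Z a i"
    using zero_map[OF k(1) a] by blast
  have "Cmp D k a b f j = Cmp D k a b f z"
  proof (rule faithful[OF k(1) b Cmp_Hom[OF k(1) a b k(2) f] Cmp_Hom[OF k(1) a b z(1) f]])
    fix i u assume i: "i \<in> I" and u: "u \<in> U k i"
    show "act (Cmp D k a b f j) i u = act (Cmp D k a b f z) i u"
      using i u k z act_Z[OF a b f i] by (simp add: act_Cmp[OF k(1) a b] f)
  qed
  then have "j = z" using m k z unfolding monic_def by blast
  then have "u = Z a i" if "i \<in> I" "u \<in> U a i" "act f i u = Z b i" for i u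
    using that k z by (metis (mono_tags, lifting) mem_Collect_eq)
  then show "\<forall>i\<in>I. inj_on (act f i) (U a i)"
    using ker_inj[OF a b f] by blast
next
  assume inj: "\<forall>i\<in>I. inj_on (act f i) (U a i)"
  show "monic D a b f"
    unfolding monic_def
  proof (intro conjI ballI impI)
    fix w g h assume w: "w \<in> Obj D" and gh: "g \<in> Hom D w a" "h \<in> Hom D w a"
      and eq: "Cmp D w a b f g = Cmp D w a b f h"
    show "g = h"
    proof (rule faithful[OF w a gh])
      fix i u assume i: "i \<in> I" and u: "u \<in> U w i"
      have "act f i (act g i u) = act f i (act h i u)"
        using act_Cmp[OF w a b gh(1) f i u] act_Cmp[OF w a b gh(2) f i u] eq by simp
      then show "act g i u = act h i u"
        using inj i act_in[OF w a gh(1) i u] act_in[OF w a gh(2) i u] by (auto dest: inj_onD)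
    qed
  qed (fact f)
qed

lemma iso_imp_bij:
  assumes a: "a \<in> Obj D" and b: "b \<in> Obj D" and f: "iso_arrow D a b f" and i: "i \<in> I"
  shows "bij_betw (act f i) (U a i) (U b i)"
proof -
  obtain g where g: "f \<in> Hom D a b" "g \<in> Hom D b a"
      "Cmp D a b a g f = Idn D a" "Cmp D b a b f g = Idn D b"
    using f by (auto simp: iso_arrow_def)
  show ?thesis
  proof (rule bij_betwI[where g = "act g i"])
    show "act f i \<in> U a i \<rightarrow> U b i" "act g i \<in> U b i \<rightarrow> U a i"
      using act_in a b g i by auto
    show "act g i (act f i u) = u" if "u \<in> U a i" for u
      using act_Cmp[OF a b a g(1,2) i that] g act_Idn[OF a i that] by simp
    show "act f i (act g i u) = u" if "u \<in> U b i" for u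
      using act_Cmp[OF b a b g(2,1) i that] g act_Idn[OF b i that] by simp
  qed
qed

text \<open>
A subobject has a monic inclusion, and conversely a monic arrow is an isomorphism onto its image.
\<close>

theorem simple_object_iff:
  "simple_object D s \<longleftrightarrow> s \<in> Obj D \<and> (\<exists>i\<in>I. U s i \<noteq> {Z s i}) \<and>
     (\<forall>N. Sub s N \<longrightarrow> (\<forall>i\<in>I. N i = {Z s i}) \<or> (\<forall>i\<in>I. N i = U s i))"
proof (cases "s \<in> Obj D")
  case s: True
  show ?thesis
  proof (intro iffI conjI allI impI)
    assume sim: "simple_object D s"
    then show "\<exists>i\<in>I. U s i \<noteq> {Z s i}" 
      unfolding simple_object_def zero_object_iff[OF s] by blast
    fix N assume N: "Sub s N"
    obtain a f where a: "a \<in> Obj D" "f \<in> Hom D a s"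
      "\<forall>i\<in>I. U a i = N i \<and> (\<forall>u\<in>N i. act f i u = u)"
      using Sub_incl[OF s N] by blast
    have "monic D a s f"
      unfolding monic_iff[OF a(1) s a(2)] using a(3) by (auto intro!: inj_onI)
    with sim a consider "zero_object D a" | "iso_arrow D a s f"
      unfolding simple_object_def by blast
    then show "(\<forall>i\<in>I. N i = {Z s i}) \<or> (\<forall>i\<in>I. N i = U s i)"
    proof cases
      case 1
      then have "N i = {Z s i}" if "i \<in> I" for i
      proof -
          have "U a i = N i" using a(3) that by blast
          moreover have "U a i = {Z a i}" using 1 that unfolding zero_object_iff[OF a(1)] by blast
          moreover have "Z s i \<in> N i" using Sub_subset[OF s N that] by blast
          ultimately show ?thesis by (metis singletonD)
        qed
      then show ?thesis by blast
    next
      case 2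
      have "N i = U s i" if i: "i \<in> I" for i
      proof -
        have "act f i ` N i = U s i"
          using iso_imp_bij[OF a(1) s 2 i] a(3) i by (simp add: bij_betw_def)
        moreover have "act f i ` N i = N i" using a(3) i by auto
        ultimately show ?thesis by simp
      qed
      then show ?thesis by blast
    qed
  next
    assume R: "s \<in> Obj D \<and> (\<exists>i\<in>I. U s i \<noteq> {Z s i}) \<and>
      (\<forall>N. Sub s N \<longrightarrow> (\<forall>i\<in>I. N i = {Z s i}) \<or> (\<forall>i\<in>I. N i = U s i))"
    show "simple_object D s"
      unfolding simple_object_def
    proof (intro conjI ballI allI impI)
      show "\<not> zero_object D s" using R zero_object_iff[OF s] by blast
      fix a f assume a: "a \<in> Obj D" and m: "monic D a s f"
      have f: "f \<in> Hom D a s" using m by (simp add: monic_def)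
      note inj = m[unfolded monic_iff[OF a s f]]
      consider "\<forall>i\<in>I. act f i ` U a i = {Z s i}" | "\<forall>i\<in>I. act f i ` U a i = U s i"
        using R Sub_im[OF a s f] by meson
      then show "zero_object D a \<or> iso_arrow D a s f"
      proof cases
        case 1
        have "U a i = {Z a i}" if i: "i \<in> I" for i
        proof -
          have "u = Z a i" if u: "u \<in> U a i" for u
          proof (rule inj_onD[OF bspec[OF inj i] _ u Z_in[OF a i]])
            show "act f i u = act f i (Z a i)" using 1 i u act_Z[OF a s f i] by auto
          qed
          then show ?thesis using Z_in[OF a i] by blast
        qed
        then show ?thesis using zero_object_iff[OF a] by blast
      next
        case 2
        then show ?thesis using bij_iso[OF a s f] inj by (auto simp: bij_betw_def)
      qed
    qed (fact s)
  qed (use s in auto)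
qed (simp add: simple_object_def)

end

section \<open>Finite endomorphism monoids\<close>

text \<open>
Multiplication by \<open>b\<close> on the left is injective, hence surjective by finiteness, so \<open>b\<close> also has a
right inverse, which must be \<open>a\<close>.
\<close>

lemma (in monoid) finite_one_sided_inverse:
  assumes fin: "finite (carrier G)" and a: "a \<in> carrier G" "b \<in> carrier G" "a \<otimes> b = \<one>"
  shows "b \<otimes> a = \<one>"
proof -
  have "inj_on (\<lambda>z. b \<otimes> z) (carrier G)"
  proof (rule inj_on_inverseI[where g = "\<lambda>z. a \<otimes> z"])
    fix z assume "z \<in> carrier G"
    then show "a \<otimes> (b \<otimes> z) = z" using a by (simp flip: m_assoc)
  qed
  moreover have "(\<lambda>z. b \<otimes> z) ` carrier G \<subseteq> carrier G" using a by auto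
  ultimately have "(\<lambda>z. b \<otimes> z) ` carrier G = carrier G"
    using fin by (simp add: endo_inj_surj)
  then obtain d where d: "d \<in> carrier G" "b \<otimes> d = \<one>" by (metis imageE one_closed)
  have "a = a \<otimes> (b \<otimes> d)" using a d by simp
  also have "\<dots> = (a \<otimes> b) \<otimes> d" using a(1,2) d(1) by (rule m_assoc[symmetric])
  also have "\<dots> = d" using a d by simp
  finally show ?thesis using d by simp
qed

text \<open>
Equivalently, the nonunits of a finite monoid form a two-sided ideal.
\<close>

lemma (in monoid) finite_Units_mult_iff:
  assumes fin: "finite (carrier G)" and a: "a \<in> carrier G" "b \<in> carrier G"
  shows "a \<otimes> b \<in> Units G \<longleftrightarrow> a \<in> Units G \<and> b \<in> Units G"
proof
  assume "a \<otimes> b \<in> Units G"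
  then obtain u where u: "u \<in> carrier G" "u \<otimes> (a \<otimes> b) = \<one>" "(a \<otimes> b) \<otimes> u = \<one>"
    by (auto simp: Units_def)
  have r: "a \<otimes> (b \<otimes> u) = \<one>" using u a by (simp add: m_assoc)
  have l: "(u \<otimes> a) \<otimes> b = \<one>" using u a by (simp add: m_assoc)
  have "(b \<otimes> u) \<otimes> a = \<one>" using finite_one_sided_inverse[OF fin _ _ r] a u by simp
  moreover have "b \<otimes> (u \<otimes> a) = \<one>" using finite_one_sided_inverse[OF fin _ _ l] a u by simp
  ultimately show "a \<in> Units G \<and> b \<in> Units G"
    using a u l r unfolding Units_def by blast
qed simp

text \<open>
The powers of \<open>t\<close> are eventually periodic, and an exponent which is a multiple of the period and
lies in the periodic part gives an idempotent.
\<close>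

lemma (in monoid) finite_idempotent_power:
  assumes fin: "finite (carrier G)" and t: "t \<in> carrier G"
  shows "\<exists>k::nat. 0 < k \<and> t [^] k \<otimes> t [^] k = t [^] k"
proof -
  have "\<not> inj (\<lambda>n::nat. t [^] n)"
  proof
    assume "inj (\<lambda>n::nat. t [^] n)"
    moreover have "range (\<lambda>n::nat. t [^] n) \<subseteq> carrier G" using t by auto
    ultimately show False using fin by (meson finite_imageD finite_subset infinite_UNIV_nat)
  qed
  then obtain i j :: nat where ij: "i < j" "t [^] i = t [^] j"
    by (metis (no_types, lifting) linorder_injI)
  define d :: nat where "d = j - i"
  have "i + d = j" "0 < d" using ij(1) by (simp_all add: d_def)
  then have d: "0 < d" "t [^] (i + d) = t [^] i" by (simp_all only: ij(2))
  have step: "t [^] (n + d) = t [^] n" if le: "i \<le> n" for n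
  proof -
    obtain r where n: "n = i + r" using le_Suc_ex[OF le] by blast
    have "t [^] (n + d) = t [^] (i + d) \<otimes> t [^] r"
      unfolding n nat_pow_mult[OF t] by (simp only: add.assoc add.commute[of d])
    then show ?thesis using d t by (simp add: n nat_pow_mult)
  qed
  have multi: "t [^] (n + m * d) = t [^] n" if "i \<le> n" for n m
  proof (induction m)
    case (Suc m)
    have "t [^] (n + Suc m * d) = t [^] ((n + m * d) + d)" by (simp only: mult_Suc add.assoc add.commute[of d])
    also have "\<dots> = t [^] (n + m * d)" by (rule step) (use that in simp)
    also have "\<dots> = t [^] n" by (fact Suc)
    finally show ?case .
  qed simp
  let ?k = "Suc i * d"
  have "i \<le> Suc i * 1" by simp
  also have "\<dots> \<le> ?k" using d by (intro mult_le_mono2) simp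
  finally have "i \<le> ?k" .
  then have "t [^] ?k \<otimes> t [^] ?k = t [^] ?k"
    unfolding nat_pow_mult[OF t] by (rule multi)
  moreover have "0 < ?k" using d by simp
  ultimately show ?thesis by blast
qed

definition End :: "('o, 'm) cat \<Rightarrow> 'o \<Rightarrow> 'm monoid" where
  "End C x = \<lparr>carrier = Hom C x x, monoid.mult = Cmp C x x x, monoid.one = Idn C x\<rparr>"

lemma (in category) End_monoid: "x \<in> Obj C \<Longrightarrow> monoid (End C x)"
  by (rule monoidI) (auto simp: End_def Cmp_Hom Idn_Hom Cmp_Idn_left Cmp_Idn_right Cmp_assoc)

lemma (in category) Units_End: "Units (End C x) = {f. iso_arrow C x x f}"
  by (auto simp: Units_def End_def iso_arrow_def)

lemma (in category) Aut_group: "x \<in> Obj C \<Longrightarrow> group (Aut C x)"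
proof -
  assume x: "x \<in> Obj C"
  have "Aut C x = units_of (End C x)"
    by (simp add: Aut_def units_of_def Units_End) (simp add: End_def)
  then show ?thesis using monoid.units_group[OF End_monoid[OF x]] by simp
qed

section \<open>The category of left modules\<close>

context left_module
begin

lemma smult_r_null [simp]: "a \<in> carrier R \<Longrightarrow> a \<odot>\<^bsub>M\<^esub> \<zero>\<^bsub>M\<^esub> = \<zero>\<^bsub>M\<^esub>"
  using smult_r_distr[of a "\<zero>\<^bsub>M\<^esub>" "\<zero>\<^bsub>M\<^esub>"] smult_closed[of a "\<zero>\<^bsub>M\<^esub>"]
  by (metis M.add.r_cancel_one' M.r_zero M.zero_closed)

lemma smult_l_null [simp]: "v \<in> carrier M \<Longrightarrow> \<zero> \<odot>\<^bsub>M\<^esub> v = \<zero>\<^bsub>M\<^esub>"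
  using smult_l_distr[of \<zero> \<zero> v] smult_closed[of \<zero> v]
  by (metis M.add.r_cancel_one' R.r_zero R.zero_closed)

lemma smult_l_minus: "\<lbrakk>a \<in> carrier R; v \<in> carrier M\<rbrakk> \<Longrightarrow> (\<ominus> a) \<odot>\<^bsub>M\<^esub> v = \<ominus>\<^bsub>M\<^esub> (a \<odot>\<^bsub>M\<^esub> v)"
  using smult_l_distr[of "\<ominus> a" a v] by (simp add: R.l_neg M.minus_equality)

lemma smult_finsum:
  assumes "finite A" "a \<in> carrier R" "f \<in> A \<rightarrow> carrier M"
  shows "a \<odot>\<^bsub>M\<^esub> (\<Oplus>\<^bsub>M\<^esub>i\<in>A. f i) = (\<Oplus>\<^bsub>M\<^esub>i\<in>A. a \<odot>\<^bsub>M\<^esub> f i)"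
  using assms by (induction set: finite) (auto simp: Pi_def smult_r_distr)

lemma finsum_smult:
  assumes "finite A" "v \<in> carrier M" "f \<in> A \<rightarrow> carrier R"
  shows "(\<Oplus>i\<in>A. f i) \<odot>\<^bsub>M\<^esub> v = (\<Oplus>\<^bsub>M\<^esub>i\<in>A. f i \<odot>\<^bsub>M\<^esub> v)"
  using assms by (induction set: finite) (auto simp: Pi_def smult_l_distr)

end

text \<open>
Closure under negatives is automatic, since \<open>\<ominus> v\<close> is the multiple of \<open>v\<close> by \<open>\<ominus> \<one>\<close>.
\<close>

definition submod :: "('r, 'a) ring_scheme \<Rightarrow> ('r, 'v) module \<Rightarrow> 'v set \<Rightarrow> bool" where
  "submod R M N \<longleftrightarrow> N \<subseteq> carrier M \<and> \<zero>\<^bsub>M\<^esub> \<in> N \<and>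
     (\<forall>u\<in>N. \<forall>v\<in>N. u \<oplus>\<^bsub>M\<^esub> v \<in> N) \<and> (\<forall>a\<in>carrier R. \<forall>v\<in>N. a \<odot>\<^bsub>M\<^esub> v \<in> N)"

lemma submodD:
  assumes "submod R M N"
  shows "v \<in> N \<Longrightarrow> v \<in> carrier M" "\<zero>\<^bsub>M\<^esub> \<in> N" "\<lbrakk>u \<in> N; v \<in> N\<rbrakk> \<Longrightarrow> u \<oplus>\<^bsub>M\<^esub> v \<in> N"
    "\<lbrakk>a \<in> carrier R; v \<in> N\<rbrakk> \<Longrightarrow> a \<odot>\<^bsub>M\<^esub> v \<in> N"
  using assms by (auto simp: submod_def)

lemma submod_finsum:
  assumes M: "left_module R M" and N: "submod R M N" and "finite A" "f \<in> A \<rightarrow> N"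
  shows "(\<Oplus>\<^bsub>M\<^esub>i\<in>A. f i) \<in> N"
proof -
  interpret left_module R M by fact
  show ?thesis
    using assms(3,4)
  proof (induction set: finite)
    case (insert x A)
    then have "f \<in> insert x A \<rightarrow> carrier M" using submodD[OF N] by (auto simp: Pi_def)
    then show ?case using insert submodD[OF N] by (auto simp: Pi_def)
  qed (simp add: submodD[OF N])
qed

lemma submod_left_module:
  assumes M: "left_module R M" and N: "submod R M N"
  shows "left_module R (M\<lparr>carrier := N\<rparr>)"
proof -
  interpret M: left_module R M by fact
  note N = submodD[OF N]
  have "abelian_group (M\<lparr>carrier := N\<rparr>)"
  proof (rule abelian_groupI)
    fix v assume v: "v \<in> carrier (M\<lparr>carrier := N\<rparr>)"
    then have v: "v \<in> N" "v \<in> carrier M" using N(1) by auto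
    have "\<ominus>\<^bsub>M\<^esub> v = (\<ominus>\<^bsub>R\<^esub> \<one>\<^bsub>R\<^esub>) \<odot>\<^bsub>M\<^esub> v" using v M.smult_l_minus[of "\<one>\<^bsub>R\<^esub>" v] by simp
    then have "\<ominus>\<^bsub>M\<^esub> v \<in> N" using v N(4) by simp
    then show "\<exists>w\<in>carrier (M\<lparr>carrier := N\<rparr>). w \<oplus>\<^bsub>M\<lparr>carrier := N\<rparr>\<^esub> v = \<zero>\<^bsub>M\<lparr>carrier := N\<rparr>\<^esub>"
      using v M.M.l_neg by auto
  qed (use N in \<open>auto simp: M.M.a_ac\<close>)
  then show ?thesis
    unfolding left_module_def left_module_axioms_def
    using N M.R.ring_axioms
    by (auto simp: M.smult_l_distr M.smult_r_distr M.smult_assoc1)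
qed

lemma linear_mapsD:
  assumes "\<phi> \<in> linear_maps R M N"
  shows "v \<in> carrier M \<Longrightarrow> \<phi> v \<in> carrier N"
    "\<lbrakk>u \<in> carrier M; v \<in> carrier M\<rbrakk> \<Longrightarrow> \<phi> (u \<oplus>\<^bsub>M\<^esub> v) = \<phi> u \<oplus>\<^bsub>N\<^esub> \<phi> v"
    "\<lbrakk>a \<in> carrier R; v \<in> carrier M\<rbrakk> \<Longrightarrow> \<phi> (a \<odot>\<^bsub>M\<^esub> v) = a \<odot>\<^bsub>N\<^esub> \<phi> v"
    "\<phi> \<in> extensional (carrier M)"
  using assms by (auto simp: linear_maps_def PiE_def)

lemma linear_mapsI:
  assumes "\<And>v. v \<in> carrier M \<Longrightarrow> \<phi> v \<in> carrier N"
    "\<And>u v. \<lbrakk>u \<in> carrier M; v \<in> carrier M\<rbrakk> \<Longrightarrow> \<phi> (u \<oplus>\<^bsub>M\<^esub> v) = \<phi> u \<oplus>\<^bsub>N\<^esub> \<phi> v"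
    "\<And>a v. \<lbrakk>a \<in> carrier R; v \<in> carrier M\<rbrakk> \<Longrightarrow> \<phi> (a \<odot>\<^bsub>M\<^esub> v) = a \<odot>\<^bsub>N\<^esub> \<phi> v"
    "\<phi> \<in> extensional (carrier M)"
  shows "\<phi> \<in> linear_maps R M N"
  using assms by (auto simp: linear_maps_def PiE_def)

lemma linear_restrictI:
  assumes "left_module R M"
    and "\<And>v. v \<in> carrier M \<Longrightarrow> \<phi> v \<in> carrier N"
    "\<And>u v. \<lbrakk>u \<in> carrier M; v \<in> carrier M\<rbrakk> \<Longrightarrow> \<phi> (u \<oplus>\<^bsub>M\<^esub> v) = \<phi> u \<oplus>\<^bsub>N\<^esub> \<phi> v"
    "\<And>a v. \<lbrakk>a \<in> carrier R; v \<in> carrier M\<rbrakk> \<Longrightarrow> \<phi> (a \<odot>\<^bsub>M\<^esub> v) = a \<odot>\<^bsub>N\<^esub> \<phi> v"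
  shows "restrict \<phi> (carrier M) \<in> linear_maps R M N"
proof -
  interpret left_module R M by fact
  show ?thesis by (rule linear_mapsI) (use assms in auto)
qed

lemma linear_zero:
  assumes "left_module R M" "left_module R N" "\<phi> \<in> linear_maps R M N"
  shows "\<phi> \<zero>\<^bsub>M\<^esub> = \<zero>\<^bsub>N\<^esub>"
proof -
  interpret M: left_module R M by fact
  interpret N: left_module R N by fact
  have "\<phi> \<zero>\<^bsub>M\<^esub> \<oplus>\<^bsub>N\<^esub> \<phi> \<zero>\<^bsub>M\<^esub> = \<phi> \<zero>\<^bsub>M\<^esub>"
    using linear_mapsD(2)[OF assms(3), of "\<zero>\<^bsub>M\<^esub>" "\<zero>\<^bsub>M\<^esub>"] by simp
  then show ?thesis using linear_mapsD(1)[OF assms(3)] by (simp add: N.M.add.r_cancel_one)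
qed

lemma linear_finsum:
  assumes "left_module R M" "left_module R N" "\<phi> \<in> linear_maps R M N"
    and "finite A" "f \<in> A \<rightarrow> carrier M"
  shows "\<phi> (\<Oplus>\<^bsub>M\<^esub>i\<in>A. f i) = (\<Oplus>\<^bsub>N\<^esub>i\<in>A. \<phi> (f i))"
proof -
  interpret M: left_module R M by fact
  interpret N: left_module R N by fact
  show ?thesis
    using assms(4,5)
    by (induction set: finite)
      (auto simp: linear_zero[OF assms(1-3)] Pi_def linear_mapsD[OF assms(3)])
qed

lemma linear_inj:
  assumes M: "left_module R M" and N: "left_module R N" and \<phi>: "\<phi> \<in> linear_maps R M N"
    and ker: "\<And>v. \<lbrakk>v \<in> carrier M; \<phi> v = \<zero>\<^bsub>N\<^esub>\<rbrakk> \<Longrightarrow> v = \<zero>\<^bsub>M\<^esub>"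
  shows "inj_on \<phi> (carrier M)"
proof (rule inj_onI)
  interpret M: left_module R M by fact
  interpret N: left_module R N by fact
  fix u v assume uv: "u \<in> carrier M" "v \<in> carrier M" "\<phi> u = \<phi> v"
  have "\<phi> (u \<oplus>\<^bsub>M\<^esub> \<ominus>\<^bsub>M\<^esub> v) = \<phi> v \<oplus>\<^bsub>N\<^esub> \<phi> (\<ominus>\<^bsub>M\<^esub> v)"
    using uv linear_mapsD[OF \<phi>] by simp
  also have "\<dots> = \<phi> (v \<oplus>\<^bsub>M\<^esub> \<ominus>\<^bsub>M\<^esub> v)" using uv linear_mapsD[OF \<phi>] by simp
  also have "\<dots> = \<zero>\<^bsub>N\<^esub>" using uv linear_zero[OF M N \<phi>] by (simp add: M.M.r_neg)
  finally have "u \<oplus>\<^bsub>M\<^esub> \<ominus>\<^bsub>M\<^esub> v = \<zero>\<^bsub>M\<^esub>" using uv ker by simp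
  then show "u = v" using uv by (metis M.M.add.inv_closed M.M.minus_equality M.M.minus_minus)
qed

lemma submod_kernel:
  assumes M: "left_module R M" and N: "left_module R N" and \<phi>: "\<phi> \<in> linear_maps R M N"
  shows "submod R M {v \<in> carrier M. \<phi> v = \<zero>\<^bsub>N\<^esub>}"
proof -
  interpret M: left_module R M by fact
  interpret N: left_module R N by fact
  show ?thesis
    unfolding submod_def using linear_zero[OF M N \<phi>] by (auto simp: linear_mapsD[OF \<phi>])
qed

lemma submod_image:
  assumes M: "left_module R M" and N: "left_module R N" and \<phi>: "\<phi> \<in> linear_maps R M N"
  shows "submod R N (\<phi> ` carrier M)"
proof -
  interpret M: left_module R M by fact
  show ?thesis
    unfolding submod_def
  proof (intro conjI ballI)
    show "\<zero>\<^bsub>N\<^esub> \<in> \<phi> ` carrier M"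
      using linear_zero[OF M N \<phi>] M.M.zero_closed by (metis imageI)
    fix u v assume "u \<in> \<phi> ` carrier M" "v \<in> \<phi> ` carrier M"
    then obtain u' v' where *: "u' \<in> carrier M" "v' \<in> carrier M" "u = \<phi> u'" "v = \<phi> v'" by blast
    show "u \<oplus>\<^bsub>N\<^esub> v \<in> \<phi> ` carrier M"
      by (rule image_eqI[of _ _ "u' \<oplus>\<^bsub>M\<^esub> v'"]) (use * linear_mapsD[OF \<phi>] in auto)
  next
    fix a v assume a: "a \<in> carrier R" and "v \<in> \<phi> ` carrier M"
    then obtain v' where *: "v' \<in> carrier M" "v = \<phi> v'" by blast
    show "a \<odot>\<^bsub>N\<^esub> v \<in> \<phi> ` carrier M"
      by (rule image_eqI[of _ _ "a \<odot>\<^bsub>M\<^esub> v'"]) (use * a linear_mapsD[OF \<phi>] in auto)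
  qed (use linear_mapsD[OF \<phi>] in auto)
qed

lemma left_modules_simps [simp]:
  "M \<in> Obj (left_modules R) \<longleftrightarrow> left_module R M"
  "Hom (left_modules R) = linear_maps R"
  "Cmp (left_modules R) L M N = compose (carrier L)"
  "Idn (left_modules R) M = (\<lambda>v\<in>carrier M. v)"
  by (simp_all add: left_modules_def)

lemma linear_maps_compose:
  assumes "left_module R L" "left_module R M" "left_module R N"
    and f: "f \<in> linear_maps R L M" and g: "g \<in> linear_maps R M N"
  shows "compose (carrier L) g f \<in> linear_maps R L N"
proof -
  interpret L: left_module R L by fact
  show ?thesis
    by (rule linear_mapsI) (auto simp: compose_def linear_mapsD[OF f] linear_mapsD[OF g])
qed

lemma left_modules_category: "category (left_modules (R :: ('r, 'a) ring_scheme) :: (('r, 'v) module, _) cat)"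
proof
  fix M :: "('r, 'v) module" assume "M \<in> Obj (left_modules R)"
  then show "Idn (left_modules R) M \<in> Hom (left_modules R) M M"
    by (auto intro!: linear_restrictI)
next
  fix L M N :: "('r, 'v) module" and f g
  assume *: "L \<in> Obj (left_modules R)" "M \<in> Obj (left_modules R)" "N \<in> Obj (left_modules R)"
    "f \<in> Hom (left_modules R) L M" "g \<in> Hom (left_modules R) M N"
  then show "Cmp (left_modules R) L M N g f \<in> Hom (left_modules R) L N"
    by (auto intro: linear_maps_compose)
next
  fix M N :: "('r, 'v) module" and f
  assume *: "f \<in> Hom (left_modules R) M N"
  then have f: "f \<in> linear_maps R M N" by simp
  show "Cmp (left_modules R) M M N f (Idn (left_modules R) M) = f"
    "Cmp (left_modules R) M N N (Idn (left_modules R) N) f = f"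
    using linear_mapsD(1)[OF f]
    by (auto simp: compose_def fun_eq_iff extensional_arb[OF linear_mapsD(4)[OF f]])
next
  fix L M N P :: "('r, 'v) module" and f g h
  assume "f \<in> Hom (left_modules R) L M"
  then have f: "f \<in> linear_maps R L M" by simp
  show "Cmp (left_modules R) L M P (Cmp (left_modules R) M N P h g) f =
     Cmp (left_modules R) L N P h (Cmp (left_modules R) L M N g f)"
    using linear_mapsD(1)[OF f] by (auto simp: compose_def fun_eq_iff)
qed

lemma submod_inclusion:
  assumes M: "left_module R M" and N: "submod R M N"
  shows "(\<lambda>v\<in>N. v) \<in> linear_maps R (M\<lparr>carrier := N\<rparr>) M"
  using linear_restrictI[OF submod_left_module[OF M N], of "\<lambda>v. v" M] submodD(1)[OF N] by simp

lemma linear_bij_iso: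
  assumes M: "left_module R M" and N: "left_module R N" and \<phi>: "\<phi> \<in> linear_maps R M N"
    and bij: "bij_betw \<phi> (carrier M) (carrier N)"
  shows "iso_arrow (left_modules R) M N \<phi>"
proof -
  interpret M: left_module R M by fact
  interpret N: left_module R N by fact
  define \<psi> where "\<psi> = (\<lambda>v\<in>carrier N. inv_into (carrier M) \<phi> v)"
  have \<psi>1: "\<psi> v \<in> carrier M" "\<phi> (\<psi> v) = v" if "v \<in> carrier N" for v
    using bij that by (auto simp: \<psi>_def bij_betw_def f_inv_into_f inv_into_into)
  have \<psi>2: "\<psi> (\<phi> v) = v" if "v \<in> carrier M" for v
    using bij that linear_mapsD(1)[OF \<phi>] by (auto simp: \<psi>_def bij_betw_def)
  have "\<psi> \<in> linear_maps R N M"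
  proof (rule linear_mapsI)
    fix u v assume uv: "u \<in> carrier N" "v \<in> carrier N"
    have "\<phi> (\<psi> u \<oplus>\<^bsub>M\<^esub> \<psi> v) = u \<oplus>\<^bsub>N\<^esub> v" using uv \<psi>1 linear_mapsD[OF \<phi>] by simp
    then show "\<psi> (u \<oplus>\<^bsub>N\<^esub> v) = \<psi> u \<oplus>\<^bsub>M\<^esub> \<psi> v" using uv \<psi>1 \<psi>2 by (metis M.M.a_closed)
  next
    fix a v assume a: "a \<in> carrier R" "v \<in> carrier N"
    have "\<phi> (a \<odot>\<^bsub>M\<^esub> \<psi> v) = a \<odot>\<^bsub>N\<^esub> v" using a \<psi>1 linear_mapsD[OF \<phi>] by simp
    then show "\<psi> (a \<odot>\<^bsub>N\<^esub> v) = a \<odot>\<^bsub>M\<^esub> \<psi> v" using a \<psi>1 \<psi>2 by (metis M.smult_closed)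
  qed (auto simp: \<psi>1, simp add: \<psi>_def)
  then show ?thesis
    using \<phi> linear_mapsD(1)[OF \<phi>] \<psi>1 \<psi>2
    unfolding iso_arrow_def by (auto intro!: bexI[of _ \<psi>] simp: compose_def fun_eq_iff)
qed

lemma zero_linear:
  assumes "left_module R M" "left_module R N"
  shows "(\<lambda>v\<in>carrier M. \<zero>\<^bsub>N\<^esub>) \<in> linear_maps R M N"
proof -
  interpret N: left_module R N by fact
  show ?thesis by (rule linear_restrictI) (use assms in auto)
qed

lemma left_modules_concrete:
  "concrete_category (left_modules (R :: ('r, 'a) ring_scheme) :: (('r, 'v) module, _) cat) (UNIV :: unit set) (\<lambda>M _. carrier M) (\<lambda>f _. f) (\<lambda>M _. \<zero>\<^bsub>M\<^esub>)
     (\<lambda>M N. submod R M (N ()))"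
proof (intro concrete_category.intro left_modules_category concrete_category_axioms.intro;
    unfold left_modules_simps)
  fix M :: "('r, 'v) module" assume "left_module R M"
  then interpret left_module R M .
  show "\<zero>\<^bsub>M\<^esub> \<in> carrier M" by simp
next
  fix M N :: "('r, 'v) module" and f g
  assume f: "f \<in> linear_maps R M N" and g: "g \<in> linear_maps R M N"
    and eq: "\<And>i v. i \<in> (UNIV :: unit set) \<Longrightarrow> v \<in> carrier M \<Longrightarrow> f v = g v"
  show "f = g"
    using eq by (intro extensionalityI[OF linear_mapsD(4)[OF f] linear_mapsD(4)[OF g]]) auto
next
  show "\<exists>M\<in>Obj (left_modules R). \<exists>f\<in>linear_maps R M N.
      \<forall>i\<in>UNIV. carrier M = B i \<and> (\<forall>u\<in>B i. f u = u)"
    if *: "left_module R N" "submod R N (B ())" for N :: "('r, 'v) module" and B :: "unit \<Rightarrow> 'v set"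
    using submod_left_module[OF *] submod_inclusion[OF *]
    by (intro bexI[of _ "N\<lparr>carrier := B ()\<rparr>"] bexI[of _ "\<lambda>v\<in>B (). v"]) auto
next
  fix M N :: "('r, 'v) module" assume "left_module R M" "left_module R N"
  from zero_linear[OF this] show "\<exists>f\<in>linear_maps R M N. \<forall>i\<in>UNIV. \<forall>u\<in>carrier M. f u = \<zero>\<^bsub>N\<^esub>"
    by (rule rev_bexI) auto
qed (auto intro: linear_mapsD linear_zero linear_bij_iso linear_inj submod_kernel submod_image
    simp: compose_def dest: submodD)

lemma simple_left_module_iff:
  "simple_object (left_modules R) M \<longleftrightarrow> left_module R M \<and> carrier M \<noteq> {\<zero>\<^bsub>M\<^esub>} \<and>
     (\<forall>N. submod R M N \<longrightarrow> N = {\<zero>\<^bsub>M\<^esub>} \<or> N = carrier M)"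
proof -
  interpret concrete_category "left_modules R" "UNIV :: unit set" "\<lambda>M _. carrier M" "\<lambda>f _. f"
      "\<lambda>M _. \<zero>\<^bsub>M\<^esub>" "\<lambda>M N. submod R M (N ())"
    by (rule left_modules_concrete)
  have "(\<forall>N. submod R M (N ()) \<longrightarrow> (\<forall>i\<in>UNIV. N i = {\<zero>\<^bsub>M\<^esub>}) \<or> (\<forall>i\<in>UNIV. N i = carrier M)) \<longleftrightarrow>
      (\<forall>N. submod R M N \<longrightarrow> N = {\<zero>\<^bsub>M\<^esub>} \<or> N = carrier M)" (is "?L \<longleftrightarrow> ?R")
  proof
    assume l: ?L
    show ?R
    proof (intro allI impI)
      fix N assume "submod R M N"
      then show "N = {\<zero>\<^bsub>M\<^esub>} \<or> N = carrier M" using l[rule_format, of "\<lambda>_. N"] by simp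
    qed
  qed (simp add: UNIV_unit)
  then show ?thesis unfolding simple_object_iff by (simp add: UNIV_unit)
qed

section \<open>Functor categories\<close>

lemma functor_category_simps [simp]:
  "F \<in> Obj (functor_category C D) \<longleftrightarrow> is_fctr C D F"
  "Hom (functor_category C D) = nat_trans C D"
  "Cmp (functor_category C D) F G H \<beta> \<alpha> =
     (\<lambda>x\<in>Obj C. Cmp D (Fob F x) (Fob G x) (Fob H x) (\<beta> x) (\<alpha> x))"
  "Idn (functor_category C D) F = (\<lambda>x\<in>Obj C. Idn D (Fob F x))"
  by (simp_all add: functor_category_def)

lemma is_fctrD:
  assumes "is_fctr C D F"
  shows "x \<in> Obj C \<Longrightarrow> Fob F x \<in> Obj D"
    "\<lbrakk>x \<in> Obj C; y \<in> Obj C; f \<in> Hom C x y\<rbrakk> \<Longrightarrow> Far F x y f \<in> Hom D (Fob F x) (Fob F y)"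
    "x \<in> Obj C \<Longrightarrow> Far F x x (Idn C x) = Idn D (Fob F x)"
    "\<lbrakk>x \<in> Obj C; y \<in> Obj C; z \<in> Obj C; f \<in> Hom C x y; g \<in> Hom C y z\<rbrakk> \<Longrightarrow>
      Far F x z (Cmp C x y z g f) = Cmp D (Fob F x) (Fob F y) (Fob F z) (Far F y z g) (Far F x y f)"
  using assms by (auto simp: is_fctr_def)

lemma nat_transD:
  assumes "\<alpha> \<in> nat_trans C D F G"
  shows "x \<in> Obj C \<Longrightarrow> \<alpha> x \<in> Hom D (Fob F x) (Fob G x)"
    "\<lbrakk>x \<in> Obj C; y \<in> Obj C; f \<in> Hom C x y\<rbrakk> \<Longrightarrow>
      Cmp D (Fob F x) (Fob F y) (Fob G y) (\<alpha> y) (Far F x y f) =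
      Cmp D (Fob F x) (Fob G x) (Fob G y) (Far G x y f) (\<alpha> x)"
    "\<alpha> \<in> extensional (Obj C)"
  using assms by (auto simp: nat_trans_def PiE_def)

lemma nat_transI:
  assumes "\<And>x. x \<in> Obj C \<Longrightarrow> \<alpha> x \<in> Hom D (Fob F x) (Fob G x)"
    "\<And>x y f. \<lbrakk>x \<in> Obj C; y \<in> Obj C; f \<in> Hom C x y\<rbrakk> \<Longrightarrow>
      Cmp D (Fob F x) (Fob F y) (Fob G y) (\<alpha> y) (Far F x y f) =
      Cmp D (Fob F x) (Fob G x) (Fob G y) (Far G x y f) (\<alpha> x)"
  shows "restrict \<alpha> (Obj C) \<in> nat_trans C D F G"
  using assms by (auto simp: nat_trans_def)

lemma nat_trans_compose:
  assumes D: "category D" and F: "is_fctr C D F" and G: "is_fctr C D G" and H: "is_fctr C D H"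
    and \<alpha>: "\<alpha> \<in> nat_trans C D F G" and \<beta>: "\<beta> \<in> nat_trans C D G H"
  shows "(\<lambda>x\<in>Obj C. Cmp D (Fob F x) (Fob G x) (Fob H x) (\<beta> x) (\<alpha> x)) \<in> nat_trans C D F H"
proof (rule nat_transI)
  interpret D: category D by fact
  note O = is_fctrD(1)[OF F] is_fctrD(1)[OF G] is_fctrD(1)[OF H]
  note M = is_fctrD(2)[OF F] is_fctrD(2)[OF G] is_fctrD(2)[OF H] nat_transD(1)[OF \<alpha>] nat_transD(1)[OF \<beta>]
  fix x assume x: "x \<in> Obj C"
  show "Cmp D (Fob F x) (Fob G x) (Fob H x) (\<beta> x) (\<alpha> x) \<in> Hom D (Fob F x) (Fob H x)"
    using x O M by (auto intro!: D.Cmp_Hom)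
  fix y f assume y: "y \<in> Obj C" and f: "f \<in> Hom C x y"
  note O' = O[OF x] O[OF y] and M' = M[OF x] M[OF y] M(1-3)[OF x y f]
  let ?F = "Fob F" and ?G = "Fob G" and ?H = "Fob H"
  have "Cmp D (?F x) (?F y) (?H y) (Cmp D (?F y) (?G y) (?H y) (\<beta> y) (\<alpha> y)) (Far F x y f) =
      Cmp D (?F x) (?G y) (?H y) (\<beta> y) (Cmp D (?F x) (?F y) (?G y) (\<alpha> y) (Far F x y f))"
    using O' M' by (intro D.Cmp_assoc)
  also have "\<dots> = Cmp D (?F x) (?G y) (?H y) (\<beta> y) (Cmp D (?F x) (?G x) (?G y) (Far G x y f) (\<alpha> x))"
    by (simp only: nat_transD(2)[OF \<alpha> x y f])
  also have "\<dots> = Cmp D (?F x) (?G x) (?H y) (Cmp D (?G x) (?G y) (?H y) (\<beta> y) (Far G x y f)) (\<alpha> x)"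
    using O' M' by (intro D.Cmp_assoc[symmetric])
  also have "\<dots> = Cmp D (?F x) (?G x) (?H y) (Cmp D (?G x) (?H x) (?H y) (Far H x y f) (\<beta> x)) (\<alpha> x)"
    by (simp only: nat_transD(2)[OF \<beta> x y f])
  also have "\<dots> = Cmp D (?F x) (?H x) (?H y) (Far H x y f) (Cmp D (?F x) (?G x) (?H x) (\<beta> x) (\<alpha> x))"
    using O' M' by (intro D.Cmp_assoc)
  finally show "Cmp D (?F x) (?F y) (?H y) (Cmp D (?F y) (?G y) (?H y) (\<beta> y) (\<alpha> y)) (Far F x y f) =
      Cmp D (?F x) (?H x) (?H y) (Far H x y f) (Cmp D (?F x) (?G x) (?H x) (\<beta> x) (\<alpha> x))" .
qed

lemma functor_category_category:
  fixes C :: "('o, 'm) cat" and D :: "('p, 'n) cat"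
  assumes "category D"
  shows "category (functor_category C D)"
proof -
  interpret D: category D by fact
  show ?thesis
  proof
    fix F assume "F \<in> Obj (functor_category C D)"
    then have F: "is_fctr C D F" by simp
    show "Idn (functor_category C D) F \<in> Hom (functor_category C D) F F"
      using is_fctrD(1,2)[OF F]
      by (auto intro!: nat_transI D.Idn_Hom simp: D.Cmp_Idn_left D.Cmp_Idn_right)
  next
    fix F G H \<alpha> \<beta>
    assume "F \<in> Obj (functor_category C D)" "G \<in> Obj (functor_category C D)" "H \<in> Obj (functor_category C D)"
      "\<alpha> \<in> Hom (functor_category C D) F G" "\<beta> \<in> Hom (functor_category C D) G H"
    then show "Cmp (functor_category C D) F G H \<beta> \<alpha> \<in> Hom (functor_category C D) F H"
      by (auto intro: nat_trans_compose[OF assms])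
  next
    fix F G \<alpha>
    assume "F \<in> Obj (functor_category C D)" "G \<in> Obj (functor_category C D)"
      "\<alpha> \<in> Hom (functor_category C D) F G"
    then have *: "is_fctr C D F" "is_fctr C D G" "\<alpha> \<in> nat_trans C D F G" by simp_all
    show "Cmp (functor_category C D) F F G \<alpha> (Idn (functor_category C D) F) = \<alpha>"
      "Cmp (functor_category C D) F G G (Idn (functor_category C D) G) \<alpha> = \<alpha>"
      using is_fctrD(1)[OF *(1)] is_fctrD(1)[OF *(2)] nat_transD(1)[OF *(3)]
      by (auto intro!: extensionalityI[OF _ nat_transD(3)[OF *(3)]]
          simp: D.Cmp_Idn_left D.Cmp_Idn_right)
  next
    fix F G H L \<alpha> \<beta> \<gamma>
    assume "F \<in> Obj (functor_category C D)" "G \<in> Obj (functor_category C D)"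
      "H \<in> Obj (functor_category C D)" "L \<in> Obj (functor_category C D)"
      "\<alpha> \<in> Hom (functor_category C D) F G" "\<beta> \<in> Hom (functor_category C D) G H"
      "\<gamma> \<in> Hom (functor_category C D) H L"
    then show "Cmp (functor_category C D) F G L (Cmp (functor_category C D) G H L \<gamma> \<beta>) \<alpha> =
        Cmp (functor_category C D) F H L \<gamma> (Cmp (functor_category C D) F G H \<beta> \<alpha>)"
      by (auto intro!: D.Cmp_assoc restrict_ext dest: is_fctrD(1) nat_transD(1))
  qed
qed

text \<open>
The inverses of the components are natural: conjugate the naturality square of \<open>\<alpha>\<close>.
\<close>

lemma nat_trans_iso:
  assumes D: "category D" and F: "is_fctr C D F" and G: "is_fctr C D G"
    and \<alpha>: "\<alpha> \<in> nat_trans C D F G"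
    and iso: "\<And>x. x \<in> Obj C \<Longrightarrow> iso_arrow D (Fob F x) (Fob G x) (\<alpha> x)"
  shows "iso_arrow (functor_category C D) F G \<alpha>"
proof -
  interpret D: category D by fact
  let ?F = "Fob F" and ?G = "Fob G"
  have "\<forall>x\<in>Obj C. \<exists>g. g \<in> Hom D (?G x) (?F x) \<and>
      Cmp D (?F x) (?G x) (?F x) g (\<alpha> x) = Idn D (?F x) \<and>
      Cmp D (?G x) (?F x) (?G x) (\<alpha> x) g = Idn D (?G x)"
    using iso unfolding iso_arrow_def by blast
  then obtain \<beta> where \<beta>: "\<And>x. x \<in> Obj C \<Longrightarrow> \<beta> x \<in> Hom D (?G x) (?F x)"
      "\<And>x. x \<in> Obj C \<Longrightarrow> Cmp D (?F x) (?G x) (?F x) (\<beta> x) (\<alpha> x) = Idn D (?F x)"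
      "\<And>x. x \<in> Obj C \<Longrightarrow> Cmp D (?G x) (?F x) (?G x) (\<alpha> x) (\<beta> x) = Idn D (?G x)"
    by metis
  have "restrict \<beta> (Obj C) \<in> nat_trans C D G F"
  proof (rule nat_transI)
    fix x y f assume x: "x \<in> Obj C" and y: "y \<in> Obj C" and f: "f \<in> Hom C x y"
    note O = is_fctrD(1)[OF F] is_fctrD(1)[OF G]
    note A = O[OF x] O[OF y] is_fctrD(2)[OF F x y f] is_fctrD(2)[OF G x y f]
      nat_transD(1)[OF \<alpha> x] nat_transD(1)[OF \<alpha> y] \<beta>(1)[OF x] \<beta>(1)[OF y]
    have "Cmp D (?G x) (?G y) (?F y) (\<beta> y) (Far G x y f) = Cmp D (?G x) (?G y) (?F y) (\<beta> y)
        (Cmp D (?G x) (?G x) (?G y) (Far G x y f) (Cmp D (?G x) (?F x) (?G x) (\<alpha> x) (\<beta> x)))"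
      using A \<beta>(3)[OF x] by (simp add: D.Cmp_Idn_right)
    also have "\<dots> = Cmp D (?G x) (?G y) (?F y) (\<beta> y)
        (Cmp D (?G x) (?F x) (?G y) (Cmp D (?F x) (?G x) (?G y) (Far G x y f) (\<alpha> x)) (\<beta> x))"
      using A by (simp add: D.Cmp_assoc)
    also have "\<dots> = Cmp D (?G x) (?G y) (?F y) (\<beta> y)
        (Cmp D (?G x) (?F x) (?G y) (Cmp D (?F x) (?F y) (?G y) (\<alpha> y) (Far F x y f)) (\<beta> x))"
      by (simp only: nat_transD(2)[OF \<alpha> x y f])
    also have "\<dots> = Cmp D (?G x) (?F y) (?F y) (Cmp D (?F y) (?G y) (?F y) (\<beta> y) (\<alpha> y))
        (Cmp D (?G x) (?F x) (?F y) (Far F x y f) (\<beta> x))"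
      using A by (simp add: D.Cmp_assoc D.Cmp_Hom)
    also have "\<dots> = Cmp D (?G x) (?F x) (?F y) (Far F x y f) (\<beta> x)"
      using A \<beta>(2)[OF y] by (simp add: D.Cmp_Idn_left D.Cmp_Hom)
    finally show "Cmp D (?G x) (?G y) (?F y) (\<beta> y) (Far G x y f) =
        Cmp D (?G x) (?F x) (?F y) (Far F x y f) (\<beta> x)" .
  qed (fact \<beta>(1))
  then show ?thesis
    unfolding iso_arrow_def using \<alpha> \<beta> by (auto intro!: bexI[of _ "restrict \<beta> (Obj C)"] restrict_ext)
qed

section \<open>Functors to modules and their subfunctors\<close>

abbreviation module_functor :: "('o, 'm) cat \<Rightarrow> ('r, 'a) ring_scheme \<Rightarrow>
    ('o, 'm, ('r, 'v) module, 'v \<Rightarrow> 'v) fctr \<Rightarrow> bool" where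
  "module_functor C R \<equiv> is_fctr C (left_modules R)"

abbreviation val :: "('o, 'm, ('r, 'v) module, 'v \<Rightarrow> 'v) fctr \<Rightarrow> 'o \<Rightarrow> 'v set" where
  "val F x \<equiv> carrier (Fob F x)"

abbreviation zero_at :: "('o, 'm, ('r, 'v) module, 'v \<Rightarrow> 'v) fctr \<Rightarrow> 'o \<Rightarrow> 'v" where
  "zero_at F x \<equiv> \<zero>\<^bsub>Fob F x\<^esub>"

lemma module_functorD:
  assumes F: "module_functor C R F"
  shows "x \<in> Obj C \<Longrightarrow> left_module R (Fob F x)"
    "\<lbrakk>x \<in> Obj C; y \<in> Obj C; f \<in> Hom C x y\<rbrakk> \<Longrightarrow> Far F x y f \<in> linear_maps R (Fob F x) (Fob F y)"
    "\<lbrakk>x \<in> Obj C; v \<in> val F x\<rbrakk> \<Longrightarrow> Far F x x (Idn C x) v = v"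
    "\<lbrakk>x \<in> Obj C; y \<in> Obj C; z \<in> Obj C; f \<in> Hom C x y; g \<in> Hom C y z; v \<in> val F x\<rbrakk> \<Longrightarrow>
      Far F x z (Cmp C x y z g f) v = Far F y z g (Far F x y f v)"
    "\<lbrakk>x \<in> Obj C; y \<in> Obj C; f \<in> Hom C x y; v \<in> val F x\<rbrakk> \<Longrightarrow> Far F x y f v \<in> val F y"
    "\<lbrakk>x \<in> Obj C; y \<in> Obj C; f \<in> Hom C x y\<rbrakk> \<Longrightarrow> Far F x y f (zero_at F x) = zero_at F y"
  using is_fctrD[OF F] linear_mapsD(1)[where \<phi> = "Far F x y f" and R = R and M = "Fob F x" and N = "Fob F y"] linear_zero[of R "Fob F x" "Fob F y" "Far F x y f"]
  by (auto simp: compose_def)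

lemma module_functorI:
  assumes C: "category C"
    and "\<And>x. x \<in> Obj C \<Longrightarrow> left_module R (Fob F x)"
    "\<And>x y f. \<lbrakk>x \<in> Obj C; y \<in> Obj C; f \<in> Hom C x y\<rbrakk> \<Longrightarrow> Far F x y f \<in> linear_maps R (Fob F x) (Fob F y)"
    "\<And>x v. \<lbrakk>x \<in> Obj C; v \<in> val F x\<rbrakk> \<Longrightarrow> Far F x x (Idn C x) v = v"
    "\<And>x y z f g v. \<lbrakk>x \<in> Obj C; y \<in> Obj C; z \<in> Obj C; f \<in> Hom C x y; g \<in> Hom C y z; v \<in> val F x\<rbrakk> \<Longrightarrow>
      Far F x z (Cmp C x y z g f) v = Far F y z g (Far F x y f v)"
  shows "module_functor C R F"
proof -
  interpret category C by fact
  show ?thesis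
    unfolding is_fctr_def left_modules_simps
  proof (intro conjI ballI)
    fix x assume x: "x \<in> Obj C"
    show "Far F x x (Idn C x) = (\<lambda>v\<in>val F x. v)"
      by (rule extensionalityI[OF linear_mapsD(4)[OF assms(3)]]) (use x assms(4) Idn_Hom in auto)
  next
    fix x y z f g
    assume *: "x \<in> Obj C" "y \<in> Obj C" "z \<in> Obj C" "f \<in> Hom C x y" "g \<in> Hom C y z"
    show "Far F x z (Cmp C x y z g f) = compose (val F x) (Far F y z g) (Far F x y f)"
      by (rule extensionalityI[OF linear_mapsD(4)[OF assms(3)]])
        (use * assms(5) Cmp_Hom in \<open>auto simp: compose_def\<close>)
  qed (use assms in auto)
qed

lemma module_nat_transD:
  assumes F: "module_functor C R F" and G: "module_functor C R G"
    and \<alpha>: "\<alpha> \<in> nat_trans C (left_modules R) F G"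
  shows "x \<in> Obj C \<Longrightarrow> \<alpha> x \<in> linear_maps R (Fob F x) (Fob G x)"
    "\<lbrakk>x \<in> Obj C; y \<in> Obj C; f \<in> Hom C x y; v \<in> val F x\<rbrakk> \<Longrightarrow>
      \<alpha> y (Far F x y f v) = Far G x y f (\<alpha> x v)"
proof -
  show "\<alpha> x \<in> linear_maps R (Fob F x) (Fob G x)" if "x \<in> Obj C"
    using nat_transD(1)[OF \<alpha>] that by simp
  show "\<alpha> y (Far F x y f v) = Far G x y f (\<alpha> x v)"
    if *: "x \<in> Obj C" "y \<in> Obj C" "f \<in> Hom C x y" "v \<in> val F x"
    using fun_cong[OF nat_transD(2)[OF \<alpha> *(1-3)], of v] *(4) by (simp add: compose_def)
qed

lemma module_nat_transI:
  assumes "\<And>x. x \<in> Obj C \<Longrightarrow> \<alpha> x \<in> linear_maps R (Fob F x) (Fob G x)"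
    "\<And>x y f v. \<lbrakk>x \<in> Obj C; y \<in> Obj C; f \<in> Hom C x y; v \<in> val F x\<rbrakk> \<Longrightarrow>
      \<alpha> y (Far F x y f v) = Far G x y f (\<alpha> x v)"
  shows "restrict \<alpha> (Obj C) \<in> nat_trans C (left_modules R) F G"
  by (rule nat_transI) (use assms in \<open>auto simp: compose_def fun_eq_iff\<close>)

definition subfctr :: "('o, 'm) cat \<Rightarrow> ('r, 'a) ring_scheme \<Rightarrow>
    ('o, 'm, ('r, 'v) module, 'v \<Rightarrow> 'v) fctr \<Rightarrow> ('o \<Rightarrow> 'v set) \<Rightarrow> bool" where
  "subfctr C R F N \<longleftrightarrow> (\<forall>x\<in>Obj C. submod R (Fob F x) (N x)) \<and>
     (\<forall>x\<in>Obj C. \<forall>y\<in>Obj C. \<forall>f\<in>Hom C x y. \<forall>v\<in>N x. Far F x y f v \<in> N y)"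

lemma subfctrD:
  assumes "subfctr C R F N"
  shows "x \<in> Obj C \<Longrightarrow> submod R (Fob F x) (N x)"
    "\<lbrakk>x \<in> Obj C; y \<in> Obj C; f \<in> Hom C x y; v \<in> N x\<rbrakk> \<Longrightarrow> Far F x y f v \<in> N y"
  using assms by (auto simp: subfctr_def)

lemma subfctr_inclusion:
  assumes C: "category C" and F: "module_functor C R F" and N: "subfctr C R F N"
  defines "G \<equiv> \<lparr>Fob = (\<lambda>x. (Fob F x)\<lparr>carrier := N x\<rparr>), Far = (\<lambda>x y f. restrict (Far F x y f) (N x))\<rparr>"
  shows "module_functor C R G"
    and "(\<lambda>x\<in>Obj C. \<lambda>v\<in>N x. v) \<in> nat_trans C (left_modules R) G F"
proof -
  note F = module_functorD[OF F]
  note N = subfctrD[OF N]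
  note NF = submodD(1)[OF N(1)]
  show "module_functor C R G"
  proof (rule module_functorI[OF C])
    fix x assume x: "x \<in> Obj C"
    then show "left_module R (Fob G x)"
      unfolding G_def using submod_left_module[OF F(1) N(1)] by simp
    fix y f assume y: "y \<in> Obj C" "f \<in> Hom C x y"
    show "Far G x y f \<in> linear_maps R (Fob G x) (Fob G y)"
      using linear_restrictI[OF \<open>left_module R (Fob G x)\<close>, of "Far F x y f" "Fob G y"]
        N(2)[OF x y] NF[OF x] linear_mapsD[OF F(2)[OF x y]]
      unfolding G_def by simp
  qed (use F N NF in \<open>auto simp: G_def category.Idn_Hom[OF C] category.Cmp_Hom[OF C]\<close>)
  show "(\<lambda>x\<in>Obj C. \<lambda>v\<in>N x. v) \<in> nat_trans C (left_modules R) G F"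
    by (rule module_nat_transI)
      (use N NF submod_inclusion[OF F(1) N(1)] in \<open>auto simp: G_def\<close>)
qed

lemma module_functors_concrete:
  fixes C :: "('o, 'm) cat" and R :: "('r, 'a) ring_scheme"
  assumes C: "category C"
  shows "concrete_category (functor_category C (left_modules R :: (('r, 'v) module, _) cat)) (Obj C)
    (\<lambda>F x. val F x) (\<lambda>\<alpha> x. \<alpha> x) (\<lambda>F x. zero_at F x) (subfctr C R)"
proof (intro concrete_category.intro functor_category_category left_modules_category
    concrete_category_axioms.intro; unfold functor_category_simps)
  note D = module_functorD
  fix F :: "('o, 'm, ('r, 'v) module, 'v \<Rightarrow> 'v) fctr" and x
  assume F: "module_functor C R F" and x: "x \<in> Obj C"
  interpret left_module R "Fob F x" by (rule D(1)[OF F x])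
  show "zero_at F x \<in> val F x" by simp
next
  note D = module_functorD
  fix F G :: "('o, 'm, ('r, 'v) module, 'v \<Rightarrow> 'v) fctr" and \<alpha>
  assume F: "module_functor C R F" and G: "module_functor C R G"
    and \<alpha>: "\<alpha> \<in> nat_trans C (left_modules R) F G"
  note lin = module_nat_transD(1)[OF F G \<alpha>] and nat = module_nat_transD(2)[OF F G \<alpha>]
  show "\<alpha> x v \<in> val G x" if "x \<in> Obj C" "v \<in> val F x" for x v
    using linear_mapsD(1)[OF lin] that by blast
  show "\<alpha> x (zero_at F x) = zero_at G x" if x: "x \<in> Obj C" for x
    by (rule linear_zero[OF D(1)[OF F x] D(1)[OF G x] lin[OF x]])
  show "\<alpha> = \<beta>" if \<beta>: "\<beta> \<in> nat_trans C (left_modules R) F G"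
    and eq: "\<And>x v. \<lbrakk>x \<in> Obj C; v \<in> val F x\<rbrakk> \<Longrightarrow> \<alpha> x v = \<beta> x v" for \<beta>
  proof (rule extensionalityI[OF nat_transD(3)[OF \<alpha>] nat_transD(3)[OF \<beta>]])
    fix x assume x: "x \<in> Obj C"
    show "\<alpha> x = \<beta> x"
      using linear_mapsD(4)[OF lin[OF x]] linear_mapsD(4)[OF module_nat_transD(1)[OF F G \<beta> x]] eq x
      by (intro extensionalityI) auto
  qed
  show "iso_arrow (functor_category C (left_modules R)) F G \<alpha>"
    if "\<And>x. x \<in> Obj C \<Longrightarrow> bij_betw (\<alpha> x) (val F x) (val G x)"
    by (rule nat_trans_iso[OF left_modules_category F G \<alpha>])
      (use that in \<open>auto intro!: linear_bij_iso D(1)[OF F] D(1)[OF G] lin\<close>)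
  show "inj_on (\<alpha> x) (val F x)" if x: "x \<in> Obj C"
    and "\<And>v. \<lbrakk>v \<in> val F x; \<alpha> x v = zero_at G x\<rbrakk> \<Longrightarrow> v = zero_at F x" for x
    by (rule linear_inj[OF D(1)[OF F x] D(1)[OF G x] lin[OF x]]) (use that in auto)
  show "subfctr C R F (\<lambda>x. {v \<in> val F x. \<alpha> x v = zero_at G x})"
    unfolding subfctr_def
    using submod_kernel[OF D(1)[OF F] D(1)[OF G] lin] D(5,6)[OF F] D(6)[OF G] nat by auto
  show "subfctr C R G (\<lambda>x. \<alpha> x ` val F x)"
    unfolding subfctr_def
    using submod_image[OF D(1)[OF F] D(1)[OF G] lin] D(5)[OF F] by (auto simp flip: nat)
next
  note D = module_functorD
  fix F G :: "('o, 'm, ('r, 'v) module, 'v \<Rightarrow> 'v) fctr"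
  assume F: "module_functor C R F" and G: "module_functor C R G"
  have "(\<lambda>x\<in>Obj C. \<lambda>v\<in>val F x. zero_at G x) \<in> nat_trans C (left_modules R) F G"
    by (rule module_nat_transI)
      (use zero_linear[OF D(1)[OF F] D(1)[OF G]] D(5)[OF F] D(6)[OF G] in auto)
  then show "\<exists>\<alpha>\<in>nat_trans C (left_modules R) F G. \<forall>x\<in>Obj C. \<forall>v\<in>val F x. \<alpha> x v = zero_at G x"
    by (rule rev_bexI) auto
next
  fix F :: "('o, 'm, ('r, 'v) module, 'v \<Rightarrow> 'v) fctr" and N
  assume F: "module_functor C R F" and N: "subfctr C R F N"
  show "\<exists>G\<in>Obj (functor_category C (left_modules R)). \<exists>\<alpha>\<in>nat_trans C (left_modules R) G F.
      \<forall>x\<in>Obj C. val G x = N x \<and> (\<forall>v\<in>N x. \<alpha> x v = v)"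
    using subfctr_inclusion[OF C F N] by (intro bexI) auto
qed (auto simp: compose_def dest: subfctrD submodD)

lemma simple_functor_iff:
  assumes "category C"
  shows "simple_object (functor_category C (left_modules R)) F \<longleftrightarrow>
    module_functor C R F \<and> (\<exists>x\<in>Obj C. val F x \<noteq> {zero_at F x}) \<and>
    (\<forall>N. subfctr C R F N \<longrightarrow>
       (\<forall>x\<in>Obj C. N x = {zero_at F x}) \<or> (\<forall>x\<in>Obj C. N x = val F x))"
  using concrete_category.simple_object_iff[OF module_functors_concrete[OF assms]] by simp

section \<open>Modules over the group algebra of a finite group\<close>

lemma (in abelian_monoid) finsum_swap:
  assumes "finite A" "finite B" "\<And>a b. \<lbrakk>a \<in> A; b \<in> B\<rbrakk> \<Longrightarrow> f a b \<in> carrier G"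
  shows "(\<Oplus>a\<in>A. \<Oplus>b\<in>B. f a b) = (\<Oplus>b\<in>B. \<Oplus>a\<in>A. f a b)"
  using assms(1,3)
proof (induction set: finite)
  case (insert x A)
  have "(\<Oplus>a\<in>insert x A. \<Oplus>b\<in>B. f a b) = (\<Oplus>b\<in>B. f x b) \<oplus> (\<Oplus>b\<in>B. \<Oplus>a\<in>A. f a b)"
    using insert by (simp add: Pi_def)
  also have "\<dots> = (\<Oplus>b\<in>B. f x b \<oplus> (\<Oplus>a\<in>A. f a b))"
    using insert by (simp add: finsum_addf Pi_def)
  also have "\<dots> = (\<Oplus>b\<in>B. \<Oplus>a\<in>insert x A. f a b)"
    using insert by (intro finsum_cong') (auto simp: Pi_def)
  finally show ?case .
qed simp

text \<open>
The multiple of the group element \<open>g\<close> by the scalar \<open>a\<close>.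
\<close>

definition basis_elt :: "('k, 'a) ring_scheme \<Rightarrow> ('g, 'b) monoid_scheme \<Rightarrow> 'k \<Rightarrow> 'g \<Rightarrow> ('g \<Rightarrow> 'k)" where
  "basis_elt K G a g = (\<lambda>h\<in>carrier G. if h = g then a else \<zero>\<^bsub>K\<^esub>)"

definition scalar_restriction :: "('k, 'a) ring_scheme \<Rightarrow> ('g, 'b) monoid_scheme \<Rightarrow>
    ('g \<Rightarrow> 'k, 'v) module \<Rightarrow> ('k, 'v) module" where
  "scalar_restriction K G M =
     \<lparr>carrier = carrier M, monoid.mult = monoid.mult M, monoid.one = monoid.one M, ring.zero = ring.zero M, ring.add = ring.add M,
      module.smult = (\<lambda>a v. basis_elt K G a \<one>\<^bsub>G\<^esub> \<odot>\<^bsub>M\<^esub> v)\<rparr>"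

text \<open>
A module over the group algebra amounts to a module over \<open>K\<close> together with a linear action of the
group. The two constructions \<open>scalar_restriction\<close> and \<open>rep_module\<close> pass between these views.
\<close>

definition rep_module :: "('g, 'b) monoid_scheme \<Rightarrow> ('k, 'v) module \<Rightarrow> ('g \<Rightarrow> 'v \<Rightarrow> 'v) \<Rightarrow>
    ('g \<Rightarrow> 'k, 'v) module" where
  "rep_module G V \<rho> =
     \<lparr>carrier = carrier V, monoid.mult = monoid.mult V, monoid.one = monoid.one V, ring.zero = ring.zero V, ring.add = ring.add V,
      module.smult = (\<lambda>p v. \<Oplus>\<^bsub>V\<^esub>g\<in>carrier G. p g \<odot>\<^bsub>V\<^esub> \<rho> g v)\<rparr>"

lemma scalar_restriction_simps [simp]:
  "carrier (scalar_restriction K G M) = carrier M" "ring.zero (scalar_restriction K G M) = ring.zero M"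
  "ring.add (scalar_restriction K G M) = ring.add M"
  "module.smult (scalar_restriction K G M) a v = basis_elt K G a \<one>\<^bsub>G\<^esub> \<odot>\<^bsub>M\<^esub> v"
  by (simp_all add: scalar_restriction_def)

lemma rep_module_simps [simp]:
  "carrier (rep_module G V \<rho>) = carrier V" "ring.zero (rep_module G V \<rho>) = ring.zero V"
  "ring.add (rep_module G V \<rho>) = ring.add V"
  "module.smult (rep_module G V \<rho>) p v = (\<Oplus>\<^bsub>V\<^esub>g\<in>carrier G. p g \<odot>\<^bsub>V\<^esub> \<rho> g v)"
  by (simp_all add: rep_module_def)

text \<open>
Finite sums do not see the scalar multiplication, so a sum may be moved between a module over the
group algebra and its restriction of scalars, whose record types differ.
\<close>

lemma finsum_eqI: "ring.add M = ring.add N \<Longrightarrow> ring.zero M = ring.zero N \<Longrightarrow> carrier M = carrier N \<Longrightarrow> finsum M f A = finsum N f A"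
  by (simp add: finsum_def finprod_def)

locale finite_group_algebra = G: group G + K: cring K
  for G :: "('g, 'b) monoid_scheme" and K :: "('k, 'a) ring_scheme" (structure) +
  assumes fin: "finite (carrier G)"
begin

abbreviation KG :: "('g \<Rightarrow> 'k) ring" where "KG \<equiv> group_algebra K G"
abbreviation \<delta> :: "'k \<Rightarrow> 'g \<Rightarrow> 'g \<Rightarrow> 'k" where "\<delta> \<equiv> basis_elt K G"

lemma carrier_KG: "carrier KG = carrier G \<rightarrow>\<^sub>E carrier K"
  using fin by (auto simp: group_algebra_def)

lemma KG_in: "p \<in> carrier KG \<Longrightarrow> g \<in> carrier G \<Longrightarrow> p g \<in> carrier K"
  by (auto simp: carrier_KG)

lemma KG_simps [simp]:
  "\<zero>\<^bsub>KG\<^esub> = (\<lambda>g\<in>carrier G. \<zero>)"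
  "p \<oplus>\<^bsub>KG\<^esub> q = (\<lambda>g\<in>carrier G. p g \<oplus> q g)"
  "\<one>\<^bsub>KG\<^esub> = \<delta> \<one> \<one>\<^bsub>G\<^esub>"
  by (auto simp: group_algebra_def basis_elt_def)

lemma KG_mult:
  assumes p: "p \<in> carrier KG" and q: "q \<in> carrier KG"
  shows "p \<otimes>\<^bsub>KG\<^esub> q = (\<lambda>g\<in>carrier G. \<Oplus>h\<in>carrier G. p h \<otimes> q (inv\<^bsub>G\<^esub> h \<otimes>\<^bsub>G\<^esub> g))"
  unfolding group_algebra_def monoid.simps
proof (rule restrict_ext)
  fix g assume g: "g \<in> carrier G"
  show "(\<Oplus>h\<in>{h \<in> carrier G. p h \<noteq> \<zero>}. p h \<otimes> q (inv\<^bsub>G\<^esub> h \<otimes>\<^bsub>G\<^esub> g)) =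
      (\<Oplus>h\<in>carrier G. p h \<otimes> q (inv\<^bsub>G\<^esub> h \<otimes>\<^bsub>G\<^esub> g))"
    using fin g KG_in[OF p] KG_in[OF q]
    by (intro K.add.finprod_mono_neutral_cong_left) auto
qed

lemma KG_mult_closed:
  assumes "p \<in> carrier KG" "q \<in> carrier KG" shows "p \<otimes>\<^bsub>KG\<^esub> q \<in> carrier KG"
  using KG_in[OF assms(1)] KG_in[OF assms(2)]
  unfolding KG_mult[OF assms] by (auto simp: carrier_KG intro!: K.finsum_closed)

lemma KG_eqI: "\<lbrakk>p \<in> carrier KG; q \<in> carrier KG; \<And>g. g \<in> carrier G \<Longrightarrow> p g = q g\<rbrakk> \<Longrightarrow> p = q"
  unfolding carrier_KG by (rule PiE_ext)

lemma basis_elt_in: "a \<in> carrier K \<Longrightarrow> \<delta> a g \<in> carrier KG"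
  by (auto simp: carrier_KG basis_elt_def)

lemma finsum_left_translate:
  assumes M: "abelian_monoid M" and g: "g \<in> carrier G" and f: "f \<in> carrier G \<rightarrow> carrier M"
  shows "(\<Oplus>\<^bsub>M\<^esub>h\<in>carrier G. f h) = (\<Oplus>\<^bsub>M\<^esub>h\<in>carrier G. f (g \<otimes>\<^bsub>G\<^esub> h))"
proof -
  interpret M: abelian_monoid M by fact
  have "(\<lambda>h. g \<otimes>\<^bsub>G\<^esub> h) ` carrier G = carrier G"
    using G.surj_const_mult[OF g] by simp
  then show ?thesis
    using M.finsum_reindex[of f "\<lambda>h. g \<otimes>\<^bsub>G\<^esub> h" "carrier G"] G.inj_on_cmult[OF g] f by simp
qed

text \<open>
Both products evaluate at \<open>g\<close> to a double sum of terms \<open>p(h) q(k) r(k\<inverse> h\<inverse> g)\<close>, after the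
substitution \<open>k \<mapsto> h k\<close> in the inner sum.
\<close>

lemma KG_mult_assoc:
  assumes p: "p \<in> carrier KG" and q: "q \<in> carrier KG" and r: "r \<in> carrier KG"
  shows "(p \<otimes>\<^bsub>KG\<^esub> q) \<otimes>\<^bsub>KG\<^esub> r = p \<otimes>\<^bsub>KG\<^esub> (q \<otimes>\<^bsub>KG\<^esub> r)"
proof (rule KG_eqI)
  note pq = KG_mult_closed[OF p q] and qr = KG_mult_closed[OF q r]
  note in_K = KG_in[OF p] KG_in[OF q] KG_in[OF r]
  show "(p \<otimes>\<^bsub>KG\<^esub> q) \<otimes>\<^bsub>KG\<^esub> r \<in> carrier KG" "p \<otimes>\<^bsub>KG\<^esub> (q \<otimes>\<^bsub>KG\<^esub> r) \<in> carrier KG"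
    by (intro KG_mult_closed p q r)+
  fix g assume g: "g \<in> carrier G"
  let ?i = "\<lambda>h. inv\<^bsub>G\<^esub> h"
  have "((p \<otimes>\<^bsub>KG\<^esub> q) \<otimes>\<^bsub>KG\<^esub> r) g =
      (\<Oplus>k\<in>carrier G. (\<Oplus>h\<in>carrier G. p h \<otimes> q (?i h \<otimes>\<^bsub>G\<^esub> k)) \<otimes> r (?i k \<otimes>\<^bsub>G\<^esub> g))"
    using g in_K unfolding KG_mult[OF pq r] unfolding KG_mult[OF p q]
    by (auto intro!: K.finsum_cong' K.finsum_closed)
  also have "\<dots> = (\<Oplus>k\<in>carrier G. \<Oplus>h\<in>carrier G.
      p h \<otimes> (q (?i h \<otimes>\<^bsub>G\<^esub> k) \<otimes> r (?i k \<otimes>\<^bsub>G\<^esub> g)))"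
    using g in_K fin
    by (intro K.finsum_cong') (auto simp: K.finsum_ldistr K.m_assoc Pi_def intro!: K.finsum_cong')
  also have "\<dots> = (\<Oplus>h\<in>carrier G. \<Oplus>k\<in>carrier G.
      p h \<otimes> (q (?i h \<otimes>\<^bsub>G\<^esub> k) \<otimes> r (?i k \<otimes>\<^bsub>G\<^esub> g)))"
    using g in_K by (intro K.finsum_swap[OF fin fin]) auto
  also have "\<dots> = (\<Oplus>h\<in>carrier G. p h \<otimes>
      (\<Oplus>k\<in>carrier G. q k \<otimes> r (?i k \<otimes>\<^bsub>G\<^esub> (?i h \<otimes>\<^bsub>G\<^esub> g))))"
  proof (rule K.finsum_cong')
    show "carrier G = carrier G" ..
    show "(\<lambda>h. p h \<otimes> (\<Oplus>k\<in>carrier G. q k \<otimes> r (?i k \<otimes>\<^bsub>G\<^esub> (?i h \<otimes>\<^bsub>G\<^esub> g))))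
        \<in> carrier G \<rightarrow> carrier K"
      using g in_K by (auto intro!: K.finsum_closed)
    fix h assume h: "h \<in> carrier G"
    have "(\<Oplus>k\<in>carrier G. p h \<otimes> (q (?i h \<otimes>\<^bsub>G\<^esub> k) \<otimes> r (?i k \<otimes>\<^bsub>G\<^esub> g)))
      = (\<Oplus>k\<in>carrier G. p h \<otimes> (q (?i h \<otimes>\<^bsub>G\<^esub> (h \<otimes>\<^bsub>G\<^esub> k)) \<otimes> r (?i (h \<otimes>\<^bsub>G\<^esub> k) \<otimes>\<^bsub>G\<^esub> g)))"
      using g h in_K by (intro finsum_left_translate) (auto simp: K.abelian_monoid_axioms)
    also have "\<dots> = (\<Oplus>k\<in>carrier G. p h \<otimes> (q k \<otimes> r (?i k \<otimes>\<^bsub>G\<^esub> (?i h \<otimes>\<^bsub>G\<^esub> g))))"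
      using g h in_K
      by (intro K.finsum_cong') (auto simp: G.inv_mult_group G.m_assoc simp flip: G.m_assoc[of "?i h" h])
    also have "\<dots> = p h \<otimes> (\<Oplus>k\<in>carrier G. q k \<otimes> r (?i k \<otimes>\<^bsub>G\<^esub> (?i h \<otimes>\<^bsub>G\<^esub> g)))"
      using g h in_K fin by (intro K.finsum_rdistr[symmetric]) auto
    finally show "(\<Oplus>k\<in>carrier G. p h \<otimes> (q (?i h \<otimes>\<^bsub>G\<^esub> k) \<otimes> r (?i k \<otimes>\<^bsub>G\<^esub> g)))
      = p h \<otimes> (\<Oplus>k\<in>carrier G. q k \<otimes> r (?i k \<otimes>\<^bsub>G\<^esub> (?i h \<otimes>\<^bsub>G\<^esub> g)))" .
  qed
  also have "\<dots> = (p \<otimes>\<^bsub>KG\<^esub> (q \<otimes>\<^bsub>KG\<^esub> r)) g"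
    using g in_K unfolding KG_mult[OF p qr] unfolding KG_mult[OF q r]
    by (auto intro!: K.finsum_cong' K.finsum_closed)
  finally show "((p \<otimes>\<^bsub>KG\<^esub> q) \<otimes>\<^bsub>KG\<^esub> r) g = (p \<otimes>\<^bsub>KG\<^esub> (q \<otimes>\<^bsub>KG\<^esub> r)) g" .
qed

lemma basis_elt_mult_left:
  assumes a: "a \<in> carrier K" and g: "g \<in> carrier G" and q: "q \<in> carrier KG" and x: "x \<in> carrier G"
  shows "(\<delta> a g \<otimes>\<^bsub>KG\<^esub> q) x = a \<otimes> q (inv\<^bsub>G\<^esub> g \<otimes>\<^bsub>G\<^esub> x)"
proof -
  have "(\<delta> a g \<otimes>\<^bsub>KG\<^esub> q) x =
      (\<Oplus>h\<in>carrier G. if g = h then a \<otimes> q (inv\<^bsub>G\<^esub> h \<otimes>\<^bsub>G\<^esub> x) else \<zero>)"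
    unfolding KG_mult[OF basis_elt_in[OF a] q] using KG_in[OF q] a x
    by (auto simp: basis_elt_def intro!: K.finsum_cong')
  also have "\<dots> = a \<otimes> q (inv\<^bsub>G\<^esub> g \<otimes>\<^bsub>G\<^esub> x)"
    using KG_in[OF q] a x by (intro K.finsum_singleton[OF g fin]) auto
  finally show ?thesis .
qed

lemma basis_elt_mult:
  assumes "a \<in> carrier K" "b \<in> carrier K" "g \<in> carrier G" "h \<in> carrier G"
  shows "\<delta> a g \<otimes>\<^bsub>KG\<^esub> \<delta> b h = \<delta> (a \<otimes> b) (g \<otimes>\<^bsub>G\<^esub> h)"
proof (rule KG_eqI)
  fix x assume x: "x \<in> carrier G"
  have "inv\<^bsub>G\<^esub> g \<otimes>\<^bsub>G\<^esub> x = h \<longleftrightarrow> x = g \<otimes>\<^bsub>G\<^esub> h"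
    using assms x G.inv_solve_left'[of h g x] by auto
  then show "(\<delta> a g \<otimes>\<^bsub>KG\<^esub> \<delta> b h) x = \<delta> (a \<otimes> b) (g \<otimes>\<^bsub>G\<^esub> h) x"
    using assms x by (simp add: basis_elt_mult_left basis_elt_in) (simp add: basis_elt_def)
qed (use assms in \<open>auto intro!: KG_mult_closed basis_elt_in\<close>)

lemma KG_ring: "ring KG"
proof (rule ringI)
  show "abelian_group KG"
  proof (rule abelian_groupI)
    fix p assume p: "p \<in> carrier KG"
    show "\<exists>q\<in>carrier KG. q \<oplus>\<^bsub>KG\<^esub> p = \<zero>\<^bsub>KG\<^esub>"
      using KG_in[OF p]
      by (intro bexI[of _ "\<lambda>g\<in>carrier G. \<ominus> p g"]) (auto simp: carrier_KG K.l_neg intro!: restrict_ext)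
    show "\<zero>\<^bsub>KG\<^esub> \<oplus>\<^bsub>KG\<^esub> p = p"
      by (rule KG_eqI) (use KG_in[OF p] p in \<open>auto simp: carrier_KG\<close>)
  qed (auto simp: carrier_KG intro!: restrict_ext K.a_assoc K.a_comm)
  show "monoid KG"
  proof (rule monoidI)
    show "\<one>\<^bsub>KG\<^esub> \<in> carrier KG" by (simp add: basis_elt_in)
    fix p assume p: "p \<in> carrier KG"
    show "\<one>\<^bsub>KG\<^esub> \<otimes>\<^bsub>KG\<^esub> p = p"
      by (rule KG_eqI)
        (use p KG_in[OF p] in \<open>auto simp: basis_elt_mult_left intro!: KG_mult_closed basis_elt_in\<close>)
    show "p \<otimes>\<^bsub>KG\<^esub> \<one>\<^bsub>KG\<^esub> = p"
    proof (rule KG_eqI)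
      fix g assume g: "g \<in> carrier G"
      have eq: "inv\<^bsub>G\<^esub> h \<otimes>\<^bsub>G\<^esub> g = \<one>\<^bsub>G\<^esub> \<longleftrightarrow> g = h" if h: "h \<in> carrier G" for h
        using g h G.inv_solve_left'[of "\<one>\<^bsub>G\<^esub>" h g] by auto
      have "(p \<otimes>\<^bsub>KG\<^esub> \<one>\<^bsub>KG\<^esub>) g = (\<Oplus>h\<in>carrier G. if g = h then p h else \<zero>)"
        unfolding KG_simps KG_mult[OF p basis_elt_in[OF K.one_closed]]
        using KG_in[OF p] g by (auto simp: basis_elt_def eq intro!: K.finsum_cong')
      also have "\<dots> = p g" using KG_in[OF p] by (intro K.finsum_singleton[OF g fin]) auto
      finally show "(p \<otimes>\<^bsub>KG\<^esub> \<one>\<^bsub>KG\<^esub>) g = p g" .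
    qed (use p in \<open>auto intro!: KG_mult_closed basis_elt_in\<close>)
  qed (auto intro: KG_mult_closed KG_mult_assoc)
next
  fix p q r assume *: "p \<in> carrier KG" "q \<in> carrier KG" "r \<in> carrier KG"
  note in_K = KG_in[OF *(1)] KG_in[OF *(2)] KG_in[OF *(3)]
  have pq: "p \<oplus>\<^bsub>KG\<^esub> q \<in> carrier KG" using * by (auto simp: carrier_KG)
  show "(p \<oplus>\<^bsub>KG\<^esub> q) \<otimes>\<^bsub>KG\<^esub> r = p \<otimes>\<^bsub>KG\<^esub> r \<oplus>\<^bsub>KG\<^esub> q \<otimes>\<^bsub>KG\<^esub> r"
    unfolding KG_mult[OF pq *(3)] KG_mult[OF *(1,3)] KG_mult[OF *(2,3)] unfolding KG_simps
    using in_K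
    by (auto simp: K.l_distr simp flip: K.finsum_addf intro!: restrict_ext K.finsum_cong')
  show "r \<otimes>\<^bsub>KG\<^esub> (p \<oplus>\<^bsub>KG\<^esub> q) = r \<otimes>\<^bsub>KG\<^esub> p \<oplus>\<^bsub>KG\<^esub> r \<otimes>\<^bsub>KG\<^esub> q"
    unfolding KG_mult[OF *(3) pq] KG_mult[OF *(3,1)] KG_mult[OF *(3,2)] unfolding KG_simps
    using in_K
    by (auto simp: K.r_distr simp flip: K.finsum_addf intro!: restrict_ext K.finsum_cong')
qed

lemma KG_finsum_eval:
  assumes "finite A" "f \<in> A \<rightarrow> carrier KG" "g \<in> carrier G"
  shows "(\<Oplus>\<^bsub>KG\<^esub>i\<in>A. f i) g = (\<Oplus>i\<in>A. f i g)"
proof -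
  interpret KG: ring KG by (rule KG_ring)
  show ?thesis
    using assms(1,2)
    by (induction set: finite) (use assms(3) in \<open>auto simp: Pi_def KG_in\<close>)
qed

lemma KG_expansion:
  assumes p: "p \<in> carrier KG"
  shows "p = (\<Oplus>\<^bsub>KG\<^esub>g\<in>carrier G. \<delta> (p g) g)"
proof (rule KG_eqI[OF p])
  interpret KG: ring KG by (rule KG_ring)
  have \<delta>: "(\<lambda>g. \<delta> (p g) g) \<in> carrier G \<rightarrow> carrier KG"
    using KG_in[OF p] basis_elt_in by auto
  then show "(\<Oplus>\<^bsub>KG\<^esub>g\<in>carrier G. \<delta> (p g) g) \<in> carrier KG" by (rule KG.finsum_closed)
  fix h assume h: "h \<in> carrier G"
  have "(\<Oplus>\<^bsub>KG\<^esub>g\<in>carrier G. \<delta> (p g) g) h = (\<Oplus>g\<in>carrier G. \<delta> (p g) g h)"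
    by (rule KG_finsum_eval[OF fin \<delta> h])
  also have "\<dots> = (\<Oplus>g\<in>carrier G. if h = g then p g else \<zero>)"
    using h KG_in[OF p] by (intro K.finsum_cong') (auto simp: basis_elt_def)
  also have "\<dots> = p h" using KG_in[OF p] by (intro K.finsum_singleton[OF h fin]) auto
  finally show "p h = (\<Oplus>\<^bsub>KG\<^esub>g\<in>carrier G. \<delta> (p g) g) h" by simp
qed

lemma smult_expansion:
  assumes M: "left_module KG M" and p: "p \<in> carrier KG" and v: "v \<in> carrier M"
  shows "p \<odot>\<^bsub>M\<^esub> v = (\<Oplus>\<^bsub>M\<^esub>g\<in>carrier G. \<delta> (p g) \<one>\<^bsub>G\<^esub> \<odot>\<^bsub>M\<^esub> (\<delta> \<one> g \<odot>\<^bsub>M\<^esub> v))"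
proof -
  interpret M: left_module KG M by fact
  have "p \<odot>\<^bsub>M\<^esub> v = (\<Oplus>\<^bsub>KG\<^esub>g\<in>carrier G. \<delta> (p g) g) \<odot>\<^bsub>M\<^esub> v"
    by (simp only: KG_expansion[OF p, symmetric])
  also have "\<dots> = (\<Oplus>\<^bsub>M\<^esub>g\<in>carrier G. \<delta> (p g) g \<odot>\<^bsub>M\<^esub> v)"
    using KG_in[OF p] basis_elt_in by (intro M.finsum_smult[OF fin v]) auto
  also have "\<dots> = (\<Oplus>\<^bsub>M\<^esub>g\<in>carrier G. \<delta> (p g) \<one>\<^bsub>G\<^esub> \<odot>\<^bsub>M\<^esub> (\<delta> \<one> g \<odot>\<^bsub>M\<^esub> v))"
    using KG_in[OF p] v
    by (intro M.M.finsum_cong')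
      (auto simp: basis_elt_in basis_elt_mult simp flip: M.smult_assoc1)
  finally show ?thesis .
qed

lemma scalar_restriction_module:
  assumes M: "left_module KG M"
  shows "left_module K (scalar_restriction K G M)"
proof -
  interpret M: left_module KG M by fact
  have "abelian_group (scalar_restriction K G M)"
    by (rule abelian_groupI) (auto simp: M.M.a_ac intro!: M.M.l_neg bexI[of _ "\<ominus>\<^bsub>M\<^esub> _"])
  moreover have "\<delta> (a \<oplus> b) \<one>\<^bsub>G\<^esub> = \<delta> a \<one>\<^bsub>G\<^esub> \<oplus>\<^bsub>KG\<^esub> \<delta> b \<one>\<^bsub>G\<^esub>"
    if "a \<in> carrier K" "b \<in> carrier K" for a b
    unfolding KG_simps using that by (auto simp: basis_elt_def intro!: restrict_ext)
  moreover have "\<delta> (a \<otimes> b) \<one>\<^bsub>G\<^esub> = \<delta> a \<one>\<^bsub>G\<^esub> \<otimes>\<^bsub>KG\<^esub> \<delta> b \<one>\<^bsub>G\<^esub>"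
    if "a \<in> carrier K" "b \<in> carrier K" for a b
    using that by (simp add: basis_elt_mult)
  moreover have "\<delta> \<one> \<one>\<^bsub>G\<^esub> \<odot>\<^bsub>M\<^esub> v = v" if "v \<in> carrier M" for v
    using M.smult_one[OF that] by simp
  ultimately show ?thesis
    unfolding left_module_def left_module_axioms_def
    by (auto simp: K.ring_axioms basis_elt_in simp del: KG_simps
        intro: M.smult_l_distr M.smult_r_distr M.smult_assoc1)
qed

text \<open>
A group algebra element acts by a linear combination of group elements, so stability under scalars
and under group elements suffices.
\<close>

lemma submod_iff:
  assumes M: "left_module KG M"
  shows "submod KG M N \<longleftrightarrow> submod K (scalar_restriction K G M) N \<and>
    (\<forall>g\<in>carrier G. \<forall>v\<in>N. \<delta> \<one> g \<odot>\<^bsub>M\<^esub> v \<in> N)" (is "?L \<longleftrightarrow> ?R")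
proof
  assume ?L
  then show ?R by (auto simp: submod_def basis_elt_in)
next
  assume R: ?R
  then have N: "submod K (scalar_restriction K G M) N" by blast
  note N' = submodD[OF N, simplified]
  have "p \<odot>\<^bsub>M\<^esub> v \<in> N" if p: "p \<in> carrier KG" and v: "v \<in> N" for p v
  proof -
    have "(\<Oplus>\<^bsub>scalar_restriction K G M\<^esub>g\<in>carrier G. \<delta> (p g) \<one>\<^bsub>G\<^esub> \<odot>\<^bsub>M\<^esub> (\<delta> \<one> g \<odot>\<^bsub>M\<^esub> v)) \<in> N"
      by (rule submod_finsum[OF scalar_restriction_module[OF M] N fin])
        (use R N' KG_in[OF p] v in auto)
    then show ?thesis
      unfolding smult_expansion[OF M p N'(1)[OF v]]
      by (subst finsum_eqI[of M "scalar_restriction K G M"]) simp_all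
  qed
  then show ?L using N' by (auto simp: submod_def)
qed

lemma linear_iff:
  assumes M: "left_module KG M" and N: "left_module KG N"
  shows "\<phi> \<in> linear_maps KG M N \<longleftrightarrow>
    \<phi> \<in> linear_maps K (scalar_restriction K G M) (scalar_restriction K G N) \<and>
    (\<forall>g\<in>carrier G. \<forall>v\<in>carrier M. \<phi> (\<delta> \<one> g \<odot>\<^bsub>M\<^esub> v) = \<delta> \<one> g \<odot>\<^bsub>N\<^esub> \<phi> v)" (is "?L \<longleftrightarrow> ?R")
proof
  assume ?L
  then show ?R by (auto simp: linear_maps_def basis_elt_in)
next
  assume R: ?R
  interpret M: left_module KG M by fact
  interpret N: left_module KG N by fact
  let ?rM = "scalar_restriction K G M" and ?rN = "scalar_restriction K G N"
  have \<phi>: "\<phi> \<in> linear_maps K ?rM ?rN" using R by blast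
  note \<phi>' = linear_mapsD[OF \<phi>, simplified]
  show ?L
  proof (rule linear_mapsI)
    fix p v assume p: "p \<in> carrier KG" and v: "v \<in> carrier M"
    have "\<phi> (p \<odot>\<^bsub>M\<^esub> v) = \<phi> (\<Oplus>\<^bsub>?rM\<^esub>g\<in>carrier G. \<delta> (p g) \<one>\<^bsub>G\<^esub> \<odot>\<^bsub>M\<^esub> (\<delta> \<one> g \<odot>\<^bsub>M\<^esub> v))"
      unfolding smult_expansion[OF M p v] by (subst finsum_eqI[of M ?rM]) simp_all
    also have "\<dots> = (\<Oplus>\<^bsub>?rN\<^esub>g\<in>carrier G. \<phi> (\<delta> (p g) \<one>\<^bsub>G\<^esub> \<odot>\<^bsub>M\<^esub> (\<delta> \<one> g \<odot>\<^bsub>M\<^esub> v)))"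
      by (rule linear_finsum[OF scalar_restriction_module[OF M] scalar_restriction_module[OF N] \<phi> fin])
        (use KG_in[OF p] v basis_elt_in in auto)
    also have "\<dots> = (\<Oplus>\<^bsub>N\<^esub>g\<in>carrier G. \<phi> (\<delta> (p g) \<one>\<^bsub>G\<^esub> \<odot>\<^bsub>M\<^esub> (\<delta> \<one> g \<odot>\<^bsub>M\<^esub> v)))"
      by (rule finsum_eqI) simp_all
    also have "\<dots> = p \<odot>\<^bsub>N\<^esub> \<phi> v"
      unfolding smult_expansion[OF N p \<phi>'(1)[OF v]] using R KG_in[OF p] v \<phi>' basis_elt_in
      by (intro N.M.finsum_cong') auto
    finally show "\<phi> (p \<odot>\<^bsub>M\<^esub> v) = p \<odot>\<^bsub>N\<^esub> \<phi> v" .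
  qed (use \<phi>' in auto)
qed

end

locale representation = finite_group_algebra G K + V: left_module K V
  for G :: "('g, 'b) monoid_scheme" and K :: "('k, 'a) ring_scheme" (structure) and V :: "('k, 'v) module" +
  fixes \<rho> :: "'g \<Rightarrow> 'v \<Rightarrow> 'v"
  assumes linear: "g \<in> carrier G \<Longrightarrow> \<rho> g \<in> linear_maps K V V"
    and rho_mult: "\<lbrakk>g \<in> carrier G; h \<in> carrier G; v \<in> carrier V\<rbrakk> \<Longrightarrow> \<rho> (g \<otimes>\<^bsub>G\<^esub> h) v = \<rho> g (\<rho> h v)"
    and rho_one: "v \<in> carrier V \<Longrightarrow> \<rho> \<one>\<^bsub>G\<^esub> v = v"
begin

lemmas rho = linear_mapsD[OF linear]

lemma rep_module_basis_elt:
  assumes a: "a \<in> carrier K" and g: "g \<in> carrier G" and v: "v \<in> carrier V"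
  shows "\<delta> a g \<odot>\<^bsub>rep_module G V \<rho>\<^esub> v = a \<odot>\<^bsub>V\<^esub> \<rho> g v"
proof -
  have "\<delta> a g \<odot>\<^bsub>rep_module G V \<rho>\<^esub> v =
      (\<Oplus>\<^bsub>V\<^esub>h\<in>carrier G. if g = h then a \<odot>\<^bsub>V\<^esub> \<rho> h v else \<zero>\<^bsub>V\<^esub>)"
    unfolding rep_module_simps using a v rho(1) by (intro V.M.finsum_cong') (auto simp: basis_elt_def)
  also have "\<dots> = a \<odot>\<^bsub>V\<^esub> \<rho> g v" using a v rho(1) by (intro V.M.finsum_singleton[OF g fin]) auto
  finally show ?thesis .
qed

lemma rep_module_left_module: "left_module KG (rep_module G V \<rho>)"
proof -
  let ?M = "rep_module G V \<rho>"
  interpret KG: ring KG by (rule KG_ring)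
  have in_V: "(\<lambda>g. p g \<odot>\<^bsub>V\<^esub> \<rho> g v) \<in> carrier G \<rightarrow> carrier V"
    if "p \<in> carrier KG" "v \<in> carrier V" for p v
    using KG_in[OF that(1)] rho(1) that(2) by auto
  have "abelian_group ?M"
    by (rule abelian_groupI) (auto simp: V.M.a_ac intro!: V.M.l_neg bexI[of _ "\<ominus>\<^bsub>V\<^esub> _"])
  then show ?thesis
    unfolding left_module_def left_module_axioms_def
  proof (intro conjI allI impI KG.ring_axioms)
    fix p v assume p: "p \<in> carrier KG" and v: "v \<in> carrier ?M"
    then show "p \<odot>\<^bsub>?M\<^esub> v \<in> carrier ?M"
      using in_V[OF p] by simp
  next
    fix p q v assume p: "p \<in> carrier KG" and q: "q \<in> carrier KG" and v: "v \<in> carrier ?M"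
    have v: "v \<in> carrier V" using v by simp
    note pq = KG_in[OF p] KG_in[OF q]
    show "(p \<oplus>\<^bsub>KG\<^esub> q) \<odot>\<^bsub>?M\<^esub> v = p \<odot>\<^bsub>?M\<^esub> v \<oplus>\<^bsub>?M\<^esub> q \<odot>\<^bsub>?M\<^esub> v"
      unfolding rep_module_simps V.M.finsum_addf[OF in_V[OF p v] in_V[OF q v], symmetric]
      using pq v rho(1) by (intro V.M.finsum_cong') (auto simp: V.smult_l_distr)
    have "(p \<otimes>\<^bsub>KG\<^esub> q) \<odot>\<^bsub>?M\<^esub> v = (\<Oplus>\<^bsub>V\<^esub>g\<in>carrier G. \<Oplus>\<^bsub>V\<^esub>h\<in>carrier G.
        (p h \<otimes> q (inv\<^bsub>G\<^esub> h \<otimes>\<^bsub>G\<^esub> g)) \<odot>\<^bsub>V\<^esub> \<rho> g v)"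
      unfolding rep_module_simps KG_mult[OF p q] using pq v rho(1) fin
      by (intro V.M.finsum_cong') (auto simp: Pi_def V.finsum_smult)
    also have "\<dots> = (\<Oplus>\<^bsub>V\<^esub>h\<in>carrier G. \<Oplus>\<^bsub>V\<^esub>g\<in>carrier G.
        (p h \<otimes> q (inv\<^bsub>G\<^esub> h \<otimes>\<^bsub>G\<^esub> g)) \<odot>\<^bsub>V\<^esub> \<rho> g v)"
      using pq v rho(1) by (intro V.M.finsum_swap[OF fin fin]) auto
    also have "\<dots> = p \<odot>\<^bsub>?M\<^esub> (q \<odot>\<^bsub>?M\<^esub> v)"
      unfolding rep_module_simps
    proof (rule V.M.finsum_cong')
      show "(\<lambda>g. p g \<odot>\<^bsub>V\<^esub> \<rho> g (\<Oplus>\<^bsub>V\<^esub>g\<in>carrier G. q g \<odot>\<^bsub>V\<^esub> \<rho> g v)) \<in> carrier G \<rightarrow> carrier V"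
        using in_V[OF p V.M.finsum_closed[OF in_V[OF q v]]] .
      fix h assume h: "h \<in> carrier G"
      have "(\<Oplus>\<^bsub>V\<^esub>g\<in>carrier G. (p h \<otimes> q (inv\<^bsub>G\<^esub> h \<otimes>\<^bsub>G\<^esub> g)) \<odot>\<^bsub>V\<^esub> \<rho> g v) =
        (\<Oplus>\<^bsub>V\<^esub>g\<in>carrier G. (p h \<otimes> q (inv\<^bsub>G\<^esub> h \<otimes>\<^bsub>G\<^esub> (h \<otimes>\<^bsub>G\<^esub> g))) \<odot>\<^bsub>V\<^esub> \<rho> (h \<otimes>\<^bsub>G\<^esub> g) v)"
        using pq v rho(1) h V.M.abelian_monoid_axioms by (intro finsum_left_translate) auto
      also have "\<dots> = (\<Oplus>\<^bsub>V\<^esub>g\<in>carrier G. p h \<odot>\<^bsub>V\<^esub> \<rho> h (q g \<odot>\<^bsub>V\<^esub> \<rho> g v))"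
        using pq v rho h
        by (intro V.M.finsum_cong') (auto simp: rho_mult V.smult_assoc1 simp flip: G.m_assoc)
      also have "\<dots> = p h \<odot>\<^bsub>V\<^esub> (\<Oplus>\<^bsub>V\<^esub>g\<in>carrier G. \<rho> h (q g \<odot>\<^bsub>V\<^esub> \<rho> g v))"
        using pq v rho h by (intro V.smult_finsum[OF fin, symmetric]) auto
      also have "(\<Oplus>\<^bsub>V\<^esub>g\<in>carrier G. \<rho> h (q g \<odot>\<^bsub>V\<^esub> \<rho> g v)) = \<rho> h (\<Oplus>\<^bsub>V\<^esub>g\<in>carrier G. q g \<odot>\<^bsub>V\<^esub> \<rho> g v)"
        by (rule linear_finsum[OF V.left_module_axioms V.left_module_axioms linear[OF h] fin in_V[OF q v], symmetric])
      finally show "(\<Oplus>\<^bsub>V\<^esub>g\<in>carrier G. (p h \<otimes> q (inv\<^bsub>G\<^esub> h \<otimes>\<^bsub>G\<^esub> g)) \<odot>\<^bsub>V\<^esub> \<rho> g v) =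
          p h \<odot>\<^bsub>V\<^esub> \<rho> h (\<Oplus>\<^bsub>V\<^esub>g\<in>carrier G. q g \<odot>\<^bsub>V\<^esub> \<rho> g v)" .
    qed simp
    finally show "(p \<otimes>\<^bsub>KG\<^esub> q) \<odot>\<^bsub>?M\<^esub> v = p \<odot>\<^bsub>?M\<^esub> (q \<odot>\<^bsub>?M\<^esub> v)" .
  next
    fix p u v assume p: "p \<in> carrier KG" and u: "u \<in> carrier ?M" and v: "v \<in> carrier ?M"
    have u: "u \<in> carrier V" and v: "v \<in> carrier V" using u v by simp_all
    show "p \<odot>\<^bsub>?M\<^esub> (u \<oplus>\<^bsub>?M\<^esub> v) = p \<odot>\<^bsub>?M\<^esub> u \<oplus>\<^bsub>?M\<^esub> p \<odot>\<^bsub>?M\<^esub> v"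
      unfolding rep_module_simps V.M.finsum_addf[OF in_V[OF p u] in_V[OF p v], symmetric]
      using KG_in[OF p] u v rho by (intro V.M.finsum_cong') (auto simp: V.smult_r_distr)
  next
    fix v assume v: "v \<in> carrier ?M"
    then show "\<one>\<^bsub>KG\<^esub> \<odot>\<^bsub>?M\<^esub> v = v"
      unfolding KG_simps by (subst rep_module_basis_elt) (use rho_one in auto)
  qed
qed

lemma scalar_restriction_rep_module:
  assumes "a \<in> carrier K" "v \<in> carrier V"
  shows "a \<odot>\<^bsub>scalar_restriction K G (rep_module G V \<rho>)\<^esub> v = a \<odot>\<^bsub>V\<^esub> v"
  using rep_module_basis_elt[OF assms(1) G.one_closed assms(2)] rho_one assms by simp

end

section \<open>The apex of a simple functor\<close>

text \<open>
If \<open>End(x)\<close> is finite, the last condition says that the action of \<open>End(x)\<close> on \<open>F(x)\<close> is induced from the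
quotient of its monoid algebra by the ideal of nonunits, which is the group algebra of \<open>Aut(x)\<close>.
\<close>

definition apex :: "('o, 'm) cat \<Rightarrow> ('o, 'm, ('k, 'v) module, 'v \<Rightarrow> 'v) fctr \<Rightarrow> 'o \<Rightarrow> bool" where
  "apex C F x \<longleftrightarrow> x \<in> Obj C \<and> val F x \<noteq> {zero_at F x} \<and>
     (\<forall>f\<in>Hom C x x. \<not> iso_arrow C x x f \<longrightarrow> (\<forall>v\<in>val F x. Far F x x f v = zero_at F x))"

abbreviation simple_functor :: "('o, 'm) cat \<Rightarrow> ('k, 'a) ring_scheme \<Rightarrow>
    ('o, 'm, ('k, 'v) module, 'v \<Rightarrow> 'v) fctr \<Rightarrow> bool" where
  "simple_functor C K \<equiv> simple_object (functor_category C (left_modules K))"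

lemma apexD:
  assumes "apex C F x"
  shows "x \<in> Obj C" "val F x \<noteq> {zero_at F x}"
    "\<lbrakk>f \<in> Hom C x x; \<not> iso_arrow C x x f; v \<in> val F x\<rbrakk> \<Longrightarrow> Far F x x f v = zero_at F x"
  using assms by (auto simp: apex_def)

lemma left_module_zero_closed: "left_module R M \<Longrightarrow> \<zero>\<^bsub>M\<^esub> \<in> carrier M"
  by (rule abelian_monoid.zero_closed) (auto simp: left_module_def abelian_group_def)

lemma nonzero_element:
  assumes "left_module R M" "carrier M \<noteq> {\<zero>\<^bsub>M\<^esub>}"
  obtains v where "v \<in> carrier M" "v \<noteq> \<zero>\<^bsub>M\<^esub>"
  using assms left_module_zero_closed[OF assms(1)] by blast

context category
begin

lemma simple_functorD:
  assumes "simple_functor C K F"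
  shows "module_functor C K F" "\<exists>x\<in>Obj C. val F x \<noteq> {zero_at F x}"
    "\<lbrakk>subfctr C K F N; x \<in> Obj C; v \<in> N x; v \<noteq> zero_at F x; y \<in> Obj C\<rbrakk> \<Longrightarrow> N y = val F y"
proof -
  note * = assms[unfolded simple_functor_iff[OF category_axioms]]
  show "module_functor C K F" "\<exists>x\<in>Obj C. val F x \<noteq> {zero_at F x}"
    using * by blast+
  show "N y = val F y"
    if "subfctr C K F N" "x \<in> Obj C" "v \<in> N x" "v \<noteq> zero_at F x" "y \<in> Obj C"
    using * that by blast
qed

text \<open>
This is the largest subfunctor whose value at \<open>x\<close> is contained in \<open>U\<close>.
\<close>

lemma residual_subfctr:
  assumes F: "module_functor C K F" and x: "x \<in> Obj C" and U: "submod K (Fob F x) U"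
  shows "subfctr C K F (\<lambda>y. {s \<in> val F y. \<forall>h\<in>Hom C y x. Far F y x h s \<in> U})"
  unfolding subfctr_def
proof (intro conjI ballI)
  fix y assume y: "y \<in> Obj C"
  interpret left_module K "Fob F y" by (rule module_functorD(1)[OF F y])
  show "submod K (Fob F y) {s \<in> val F y. \<forall>h\<in>Hom C y x. Far F y x h s \<in> U}"
    unfolding submod_def
    using submodD[OF U] linear_mapsD[OF module_functorD(2)[OF F y x]] module_functorD(6)[OF F y x]
    by auto
next
  fix y z f s
  assume *: "y \<in> Obj C" "z \<in> Obj C" "f \<in> Hom C y z"
    and "s \<in> {s \<in> val F y. \<forall>h\<in>Hom C y x. Far F y x h s \<in> U}"
  then have s: "s \<in> val F y" "\<And>h. h \<in> Hom C y x \<Longrightarrow> Far F y x h s \<in> U" by auto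
  have "Far F z x h (Far F y z f s) \<in> U" if h: "h \<in> Hom C z x" for h
    using s(2)[of "Cmp C y z x h f"] module_functorD(4)[OF F *(1,2) x *(3) h s(1)]
      Cmp_Hom[OF *(1,2) x *(3) h] by simp
  then show "Far F y z f s \<in> {s \<in> val F z. \<forall>h\<in>Hom C z x. Far F z x h s \<in> U}"
    using module_functorD(5)[OF F * s(1)] by blast
qed

text \<open>
The elements of \<open>F\<close> killed by all arrows into \<open>x\<close> form the residual subfunctor of \<open>0 \<subseteq> F(x)\<close>. It is
not all of \<open>F\<close>, because the identity of \<open>x\<close> kills nothing.
\<close>

lemma simple_functor_separated:
  assumes F: "simple_functor C K F" and x: "x \<in> Obj C" "val F x \<noteq> {zero_at F x}"
    and y: "y \<in> Obj C" and s: "s \<in> val F y"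
    and vanish: "\<And>h. h \<in> Hom C y x \<Longrightarrow> Far F y x h s = zero_at F x"
  shows "s = zero_at F y"
proof (rule ccontr)
  assume "s \<noteq> zero_at F y"
  note Ff = simple_functorD(1)[OF F]
  interpret left_module K "Fob F x" by (rule module_functorD(1)[OF Ff x(1)])
  let ?N = "\<lambda>y. {s \<in> val F y. \<forall>h\<in>Hom C y x. Far F y x h s \<in> {zero_at F x}}"
  have "submod K (Fob F x) {zero_at F x}" by (simp add: submod_def)
  then have "subfctr C K F ?N" by (rule residual_subfctr[OF Ff x(1)])
  moreover have "s \<in> ?N y" using s vanish by auto
  ultimately have "?N x = val F x"
    using simple_functorD(3)[OF F _ y _ \<open>s \<noteq> _\<close> x(1)] by blast
  then have "Far F x x (Idn C x) v = zero_at F x" if "v \<in> val F x" for v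
    using that Idn_Hom[OF x(1)] by blast
  then have "v = zero_at F x" if "v \<in> val F x" for v
    using module_functorD(3)[OF Ff x(1) that] that by simp
  then show False using x(2) by (metis nonzero_element[OF left_module_axioms])
qed

text \<open>
Stability says that the residual subfunctor of \<open>U\<close> has value exactly \<open>U\<close> at \<open>x\<close>.
\<close>

lemma simple_functor_eval:
  assumes F: "simple_functor C K F" and x: "x \<in> Obj C" and U: "submod K (Fob F x) U"
    and stable: "\<And>f v. \<lbrakk>f \<in> Hom C x x; v \<in> U\<rbrakk> \<Longrightarrow> Far F x x f v \<in> U"
  shows "U = {zero_at F x} \<or> U = val F x"
proof (rule disjCI)
  note Ff = simple_functorD(1)[OF F]
  let ?N = "\<lambda>y. {s \<in> val F y. \<forall>h\<in>Hom C y x. Far F y x h s \<in> U}"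
  assume "U \<noteq> val F x"
  then obtain w where w: "w \<in> val F x" "w \<notin> U" using submodD(1)[OF U] by blast
  then have "w \<notin> ?N x" using module_functorD(3)[OF Ff x w(1)] Idn_Hom[OF x] by force
  moreover have "U \<subseteq> ?N x" using stable submodD(1)[OF U] by blast
  ultimately have "v = zero_at F x" if "v \<in> U" for v
    using simple_functorD(3)[OF F residual_subfctr[OF Ff x U] x, of v x] that x w(1) by blast
  then show "U = {zero_at F x}" using submodD(2)[OF U] by blast
qed

lemma apex_iso_object:
  assumes F: "module_functor C K F" and x: "apex C F x" and xy: "(x, y) \<in> iso_rel C"
  shows "apex C F y"
proof -
  obtain a b where o: "x \<in> Obj C" "y \<in> Obj C" and a: "a \<in> Hom C x y" and b: "b \<in> Hom C y x"
    and ba: "Cmp C x y x b a = Idn C x" and ab: "Cmp C y x y a b = Idn C y"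
    using xy by (auto simp: iso_rel_def iso_arrow_def)
  note D = module_functorD[OF F]
  have FaFb: "Far F x y a (Far F y x b v) = v" if "v \<in> val F y" for v
    using D(4)[OF o(2,1,2) b a that] D(3)[OF o(2) that] ab by simp
  have FbFa: "Far F y x b (Far F x y a v) = v" if "v \<in> val F x" for v
    using D(4)[OF o o(1) a b that] D(3)[OF o(1) that] ba by simp
  show ?thesis
    unfolding apex_def
  proof (intro conjI ballI impI)
    obtain v where v: "v \<in> val F x" "v \<noteq> zero_at F x"
      using nonzero_element[OF D(1)[OF o(1)] apexD(2)[OF x]] by blast
    then have "Far F x y a v \<noteq> zero_at F y" using FbFa[OF v(1)] D(6)[OF o(2,1) b] by metis
    then show "val F y \<noteq> {zero_at F y}" using D(5)[OF o a v(1)] by blast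
  next
    fix f v assume f: "f \<in> Hom C y y" "\<not> iso_arrow C y y f" and v: "v \<in> val F y"
    define g where "g = Cmp C x y x b (Cmp C x y y f a)"
    have fa: "Cmp C x y y f a \<in> Hom C x y" and g: "g \<in> Hom C x x"
      using o a b f unfolding g_def by (auto intro!: Cmp_Hom)
    have "\<not> iso_arrow C x x g"
    proof
      assume "iso_arrow C x x g"
      moreover have ia: "iso_arrow C x y a" "iso_arrow C y x b"
        using a b ba ab by (auto simp: iso_arrow_def)
      ultimately have "iso_arrow C y y (Cmp C y x y (Cmp C x x y a g) b)"
        using o by (auto intro!: iso_arrow_Cmp)
      moreover have "Cmp C x x y a g = Cmp C x y y f a"
        using o a b f fa ab Cmp_assoc[of x y x y "Cmp C x y y f a" b a]
        by (simp add: g_def Cmp_Idn_left)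
      moreover have "Cmp C y x y (Cmp C x y y f a) b = f"
        using o a b f ab by (simp add: Cmp_assoc Cmp_Idn_right)
      ultimately show False using f by simp
    qed
    then have "Far F x x g (Far F y x b v) = zero_at F x"
      using apexD(3)[OF x g] D(5)[OF o(2,1) b v] by blast
    moreover have "Far F x x g (Far F y x b v) = Far F y x b (Far F y y f v)"
      unfolding g_def
      using o a b f v fa D(5) by (simp add: D(4) FaFb)
    ultimately have "Far F y x b (Far F y y f v) = zero_at F x" by simp
    then show "Far F y y f v = zero_at F y"
      using FaFb[OF D(5)[OF o(2,2) f(1) v]] D(6)[OF o a] by simp
  qed (fact o)
qed

text \<open>
A nonzero vector of \<open>F(x)\<close> is sent to a nonzero vector by some \<open>g : x \<rightarrow> y\<close>, and that one by some
\<open>h : y \<rightarrow> x\<close>. As \<open>h g\<close> acts nontrivially it is invertible, so \<open>g\<close> has a left inverse \<open>k\<close>; then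
\<open>g k\<close> acts nontrivially on \<open>F(y)\<close> and is invertible as well.
\<close>

lemma apex_unique:
  assumes F: "simple_functor C K F" and x: "apex C F x" and y: "apex C F y"
  shows "(x, y) \<in> iso_rel C"
proof -
  note Ff = simple_functorD(1)[OF F]
  note D = module_functorD[OF Ff]
  note o = apexD(1)[OF x] apexD(1)[OF y]
  obtain v where v: "v \<in> val F x" "v \<noteq> zero_at F x"
    using nonzero_element[OF D(1)[OF o(1)] apexD(2)[OF x]] by blast
  obtain g where g: "g \<in> Hom C x y" "Far F x y g v \<noteq> zero_at F y"
    using simple_functor_separated[OF F apexD(1,2)[OF y] o(1) v(1)] v(2) by blast
  let ?w = "Far F x y g v"
  have w: "?w \<in> val F y" using D(5) o g(1) v(1) by blast
  obtain h where h: "h \<in> Hom C y x" "Far F y x h ?w \<noteq> zero_at F x"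
    using simple_functor_separated[OF F apexD(1,2)[OF x] o(2) w] g(2) by blast
  have hg: "Cmp C x y x h g \<in> Hom C x x" using Cmp_Hom o g h by blast
  have "iso_arrow C x x (Cmp C x y x h g)"
    using apexD(3)[OF x hg _ v(1)] h(2) D(4)[OF o o(1) g(1) h(1) v(1)] by metis
  then obtain u where u: "u \<in> Hom C x x" "Cmp C x x x u (Cmp C x y x h g) = Idn C x"
    by (auto simp: iso_arrow_def)
  define k where "k = Cmp C y x x u h"
  have k: "k \<in> Hom C y x" unfolding k_def using Cmp_Hom o u h by blast
  have kg: "Cmp C x y x k g = Idn C x"
    unfolding k_def using Cmp_assoc[of x y x x g h u] o g h u by simp
  have gk: "Cmp C y x y g k \<in> Hom C y y" using Cmp_Hom o g k by blast
  have "Far F y y (Cmp C y x y g k) ?w = Far F x y g (Far F x x (Cmp C x y x k g) v)"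
    using D(4)[OF o(2,1,2) k g(1) w] D(4)[OF o o(1) g(1) k v(1)] by simp
  also have "\<dots> = ?w" using kg D(3)[OF o(1) v(1)] by simp
  finally have "iso_arrow C y y (Cmp C y x y g k)"
    using apexD(3)[OF y gk _ w] g(2) by metis
  then have "iso_arrow C x y g" by (rule split_mono_iso_arrow[OF o g(1) k kg])
  then show ?thesis using o by (auto simp: iso_rel_def)
qed

text \<open>
The object is chosen with the least number of endomorphisms. The claim \<open>no_fixed\<close> expresses the
nilpotency of nonunits in the form in which it is used: they fix no nonzero vector. A common null
vector of all nonunits is found as \<open>p v\<close> where the left ideal generated by \<open>p\<close> is minimal subject to
\<open>p v \<noteq> 0\<close>: if a nonunit \<open>f\<close> had \<open>f p v \<noteq> 0\<close>, then by minimality \<open>p = q f p\<close> for some \<open>q\<close>, and the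
nonunit \<open>q f\<close> would fix \<open>p v\<close>.
\<close>

lemma apex_exists:
  assumes split: "idempotents_split C" and fin: "\<And>x. x \<in> Obj C \<Longrightarrow> finite (Hom C x x)"
    and F: "simple_functor C K F"
  shows "\<exists>x. apex C F x"
proof -
  note Ff = simple_functorD(1)[OF F]
  note D = module_functorD[OF Ff]
  obtain x where x: "x \<in> Obj C" "val F x \<noteq> {zero_at F x}"
    and min: "\<And>y. \<lbrakk>y \<in> Obj C; val F y \<noteq> {zero_at F y}\<rbrakk> \<Longrightarrow> card (Hom C x x) \<le> card (Hom C y y)"
    using ex_has_least_nat[of "\<lambda>x. x \<in> Obj C \<and> val F x \<noteq> {zero_at F x}" _ "\<lambda>x. card (Hom C x x)"]
      simple_functorD(2)[OF F] by blast
  interpret E: monoid "End C x" by (rule End_monoid[OF x(1)])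
  interpret V: left_module K "Fob F x" by (rule D(1)[OF x(1)])
  have E [simp]: "carrier (End C x) = Hom C x x" "\<one>\<^bsub>End C x\<^esub> = Idn C x"
      "f \<otimes>\<^bsub>End C x\<^esub> g = Cmp C x x x f g" for f g
    by (simp_all add: End_def)
  have finE: "finite (carrier (End C x))" using fin[OF x(1)] by simp
  let ?U = "Units (End C x)"
  have mult_Units: "f \<otimes>\<^bsub>End C x\<^esub> g \<in> ?U \<longleftrightarrow> f \<in> ?U \<and> g \<in> ?U" if "f \<in> Hom C x x" "g \<in> Hom C x x" for f g
    using E.finite_Units_mult_iff[OF finE] that by simp
  have FCmp: "Far F x x (f \<otimes>\<^bsub>End C x\<^esub> g) v = Far F x x f (Far F x x g v)"
    if "f \<in> Hom C x x" "g \<in> Hom C x x" "v \<in> val F x" for f g v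
    using D(4)[OF x(1,1,1) that(2,1,3)] by simp
  have no_fixed: "w = zero_at F x"
    if t: "t \<in> Hom C x x" "t \<notin> ?U" and w: "w \<in> val F x" "Far F x x t w = w" for t w
  proof -
    obtain k :: nat where k: "0 < k" "t [^]\<^bsub>End C x\<^esub> k \<otimes>\<^bsub>End C x\<^esub> t [^]\<^bsub>End C x\<^esub> k = t [^]\<^bsub>End C x\<^esub> k"
      using E.finite_idempotent_power[OF finE] t by auto
    let ?e = "t [^]\<^bsub>End C x\<^esub> k"
    have pow: "t [^]\<^bsub>End C x\<^esub> n \<in> Hom C x x" for n :: nat
      using E.nat_pow_closed[of t n] t by simp
    have "?e \<notin> ?U"
    proof
      obtain n where n: "k = Suc n" using k(1) by (cases k) auto
      assume "?e \<in> ?U"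
      then have "t [^]\<^bsub>End C x\<^esub> n \<otimes>\<^bsub>End C x\<^esub> t \<in> ?U" by (simp only: n E.nat_pow_Suc)
      then show False using mult_Units[OF pow t(1)] t(2) by blast
    qed
    have fixed: "Far F x x (t [^]\<^bsub>End C x\<^esub> n) w = w" for n :: nat
    proof (induction n)
      case 0 show ?case using D(3)[OF x(1) w(1)] by simp
    next
      case (Suc n) then show ?case using FCmp[OF pow t(1) w(1), of n] w(2) by simp
    qed
    obtain y r s where y: "y \<in> Obj C" and r: "r \<in> Hom C x y" and s: "s \<in> Hom C y x"
      and sr: "Cmp C x y x s r = ?e" and rs: "Cmp C y x y r s = Idn C y"
      using split k(2) pow[of k] x(1) unfolding idempotents_split_def by (auto, metis)
    \<comment> \<open>Conjugation by the splitting embeds the endomorphisms of y into those of x. If F did not vanish at y, minimality of x would make this a bijection, and the identity of x in its image would force the idempotent to be the identity.\<close>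
    have "val F y = {zero_at F y}"
    proof (rule ccontr)
      assume "val F y \<noteq> {zero_at F y}"
      then have le: "card (Hom C x x) \<le> card (Hom C y y)" using min[OF y] by blast
      let ?j = "\<lambda>a. Cmp C x y x (Cmp C y y x s a) r"
      have sa: "Cmp C y y x s a \<in> Hom C y x" if "a \<in> Hom C y y" for a
        using Cmp_Hom y x s that by blast
      have j: "?j ` Hom C y y \<subseteq> Hom C x x" using Cmp_Hom x y r s sa by blast
      have "inj_on ?j (Hom C y y)"
      proof (rule inj_on_inverseI)
        fix a assume a: "a \<in> Hom C y y"
        have "Cmp C y x x (?j a) s = Cmp C y y x s a"
          using Cmp_assoc[of y x y x s r "Cmp C y y x s a"] x y r s sa[OF a] rs by (simp add: Cmp_Idn_right)
        then show "Cmp C y x y r (Cmp C y x x (?j a) s) = a"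
          using Cmp_assoc[of y y x y a s r] x y r s a rs by (simp add: Cmp_Idn_left)
      qed
      then have "card (?j ` Hom C y y) = card (Hom C y y)" by (rule card_image)
      then have "?j ` Hom C y y = Hom C x x"
        using le card_mono[OF fin[OF x(1)] j] card_subset_eq[OF fin[OF x(1)] j] by linarith
      with Idn_Hom[OF x(1)] have "Idn C x \<in> ?j ` Hom C y y" by (simp only:)
      then obtain a where "Idn C x = ?j a" and a1: "a \<in> Hom C y y" by (rule imageE)
      then have a: "a \<in> Hom C y y" "?j a = Idn C x" by (simp_all only:)
      have "?e = Cmp C x x x ?e (?j a)" using a pow[of k] x by (simp add: Cmp_Idn_right)
      also have "\<dots> = Cmp C x y x (Cmp C y x x ?e (Cmp C y y x s a)) r"
        using x y r sa[OF a(1)] pow[of k] by (simp add: Cmp_assoc)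
      also have "Cmp C y x x ?e (Cmp C y y x s a) = Cmp C y y x (Cmp C y x x ?e s) a"
        using x y s a(1) pow[of k] by (simp add: Cmp_assoc)
      also have "Cmp C y x x ?e s = s"
        unfolding sr[symmetric] using Cmp_assoc[of y x y x s r s] x y r s rs by (simp add: Cmp_Idn_right)
      finally have "?e = Idn C x" using a(2) by simp
      then show False using \<open>?e \<notin> ?U\<close> E.Units_one_closed by simp
    qed
    moreover have "Far F x y r w \<in> val F y" using D(5) x y r w by blast
    ultimately have "Far F x x ?e w = zero_at F x"
      using D(4)[OF x(1) y x(1) r s w(1)] sr D(6)[OF y x(1) s] by simp
    then show ?thesis using fixed by simp
  qed
  let ?A = "{v \<in> val F x. \<forall>f\<in>Hom C x x - ?U. Far F x x f v = zero_at F x}"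
  have "submod K (Fob F x) ?A"
    unfolding submod_def
    using linear_mapsD[OF D(2)[OF x(1,1)]] D(6)[OF x(1,1)] by auto
  moreover have "Far F x x f v \<in> ?A" if "f \<in> Hom C x x" "v \<in> ?A" for f v
  proof -
    have "Far F x x g (Far F x x f v) = zero_at F x" if g: "g \<in> Hom C x x - ?U" for g
      using FCmp[of g f v] mult_Units[of g f] E.m_closed[of g f] g \<open>v \<in> ?A\<close> \<open>f \<in> Hom C x x\<close> by auto
    then show ?thesis using D(5)[OF x(1,1)] that by blast
  qed
  ultimately consider "?A = {zero_at F x}" | "?A = val F x"
    using simple_functor_eval[OF F x(1)] by blast
  then show ?thesis
  proof cases
    case 1
    obtain v where v: "v \<in> val F x" "v \<noteq> zero_at F x"
      using nonzero_element[OF D(1)[OF x(1)] x(2)] by blast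
    let ?L = "\<lambda>p. (\<lambda>q. q \<otimes>\<^bsub>End C x\<^esub> p) ` Hom C x x"
    obtain p where p: "p \<in> Hom C x x" "Far F x x p v \<noteq> zero_at F x"
      and p_min: "\<And>p'. \<lbrakk>p' \<in> Hom C x x; Far F x x p' v \<noteq> zero_at F x\<rbrakk> \<Longrightarrow> card (?L p) \<le> card (?L p')"
      using ex_has_least_nat[of "\<lambda>p. p \<in> Hom C x x \<and> Far F x x p v \<noteq> zero_at F x" "Idn C x" "\<lambda>p. card (?L p)"]
        Idn_Hom[OF x(1)] D(3)[OF x(1) v(1)] v(2) by auto
    have pv: "Far F x x p v \<in> val F x" using D(5) x p v by blast
    have "Far F x x p v \<notin> ?A" using p(2) 1 by simp
    then obtain f where f: "f \<in> Hom C x x" "f \<notin> ?U" "Far F x x f (Far F x x p v) \<noteq> zero_at F x"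
      using pv by blast
    have fp: "f \<otimes>\<^bsub>End C x\<^esub> p \<in> Hom C x x" using E.m_closed[of f p] f p by simp
    have "card (?L p) \<le> card (?L (f \<otimes>\<^bsub>End C x\<^esub> p))"
      using p_min[OF fp] FCmp[OF f(1) p(1) v(1)] f(3) by simp
    moreover have "?L (f \<otimes>\<^bsub>End C x\<^esub> p) \<subseteq> ?L p"
    proof
      fix a assume "a \<in> ?L (f \<otimes>\<^bsub>End C x\<^esub> p)"
      then obtain q where q: "q \<in> Hom C x x" "a = q \<otimes>\<^bsub>End C x\<^esub> (f \<otimes>\<^bsub>End C x\<^esub> p)" by blast
      then have "a = (q \<otimes>\<^bsub>End C x\<^esub> f) \<otimes>\<^bsub>End C x\<^esub> p" using E.m_assoc[of q f p] f p by simp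
      moreover have "q \<otimes>\<^bsub>End C x\<^esub> f \<in> Hom C x x" using E.m_closed[of q f] q f by simp
      ultimately show "a \<in> ?L p" by blast
    qed
    ultimately have "?L (f \<otimes>\<^bsub>End C x\<^esub> p) = ?L p"
      using fin[OF x(1)] by (intro card_seteq) auto
    moreover have "p \<in> ?L p" using E.l_one[of p] p(1) Idn_Hom[OF x(1)] by (intro image_eqI[of _ _ "Idn C x"]) auto
    ultimately obtain q where q: "q \<in> Hom C x x" "p = q \<otimes>\<^bsub>End C x\<^esub> (f \<otimes>\<^bsub>End C x\<^esub> p)" by blast
    have qf: "q \<otimes>\<^bsub>End C x\<^esub> f \<in> Hom C x x" using E.m_closed[of q f] q f by simp
    have "p = (q \<otimes>\<^bsub>End C x\<^esub> f) \<otimes>\<^bsub>End C x\<^esub> p" using q E.m_assoc[of q f p] f p by simp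
    then have "Far F x x (q \<otimes>\<^bsub>End C x\<^esub> f) (Far F x x p v) = Far F x x p v"
      using FCmp[OF qf p(1) v(1)] by simp
    then have "Far F x x p v = zero_at F x"
      using no_fixed[OF qf _ pv] mult_Units[OF q(1) f(1)] f(2) by blast
    then show ?thesis using p(2) by blast
  next
    case 2
    then have "apex C F x" unfolding apex_def using x by (auto simp: Units_End)
    then show ?thesis by blast
  qed
qed

end

section \<open>The representation at the apex\<close>

definition value_rep :: "('o, 'm) cat \<Rightarrow> ('o, 'm, ('k, 'v) module, 'v \<Rightarrow> 'v) fctr \<Rightarrow> 'o \<Rightarrow>
    ('m \<Rightarrow> 'k, 'v) module" where
  "value_rep C F x = rep_module (Aut C x) (Fob F x) (Far F x x)"

lemma Aut_simps [simp]:
  "f \<in> carrier (Aut C x) \<longleftrightarrow> iso_arrow C x x f"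
  "f \<otimes>\<^bsub>Aut C x\<^esub> g = Cmp C x x x f g" "\<one>\<^bsub>Aut C x\<^esub> = Idn C x"
  by (simp_all add: Aut_def)

lemma value_rep_simps [simp]:
  "carrier (value_rep C F x) = val F x" "\<zero>\<^bsub>value_rep C F x\<^esub> = zero_at F x"
  "u \<oplus>\<^bsub>value_rep C F x\<^esub> v = u \<oplus>\<^bsub>Fob F x\<^esub> v"
  by (simp_all add: value_rep_def)

lemma iso_functor_iff:
  assumes "category C"
  shows "(F, G) \<in> iso_rel (functor_category C (left_modules R)) \<longleftrightarrow>
    module_functor C R F \<and> module_functor C R G \<and>
    (\<exists>\<alpha>\<in>nat_trans C (left_modules R) F G. \<forall>x\<in>Obj C. bij_betw (\<alpha> x) (val F x) (val G x))"
proof -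
  interpret concrete_category "functor_category C (left_modules R)" "Obj C"
    "\<lambda>F x. val F x" "\<lambda>\<alpha> x. \<alpha> x" "\<lambda>F x. zero_at F x" "subfctr C R"
    by (rule module_functors_concrete[OF assms])
  show ?thesis
  proof
    assume "(F, G) \<in> iso_rel (functor_category C (left_modules R))"
    then obtain \<alpha> where FG: "module_functor C R F" "module_functor C R G"
      and \<alpha>: "iso_arrow (functor_category C (left_modules R)) F G \<alpha>"
      by (auto simp: iso_rel_def)
    then have "\<alpha> \<in> nat_trans C (left_modules R) F G" using iso_arrow_Hom[OF \<alpha>] by simp
    moreover have "\<forall>x\<in>Obj C. bij_betw (\<alpha> x) (val F x) (val G x)"
      using iso_imp_bij[of F G \<alpha>] FG \<alpha> by simp
    ultimately show "module_functor C R F \<and> module_functor C R G \<and>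
        (\<exists>\<alpha>\<in>nat_trans C (left_modules R) F G. \<forall>x\<in>Obj C. bij_betw (\<alpha> x) (val F x) (val G x))"
      using FG by blast
  qed (use bij_iso[of F G] in \<open>auto simp: iso_rel_def\<close>)
qed

lemma iso_left_module_iff:
  "(M, N) \<in> iso_rel (left_modules R) \<longleftrightarrow> left_module R M \<and> left_module R N \<and>
    (\<exists>\<phi>\<in>linear_maps R M N. bij_betw \<phi> (carrier M) (carrier N))"
proof -
  interpret concrete_category "left_modules R" "UNIV :: unit set" "\<lambda>M _. carrier M" "\<lambda>f _. f"
      "\<lambda>M _. \<zero>\<^bsub>M\<^esub>" "\<lambda>M N. submod R M (N ())"
    by (rule left_modules_concrete)
  show ?thesis
  proof
    assume "(M, N) \<in> iso_rel (left_modules R)"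
    then obtain \<phi> where MN: "left_module R M" "left_module R N"
      and \<phi>: "iso_arrow (left_modules R) M N \<phi>"
      by (auto simp: iso_rel_def)
    then show "left_module R M \<and> left_module R N \<and>
        (\<exists>\<phi>\<in>linear_maps R M N. bij_betw \<phi> (carrier M) (carrier N))"
      using iso_imp_bij[of M N \<phi> "()"] iso_arrow_Hom[OF \<phi>] by auto
  qed (use bij_iso[of M N] in \<open>auto simp: iso_rel_def\<close>)
qed

context category
begin

lemma finite_group_algebra_Aut:
  assumes "cring K" "x \<in> Obj C" "finite (Hom C x x)"
  shows "finite_group_algebra (Aut C x) K"
proof -
  have "carrier (Aut C x) \<subseteq> Hom C x x" using iso_arrow_Hom by auto
  then show ?thesis
    unfolding finite_group_algebra_def finite_group_algebra_axioms_def
    using assms Aut_group finite_subset by blast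
qed

lemma value_representation:
  assumes K: "cring K" and x: "x \<in> Obj C" and fin: "finite (Hom C x x)" and F: "module_functor C K F"
  shows "representation (Aut C x) K (Fob F x) (Far F x x)"
proof -
  note D = module_functorD[OF F]
  show ?thesis
    unfolding representation_def representation_axioms_def
    using finite_group_algebra_Aut[OF K x fin] D(1,2)[OF x] D(3)[OF x] D(4)[OF x x x] x iso_arrow_Hom
    by auto
qed

lemma value_rep_smult:
  assumes K: "cring K" and x: "x \<in> Obj C" and fin: "finite (Hom C x x)" and F: "module_functor C K F"
  shows "left_module (group_algebra K (Aut C x)) (value_rep C F x)"
    "\<lbrakk>a \<in> carrier K; v \<in> val F x\<rbrakk> \<Longrightarrow>
      basis_elt K (Aut C x) a (Idn C x) \<odot>\<^bsub>value_rep C F x\<^esub> v = a \<odot>\<^bsub>Fob F x\<^esub> v"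
    "\<lbrakk>iso_arrow C x x f; v \<in> val F x\<rbrakk> \<Longrightarrow>
      basis_elt K (Aut C x) \<one>\<^bsub>K\<^esub> f \<odot>\<^bsub>value_rep C F x\<^esub> v = Far F x x f v"
proof -
  interpret representation "Aut C x" K "Fob F x" "Far F x x"
    by (rule value_representation[OF assms])
  show "left_module (group_algebra K (Aut C x)) (value_rep C F x)"
    unfolding value_rep_def by (rule rep_module_left_module)
  show "basis_elt K (Aut C x) a (Idn C x) \<odot>\<^bsub>value_rep C F x\<^esub> v = a \<odot>\<^bsub>Fob F x\<^esub> v"
    if "a \<in> carrier K" "v \<in> val F x"
    using scalar_restriction_rep_module[OF that] by (simp add: value_rep_def)
  show "basis_elt K (Aut C x) \<one>\<^bsub>K\<^esub> f \<odot>\<^bsub>value_rep C F x\<^esub> v = Far F x x f v"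
    if "iso_arrow C x x f" "v \<in> val F x"
    unfolding value_rep_def using rep_module_basis_elt[of "\<one>\<^bsub>K\<^esub>" f v] that rho(1)[of f v] by simp
qed

lemma value_rep_linear_iff:
  assumes K: "cring K" and x: "x \<in> Obj C" and fin: "finite (Hom C x x)"
    and F: "module_functor C K F" and M: "left_module (group_algebra K (Aut C x)) M"
  shows "\<phi> \<in> linear_maps (group_algebra K (Aut C x)) M (value_rep C F x) \<longleftrightarrow>
    \<phi> \<in> linear_maps K (scalar_restriction K (Aut C x) M) (Fob F x) \<and>
    (\<forall>f v. iso_arrow C x x f \<longrightarrow> v \<in> carrier M \<longrightarrow>
       \<phi> (basis_elt K (Aut C x) \<one>\<^bsub>K\<^esub> f \<odot>\<^bsub>M\<^esub> v) = Far F x x f (\<phi> v))"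
proof -
  note V = value_rep_smult[OF K x fin F]
  interpret finite_group_algebra "Aut C x" K by (rule finite_group_algebra_Aut[OF K x fin])
  show ?thesis
    unfolding linear_iff[OF M V(1)] by (auto simp: linear_maps_def V PiE_def Pi_def)
qed

lemma value_rep_linear_maps_iff:
  assumes K: "cring K" and x: "x \<in> Obj C" and fin: "finite (Hom C x x)"
    and F: "module_functor C K F" and G: "module_functor C K G"
  shows "\<phi> \<in> linear_maps (group_algebra K (Aut C x)) (value_rep C F x) (value_rep C G x) \<longleftrightarrow>
    \<phi> \<in> linear_maps K (Fob F x) (Fob G x) \<and>
    (\<forall>f v. iso_arrow C x x f \<longrightarrow> v \<in> val F x \<longrightarrow> \<phi> (Far F x x f v) = Far G x x f (\<phi> v))"
proof -
  note V = value_rep_smult[OF K x fin F]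
  show ?thesis
    unfolding value_rep_linear_iff[OF K x fin G V(1)] by (auto simp: linear_maps_def V)
qed

theorem value_rep_simple:
  assumes K: "cring K" and fin: "finite (Hom C x x)"
    and F: "simple_functor C K F" and x: "apex C F x"
  shows "simple_object (left_modules (group_algebra K (Aut C x))) (value_rep C F x)"
  unfolding simple_left_module_iff
proof (intro conjI allI impI)
  note Ff = simple_functorD(1)[OF F] and o = apexD(1)[OF x]
  note V = value_rep_smult[OF K o fin Ff]
  interpret finite_group_algebra "Aut C x" K by (rule finite_group_algebra_Aut[OF K o fin])
  show "left_module KG (value_rep C F x)" by (fact V)
  show "carrier (value_rep C F x) \<noteq> {\<zero>\<^bsub>value_rep C F x\<^esub>}" using apexD(2)[OF x] by simp
  fix U assume "submod KG (value_rep C F x) U"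
  then have U: "submod K (scalar_restriction K (Aut C x) (value_rep C F x)) U"
    and U_stable: "\<And>f v. \<lbrakk>iso_arrow C x x f; v \<in> U\<rbrakk> \<Longrightarrow>
      basis_elt K (Aut C x) \<one>\<^bsub>K\<^esub> f \<odot>\<^bsub>value_rep C F x\<^esub> v \<in> U"
    unfolding submod_iff[OF V(1)] by auto
  note U' = submodD[OF U, simplified]
  have sub: "submod K (Fob F x) U"
    unfolding submod_def
  proof (intro conjI ballI subsetI)
    fix a v assume "a \<in> carrier K" "v \<in> U"
    then show "a \<odot>\<^bsub>Fob F x\<^esub> v \<in> U" using U'(4)[of a v] V(2)[OF _ U'(1)] by simp
  qed (use U' in auto)
  have "Far F x x f v \<in> U" if "f \<in> Hom C x x" "v \<in> U" for f v
    using U_stable[of f v] V(3)[of f v] apexD(3)[OF x, of f v] U' that by metis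
  then show "U = {\<zero>\<^bsub>value_rep C F x\<^esub>} \<or> U = carrier (value_rep C F x)"
    using simple_functor_eval[OF F o sub] by simp
qed

text \<open>
The required isomorphism is the relation \<open>\<Gamma>\<close> of elements \<open>s \<in> F(y)\<close> and \<open>t \<in> G(y)\<close> whose images
under all arrows \<open>y \<rightarrow> x\<close> correspond under \<open>\<theta>\<close>. This is a subfunctor of \<open>F \<times> G\<close>. It is total because
its projection to \<open>F\<close> is a subfunctor containing all of \<open>F(x)\<close>, and it is single-valued and
injective because arrows into \<open>x\<close> separate elements of \<open>G\<close> and \<open>F\<close>. A monomorphism into the simple
functor \<open>G\<close> from a nonzero functor is an isomorphism.
\<close>

lemma extend_iso_from_apex:
  assumes F: "simple_functor C K F" and G: "simple_functor C K G"
    and x: "apex C F x" "apex C G x"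
    and \<theta>: "\<theta> \<in> linear_maps K (Fob F x) (Fob G x)" and bij: "bij_betw \<theta> (val F x) (val G x)"
    and equivariant: "\<And>f v. \<lbrakk>iso_arrow C x x f; v \<in> val F x\<rbrakk> \<Longrightarrow> \<theta> (Far F x x f v) = Far G x x f (\<theta> v)"
  shows "(F, G) \<in> iso_rel (functor_category C (left_modules K))"
proof -
  note o = apexD(1)[OF x(1)]
  note Ff = simple_functorD(1)[OF F] and Gf = simple_functorD(1)[OF G]
  note DF = module_functorD[OF Ff] and DG = module_functorD[OF Gf]
  note \<theta>' = linear_mapsD[OF \<theta>]
  note \<theta>0 = linear_zero[OF DF(1)[OF o] DG(1)[OF o] \<theta>]
  have End_equivariant: "\<theta> (Far F x x f v) = Far G x x f (\<theta> v)"
    if "f \<in> Hom C x x" "v \<in> val F x" for f v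
    using equivariant[of f v] apexD(3)[OF x(1), of f v] apexD(3)[OF x(2), of f "\<theta> v"] \<theta>'(1) \<theta>0 that
    by (cases "iso_arrow C x x f") auto
  define \<Gamma> where "\<Gamma> y s t \<longleftrightarrow> s \<in> val F y \<and> t \<in> val G y \<and>
      (\<forall>h\<in>Hom C y x. \<theta> (Far F y x h s) = Far G y x h t)" for y s t
  have \<Gamma>_in: "s \<in> val F y" "t \<in> val G y" if "\<Gamma> y s t" for y s t
    using that by (simp_all add: \<Gamma>_def)
  have \<Gamma>_add: "\<Gamma> y (s \<oplus>\<^bsub>Fob F y\<^esub> s') (t \<oplus>\<^bsub>Fob G y\<^esub> t')"
    if y: "y \<in> Obj C" and "\<Gamma> y s t" "\<Gamma> y s' t'" for y s t s' t'
  proof -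
    interpret F: left_module K "Fob F y" by (rule DF(1)[OF y])
    interpret G: left_module K "Fob G y" by (rule DG(1)[OF y])
    show ?thesis
      using that linear_mapsD(2)[OF DF(2)[OF y o]] linear_mapsD(2)[OF DG(2)[OF y o]] \<theta>'(2) DF(5)[OF y o]
      by (simp add: \<Gamma>_def)
  qed
  have \<Gamma>_smult: "\<Gamma> y (a \<odot>\<^bsub>Fob F y\<^esub> s) (a \<odot>\<^bsub>Fob G y\<^esub> t)"
    if y: "y \<in> Obj C" and "a \<in> carrier K" "\<Gamma> y s t" for y s t a
  proof -
    interpret F: left_module K "Fob F y" by (rule DF(1)[OF y])
    interpret G: left_module K "Fob G y" by (rule DG(1)[OF y])
    show ?thesis
      using that linear_mapsD(3)[OF DF(2)[OF y o]] linear_mapsD(3)[OF DG(2)[OF y o]] \<theta>'(3) DF(5)[OF y o]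
      by (simp add: \<Gamma>_def)
  qed
  have \<Gamma>_zero: "\<Gamma> y (zero_at F y) (zero_at G y)" if y: "y \<in> Obj C" for y
    using left_module_zero_closed[OF DF(1)[OF y]] left_module_zero_closed[OF DG(1)[OF y]]
      DF(6)[OF y o] DG(6)[OF y o] \<theta>0 by (simp add: \<Gamma>_def)
  have \<Gamma>_nat: "\<Gamma> z (Far F y z f s) (Far G y z f t)"
    if yz: "y \<in> Obj C" "z \<in> Obj C" "f \<in> Hom C y z" and st: "\<Gamma> y s t" for y z f s t
  proof -
    have "\<theta> (Far F z x h (Far F y z f s)) = Far G z x h (Far G y z f t)" if h: "h \<in> Hom C z x" for h
      using st DF(4)[OF yz(1,2) o yz(3) h, of s] DG(4)[OF yz(1,2) o yz(3) h, of t]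
        Cmp_Hom[OF yz(1,2) o yz(3) h] unfolding \<Gamma>_def by metis
    then show ?thesis using st DF(5)[OF yz] DG(5)[OF yz] by (simp add: \<Gamma>_def)
  qed
  have \<Gamma>_x: "\<Gamma> x v (\<theta> v)" if "v \<in> val F x" for v
    using that \<theta>'(1) End_equivariant by (simp add: \<Gamma>_def)
  have \<Gamma>_unique: "t = t'" if y: "y \<in> Obj C" and st: "\<Gamma> y s t" "\<Gamma> y s t'" for y s t t'
  proof -
    interpret G: left_module K "Fob G y" by (rule DG(1)[OF y])
    interpret Gx: left_module K "Fob G x" by (rule DG(1)[OF o])
    let ?m = "(\<ominus>\<^bsub>K\<^esub> \<one>\<^bsub>K\<^esub>) \<odot>\<^bsub>Fob G y\<^esub> t'"
    have t: "t \<in> val G y" "t' \<in> val G y" using st by (simp_all add: \<Gamma>_def)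
    have "t \<oplus>\<^bsub>Fob G y\<^esub> ?m = zero_at G y"
    proof (rule simple_functor_separated[OF G apexD(1,2)[OF x(2)] y])
      fix h assume h: "h \<in> Hom C y x"
      note l = linear_mapsD[OF DG(2)[OF y o h]]
      have "Far G y x h t = Far G y x h t'" using st h by (auto simp: \<Gamma>_def)
      then show "Far G y x h (t \<oplus>\<^bsub>Fob G y\<^esub> ?m) = zero_at G x"
        using l t by (simp add: Gx.smult_l_minus Gx.M.r_neg)
    qed (use t in simp)
    then show ?thesis
      using t by (simp add: G.smult_l_minus) (metis G.M.add.inv_closed G.M.minus_equality G.M.minus_minus)
  qed
  have "subfctr C K F (\<lambda>y. {s. \<exists>t. \<Gamma> y s t})"
    unfolding subfctr_def submod_def mem_Collect_eq
  proof (intro conjI ballI subsetI; (elim CollectE exE)?)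
    fix y s t assume "y \<in> Obj C" "\<Gamma> y s t"
    then show "s \<in> val F y" by (simp add: \<Gamma>_in)
  next
    fix y assume "y \<in> Obj C"
    then show "\<exists>t. \<Gamma> y (zero_at F y) t" using \<Gamma>_zero by blast
  next
    fix y s s' t t' assume "y \<in> Obj C" "\<Gamma> y s t" "\<Gamma> y s' t'"
    then show "\<exists>t. \<Gamma> y (s \<oplus>\<^bsub>Fob F y\<^esub> s') t" using \<Gamma>_add by blast
  next
    fix y a s t assume "y \<in> Obj C" "a \<in> carrier K" "\<Gamma> y s t"
    then show "\<exists>t. \<Gamma> y (a \<odot>\<^bsub>Fob F y\<^esub> s) t" using \<Gamma>_smult by blast
  next
    fix y z f s t assume "y \<in> Obj C" "z \<in> Obj C" "f \<in> Hom C y z" "\<Gamma> y s t"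
    then show "\<exists>t. \<Gamma> z (Far F y z f s) t" using \<Gamma>_nat by blast
  qed
  moreover obtain v where "v \<in> val F x" "v \<noteq> zero_at F x"
    using nonzero_element[OF DF(1)[OF o] apexD(2)[OF x(1)]] by blast
  ultimately have total: "\<exists>t. \<Gamma> y s t" if "y \<in> Obj C" "s \<in> val F y" for y s
    using simple_functorD(3)[OF F, of "\<lambda>y. {s. \<exists>t. \<Gamma> y s t}" x v y] o that \<Gamma>_x by blast
  define \<alpha> where "\<alpha> y = (\<lambda>s\<in>val F y. SOME t. \<Gamma> y s t)" for y
  have \<alpha>: "\<Gamma> y s (\<alpha> y s)" if "y \<in> Obj C" "s \<in> val F y" for y s
    using someI_ex[OF total[OF that]] that by (simp add: \<alpha>_def)
  have \<alpha>_eq: "\<alpha> y s = t" if "y \<in> Obj C" "\<Gamma> y s t" for y s t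
    using \<Gamma>_unique[OF that(1) \<alpha>[OF that(1)] that(2)] that(2) by (simp add: \<Gamma>_def)
  have \<alpha>_linear: "\<alpha> y \<in> linear_maps K (Fob F y) (Fob G y)" if y: "y \<in> Obj C" for y
  proof (rule linear_mapsI)
    show "\<alpha> y v \<in> val G y" if "v \<in> val F y" for v
      using \<Gamma>_in(2)[OF \<alpha>[OF y that]] .
    show "\<alpha> y (u \<oplus>\<^bsub>Fob F y\<^esub> v) = \<alpha> y u \<oplus>\<^bsub>Fob G y\<^esub> \<alpha> y v"
      if "u \<in> val F y" "v \<in> val F y" for u v
      by (rule \<alpha>_eq[OF y \<Gamma>_add[OF y \<alpha>[OF y that(1)] \<alpha>[OF y that(2)]]])
    show "\<alpha> y (a \<odot>\<^bsub>Fob F y\<^esub> v) = a \<odot>\<^bsub>Fob G y\<^esub> \<alpha> y v"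
      if "a \<in> carrier K" "v \<in> val F y" for a v
      by (rule \<alpha>_eq[OF y \<Gamma>_smult[OF y that(1) \<alpha>[OF y that(2)]]])
  qed (simp add: \<alpha>_def)
  have nat: "restrict \<alpha> (Obj C) \<in> nat_trans C (left_modules K) F G"
    by (rule module_nat_transI) (use \<alpha>_linear \<alpha>_eq \<Gamma>_nat \<alpha> in auto)
  interpret N: concrete_category "functor_category C (left_modules K)" "Obj C"
    "\<lambda>F x. val F x" "\<lambda>\<alpha> x. \<alpha> x" "\<lambda>F x. zero_at F x" "subfctr C K"
    by (rule module_functors_concrete[OF category_axioms])
  have "inj_on (\<alpha> y) (val F y)" if y: "y \<in> Obj C" for y
  proof (rule linear_inj[OF DF(1)[OF y] DG(1)[OF y] \<alpha>_linear[OF y]])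
    fix s assume s: "s \<in> val F y" "\<alpha> y s = zero_at G y"
    show "s = zero_at F y"
    proof (rule simple_functor_separated[OF F apexD(1,2)[OF x(1)] y s(1)])
      fix h assume h: "h \<in> Hom C y x"
      have "\<theta> (Far F y x h s) = Far G y x h (zero_at G y)"
        using \<alpha>[OF y s(1)] h unfolding \<Gamma>_def s(2) by blast
      then have "\<theta> (Far F y x h s) = \<theta> (zero_at F x)" using DG(6)[OF y o h] \<theta>0 by simp
      then show "Far F y x h s = zero_at F x"
        using inj_onD[OF bij_betw_imp_inj_on[OF bij]] DF(5)[OF y o h s(1)]
          left_module_zero_closed[OF DF(1)[OF o]] by blast
    qed
  qed
  then have "monic (functor_category C (left_modules K)) F G (restrict \<alpha> (Obj C))"
    using N.monic_iff[of F G "restrict \<alpha> (Obj C)"] Ff Gf nat by simp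
  moreover have "\<not> zero_object (functor_category C (left_modules K)) F"
    using F by (simp add: simple_object_def)
  ultimately have "iso_arrow (functor_category C (left_modules K)) F G (restrict \<alpha> (Obj C))"
    using G Ff unfolding simple_object_def by auto
  then show ?thesis using Ff Gf by (auto simp: iso_rel_def)
qed

theorem iso_simple_functor_iff:
  assumes K: "cring K" and fin: "finite (Hom C x x)"
    and F: "simple_functor C K F" and G: "simple_functor C K G"
    and x: "apex C F x" "apex C G x"
  shows "(F, G) \<in> iso_rel (functor_category C (left_modules K)) \<longleftrightarrow>
    (value_rep C F x, value_rep C G x) \<in> iso_rel (left_modules (group_algebra K (Aut C x)))"
    (is "?L \<longleftrightarrow> ?R")
proof
  note o = apexD(1)[OF x(1)]
  note Ff = simple_functorD(1)[OF F] and Gf = simple_functorD(1)[OF G]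
  note lin = value_rep_linear_maps_iff[OF K o fin Ff Gf]
  {
    assume ?L
    then obtain \<alpha> where \<alpha>: "\<alpha> \<in> nat_trans C (left_modules K) F G"
      "bij_betw (\<alpha> x) (val F x) (val G x)"
      unfolding iso_functor_iff[OF category_axioms] using o by blast
    have "\<alpha> x \<in> linear_maps (group_algebra K (Aut C x)) (value_rep C F x) (value_rep C G x)"
      unfolding lin using module_nat_transD[OF Ff Gf \<alpha>(1)] o iso_arrow_Hom by blast
    then show ?R
      unfolding iso_left_module_iff using \<alpha>(2) value_rep_smult(1)[OF K o fin] Ff Gf by auto
  next
    assume ?R
    then obtain \<theta> where
      "\<theta> \<in> linear_maps (group_algebra K (Aut C x)) (value_rep C F x) (value_rep C G x)"
      "bij_betw \<theta> (val F x) (val G x)"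
      unfolding iso_left_module_iff by auto
    then show ?L
      unfolding lin by (intro extend_iso_from_apex[OF F G x]) blast+
  }
qed

lemma apex_iso_functor:
  assumes iso: "(F, G) \<in> iso_rel (functor_category C (left_modules K))" and x: "apex C F x"
  shows "apex C G x"
proof -
  note o = apexD(1)[OF x]
  obtain \<alpha> where Ff: "module_functor C K F" and Gf: "module_functor C K G"
    and \<alpha>: "\<alpha> \<in> nat_trans C (left_modules K) F G"
    and bij: "bij_betw (\<alpha> x) (val F x) (val G x)"
    using iso o unfolding iso_functor_iff[OF category_axioms] by blast
  note D = module_nat_transD[OF Ff Gf \<alpha>]
  have z: "\<alpha> x (zero_at F x) = zero_at G x"
    using linear_zero[OF module_functorD(1)[OF Ff o] module_functorD(1)[OF Gf o] D(1)[OF o]] .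
  have zF: "zero_at F x \<in> val F x"
    by (rule left_module_zero_closed[OF module_functorD(1)[OF Ff o]])
  show ?thesis
    unfolding apex_def
  proof (intro conjI ballI impI o)
    obtain v where v: "v \<in> val F x" "v \<noteq> zero_at F x"
      using nonzero_element[OF module_functorD(1)[OF Ff o] apexD(2)[OF x]] by blast
    have "\<alpha> x v \<noteq> \<alpha> x (zero_at F x)"
      using v zF bij_betw_imp_inj_on[OF bij] by (auto dest: inj_onD)
    moreover have "\<alpha> x v \<in> val G x" using bij v(1) by (auto simp: bij_betw_def)
    ultimately show "val G x \<noteq> {zero_at G x}" using z by auto
  next
    fix f w assume f: "f \<in> Hom C x x" "\<not> iso_arrow C x x f" and "w \<in> val G x"
    then obtain v where v: "v \<in> val F x" "w = \<alpha> x v" using bij by (auto simp: bij_betw_def)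
    show "Far G x x f w = zero_at G x"
      using D(2)[OF o o f(1) v(1)] apexD(3)[OF x f v(1)] z v(2) by simp
  qed
qed

end

section \<open>Transport of functors along injections\<close>

definition transport_module :: "('w \<Rightarrow> 'v) \<Rightarrow> ('r, 'w) module \<Rightarrow> ('r, 'v) module" where
  "transport_module j M = (let i = inv_into (carrier M) j in
     \<lparr>carrier = j ` carrier M, monoid.mult = undefined, monoid.one = undefined,
      ring.zero = j \<zero>\<^bsub>M\<^esub>, ring.add = (\<lambda>u v. j (i u \<oplus>\<^bsub>M\<^esub> i v)),
      module.smult = (\<lambda>a v. j (a \<odot>\<^bsub>M\<^esub> i v))\<rparr>)"

text \<open>
The functor constructed from a representation has values in a type of functions. It is moved to the
type of the representation by injections of the carriers, along which the structure is carried over.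
\<close>

definition transport_functor :: "('o \<Rightarrow> 'w \<Rightarrow> 'v) \<Rightarrow> ('o, 'm, ('r, 'w) module, 'w \<Rightarrow> 'w) fctr \<Rightarrow>
    ('o, 'm, ('r, 'v) module, 'v \<Rightarrow> 'v) fctr" where
  "transport_functor j F =
     \<lparr>Fob = (\<lambda>x. transport_module (j x) (Fob F x)),
      Far = (\<lambda>x y f. \<lambda>v\<in>j x ` val F x. j y (Far F x y f (inv_into (val F x) (j x) v)))\<rparr>"

lemma transport_module_simps:
  "carrier (transport_module j M) = j ` carrier M" "\<zero>\<^bsub>transport_module j M\<^esub> = j \<zero>\<^bsub>M\<^esub>"
  "\<lbrakk>inj_on j (carrier M); u \<in> carrier M; v \<in> carrier M\<rbrakk> \<Longrightarrow> j u \<oplus>\<^bsub>transport_module j M\<^esub> j v = j (u \<oplus>\<^bsub>M\<^esub> v)"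
  "\<lbrakk>inj_on j (carrier M); v \<in> carrier M\<rbrakk> \<Longrightarrow> a \<odot>\<^bsub>transport_module j M\<^esub> j v = j (a \<odot>\<^bsub>M\<^esub> v)"
  by (simp_all add: transport_module_def Let_def)

lemma transport_left_module:
  assumes M: "left_module R M" and j: "inj_on j (carrier M)"
  shows "left_module R (transport_module j M)"
proof -
  interpret M: left_module R M by fact
  have "abelian_group (transport_module j M)"
  proof (rule abelian_groupI)
    fix v assume "v \<in> carrier (transport_module j M)"
    then obtain w where w: "w \<in> carrier M" "v = j w" by (auto simp: transport_module_simps)
    show "\<exists>u\<in>carrier (transport_module j M). u \<oplus>\<^bsub>transport_module j M\<^esub> v = \<zero>\<^bsub>transport_module j M\<^esub>"
      using w j by (intro bexI[of _ "j (\<ominus>\<^bsub>M\<^esub> w)"]) (auto simp: transport_module_simps M.M.l_neg)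
  qed (use j in \<open>auto simp: transport_module_simps M.M.a_ac\<close>)
  then show ?thesis
    unfolding left_module_def left_module_axioms_def
    using j M.R.ring_axioms
    by (auto simp: transport_module_simps M.smult_l_distr M.smult_r_distr M.smult_assoc1)
qed

lemma transport_functor_simps:
  "Fob (transport_functor j F) x = transport_module (j x) (Fob F x)"
  "\<lbrakk>inj_on (j x) (val F x); v \<in> val F x\<rbrakk> \<Longrightarrow>
    Far (transport_functor j F) x y f (j x v) = j y (Far F x y f v)"
  by (simp_all add: transport_functor_def)

lemma (in category) transport_module_functor:
  assumes F: "module_functor C R F" and j: "\<And>x. x \<in> Obj C \<Longrightarrow> inj_on (j x) (val F x)"
  shows "module_functor C R (transport_functor j F)"
proof (rule module_functorI[OF category_axioms])
  note D = module_functorD[OF F]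
  fix x assume x: "x \<in> Obj C"
  interpret Fx: left_module R "Fob F x" by (rule D(1)[OF x])
  show Tx: "left_module R (Fob (transport_functor j F) x)"
    unfolding transport_functor_simps by (rule transport_left_module[OF D(1)[OF x] j[OF x]])
  fix y f assume y: "y \<in> Obj C" and f: "f \<in> Hom C x y"
  show "Far (transport_functor j F) x y f \<in> linear_maps R (Fob (transport_functor j F) x) (Fob (transport_functor j F) y)"
  proof (rule linear_mapsI)
    show "Far (transport_functor j F) x y f \<in> extensional (carrier (Fob (transport_functor j F) x))"
      by (simp add: transport_functor_def transport_module_simps)
  qed (use j[OF x] j[OF y] linear_mapsD[OF D(2)[OF x y f]] in
      \<open>auto simp: transport_functor_simps transport_module_simps\<close>)
qed (use j module_functorD[OF F] Idn_Hom Cmp_Hom in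
    \<open>auto simp: transport_functor_simps transport_module_simps\<close>)

lemma (in category) transport_simple_functor:
  assumes F: "simple_functor C R F" and j: "\<And>x. x \<in> Obj C \<Longrightarrow> inj_on (j x) (val F x)"
  shows "simple_functor C R (transport_functor j F)"
  unfolding simple_functor_iff[OF category_axioms]
proof (intro conjI allI impI)
  note Ff = simple_functorD(1)[OF F]
  note D = module_functorD[OF Ff]
  let ?T = "transport_functor j F"
  show "module_functor C R ?T" by (rule transport_module_functor[OF Ff j])
  obtain x v where x: "x \<in> Obj C" and v: "v \<in> val F x" "v \<noteq> zero_at F x"
    using simple_functorD(2)[OF F] nonzero_element[OF D(1)] by metis
  have "j x v \<noteq> j x (zero_at F x)"
    using inj_onD[OF j[OF x], of v "zero_at F x"] v left_module_zero_closed[OF D(1)[OF x]] by blast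
  then show "\<exists>x\<in>Obj C. val ?T x \<noteq> {zero_at ?T x}"
    using x v by (intro bexI[of _ x]) (auto simp: transport_functor_simps transport_module_simps)
  fix N assume N: "subfctr C R ?T N"
  let ?N = "\<lambda>x. {v \<in> val F x. j x v \<in> N x}"
  have "subfctr C R F ?N"
    unfolding subfctr_def
  proof (intro conjI ballI)
    fix x assume x: "x \<in> Obj C"
    interpret left_module R "Fob F x" by (rule D(1)[OF x])
    show "submod R (Fob F x) (?N x)"
      using submodD[OF subfctrD(1)[OF N x]] j[OF x]
      unfolding submod_def
      by (auto simp: transport_functor_simps transport_module_simps(1,2)
          simp flip: transport_module_simps(3,4)[OF j[OF x]])
  next
    fix x y f v assume *: "x \<in> Obj C" "y \<in> Obj C" "f \<in> Hom C x y" "v \<in> ?N x"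
    then show "Far F x y f v \<in> ?N y"
      using subfctrD(2)[OF N *(1-3), of "j x v"] j[OF *(1)] D(5)[OF *(1-3)]
      by (auto simp: transport_functor_simps)
  qed
  then consider "\<forall>x\<in>Obj C. ?N x = {zero_at F x}" | "\<forall>x\<in>Obj C. ?N x = val F x"
    using F unfolding simple_functor_iff[OF category_axioms] by blast
  moreover have "N x = j x ` ?N x" if "x \<in> Obj C" for x
    using submodD(1)[OF subfctrD(1)[OF N that]] by (auto simp: transport_functor_simps transport_module_simps)
  ultimately show "(\<forall>x\<in>Obj C. N x = {zero_at ?T x}) \<or> (\<forall>x\<in>Obj C. N x = val ?T x)"
    by cases (simp_all add: transport_functor_simps transport_module_simps)
qed

section \<open>The simple functor with a given representation at its apex\<close>

definition function_module :: "'h set \<Rightarrow> ('r, 'v) module \<Rightarrow> ('r, 'h \<Rightarrow> 'v) module" where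
  "function_module H W =
     \<lparr>carrier = H \<rightarrow>\<^sub>E carrier W, monoid.mult = undefined, monoid.one = undefined,
      ring.zero = (\<lambda>h\<in>H. \<zero>\<^bsub>W\<^esub>), ring.add = (\<lambda>p q. \<lambda>h\<in>H. p h \<oplus>\<^bsub>W\<^esub> q h),
      module.smult = (\<lambda>a p. \<lambda>h\<in>H. a \<odot>\<^bsub>W\<^esub> p h)\<rparr>"

lemma function_module_simps [simp]:
  "carrier (function_module H W) = H \<rightarrow>\<^sub>E carrier W" "\<zero>\<^bsub>function_module H W\<^esub> = (\<lambda>h\<in>H. \<zero>\<^bsub>W\<^esub>)"
  "p \<oplus>\<^bsub>function_module H W\<^esub> q = (\<lambda>h\<in>H. p h \<oplus>\<^bsub>W\<^esub> q h)"
  "a \<odot>\<^bsub>function_module H W\<^esub> p = (\<lambda>h\<in>H. a \<odot>\<^bsub>W\<^esub> p h)"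
  by (simp_all add: function_module_def)

lemma function_left_module:
  assumes "left_module R W"
  shows "left_module R (function_module H W)"
proof -
  interpret W: left_module R W by fact
  have "abelian_group (function_module H W)"
  proof (rule abelian_groupI)
    fix p assume p: "p \<in> carrier (function_module H W)"
    then have in_W: "p h \<in> carrier W" if "h \<in> H" for h using that by auto
    show "\<exists>q\<in>carrier (function_module H W). q \<oplus>\<^bsub>function_module H W\<^esub> p = \<zero>\<^bsub>function_module H W\<^esub>"
      by (intro bexI[of _ "\<lambda>h\<in>H. \<ominus>\<^bsub>W\<^esub> p h"]) (auto simp: in_W W.M.l_neg intro!: restrict_ext)
    show "\<zero>\<^bsub>function_module H W\<^esub> \<oplus>\<^bsub>function_module H W\<^esub> p = p"
      by (rule PiE_ext[of _ H "\<lambda>_. carrier W"]) (use p in_W in auto)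
  qed (auto intro!: restrict_ext W.M.a_assoc W.M.a_comm)
  moreover have "\<one>\<^bsub>R\<^esub> \<odot>\<^bsub>function_module H W\<^esub> p = p" if p: "p \<in> carrier (function_module H W)" for p
    by (rule PiE_ext[of _ H "\<lambda>_. carrier W"]) (use p in \<open>auto simp: PiE_mem[of p H "\<lambda>_. carrier W"]\<close>)
  ultimately show ?thesis
    unfolding left_module_def left_module_axioms_def
    using W.R.ring_axioms
    by (auto intro!: restrict_ext W.smult_l_distr W.smult_r_distr W.smult_assoc1)
qed

text \<open>
The construction of a functor from its value at \<open>x\<close> starts from an action of the whole endomorphism
monoid; a representation of \<open>Aut(x)\<close> becomes one by letting the nonunits act as zero.
\<close>

locale End_representation = category C + W: left_module K W
  for C :: "('o, 'm) cat" and K :: "('k, 'a) ring_scheme" and W :: "('k, 'v) module" +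
  fixes x :: 'o and \<rho> :: "'m \<Rightarrow> 'v \<Rightarrow> 'v"
  assumes x: "x \<in> Obj C"
    and rho_linear: "f \<in> Hom C x x \<Longrightarrow> \<rho> f \<in> linear_maps K W W"
    and rho_Cmp: "\<lbrakk>f \<in> Hom C x x; g \<in> Hom C x x; v \<in> carrier W\<rbrakk> \<Longrightarrow> \<rho> (Cmp C x x x f g) v = \<rho> f (\<rho> g v)"
    and rho_Idn: "v \<in> carrier W \<Longrightarrow> \<rho> (Idn C x) v = v"
begin

lemmas rho = linear_mapsD[OF rho_linear]

lemma rho_zero: "f \<in> Hom C x x \<Longrightarrow> \<rho> f \<zero>\<^bsub>W\<^esub> = \<zero>\<^bsub>W\<^esub>"
  by (rule linear_zero[OF W.left_module_axioms W.left_module_axioms rho_linear])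

lemma Hom_xx: "\<lbrakk>y \<in> Obj C; g \<in> Hom C x y; h \<in> Hom C y x\<rbrakk> \<Longrightarrow> Cmp C x y x h g \<in> Hom C x x"
  using Cmp_Hom x by blast

text \<open>
The image of \<open>v\<close> under \<open>g\<close> in the coinduced functor \<open>y \<mapsto> Map(C(y, x), W)\<close>, where \<open>v\<close> is identified
with \<open>h \<mapsto> \<rho> h v\<close>.
\<close>

definition gen :: "'o \<Rightarrow> 'm \<Rightarrow> 'v \<Rightarrow> 'm \<Rightarrow> 'v" where
  "gen y g v = (\<lambda>h\<in>Hom C y x. \<rho> (Cmp C x y x h g) v)"

abbreviation maps_at :: "'o \<Rightarrow> ('k, 'm \<Rightarrow> 'v) module" where
  "maps_at y \<equiv> function_module (Hom C y x) W"

inductive_set generated :: "'o \<Rightarrow> ('m \<Rightarrow> 'v) set" for y where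
  generated_zero: "\<zero>\<^bsub>maps_at y\<^esub> \<in> generated y"
| generated_add: "\<lbrakk>g \<in> Hom C x y; v \<in> carrier W; \<phi> \<in> generated y\<rbrakk> \<Longrightarrow> gen y g v \<oplus>\<^bsub>maps_at y\<^esub> \<phi> \<in> generated y"

lemma gen_in: "\<lbrakk>y \<in> Obj C; g \<in> Hom C x y; v \<in> carrier W\<rbrakk> \<Longrightarrow> gen y g v \<in> carrier (maps_at y)"
  using Hom_xx rho(1) by (auto simp: gen_def)

lemma generated_in: "\<lbrakk>y \<in> Obj C; \<phi> \<in> generated y\<rbrakk> \<Longrightarrow> \<phi> \<in> carrier (maps_at y)"
proof (rotate_tac, induction rule: generated.induct)
  case (generated_add g v \<phi>)
  have "\<phi> h \<in> carrier W" "gen y g v h \<in> carrier W" if "h \<in> Hom C y x" for h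
    using gen_in[OF generated_add(5,1,2)] generated_add(4)[OF generated_add(5)] that by auto
  then show ?case unfolding function_module_simps by (intro restrict_PiE_iff[THEN iffD2]) simp
qed simp

lemma generated_submod:
  assumes y: "y \<in> Obj C"
  shows "submod K (maps_at y) (generated y)"
proof -
  interpret A: left_module K "maps_at y" by (rule function_left_module[OF W.left_module_axioms])
  have add: "\<phi> \<oplus>\<^bsub>maps_at y\<^esub> \<psi> \<in> generated y" if "\<phi> \<in> generated y" "\<psi> \<in> generated y" for \<phi> \<psi>
    using that
  proof (induction rule: generated.induct)
    case generated_zero
    then show ?case using A.M.l_zero[OF generated_in[OF y]] by simp
  next
    case (generated_add g v \<phi>)
    then show ?case
      using A.M.a_assoc[OF gen_in[OF y generated_add(1,2)] generated_in[OF y generated_add(3)] generated_in[OF y generated_add(5)]]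
        generated.generated_add[OF generated_add(1,2) generated_add(4)[OF generated_add(5)]] by (simp only:)
  qed
  have smult: "a \<odot>\<^bsub>maps_at y\<^esub> \<phi> \<in> generated y" if a: "a \<in> carrier K" and "\<phi> \<in> generated y" for a \<phi>
    using that(2)
  proof (induction rule: generated.induct)
    case generated_zero
    show ?case using A.smult_r_null[OF a] generated.generated_zero by (simp only:)
  next
    case (generated_add g v \<phi>)
    have "a \<odot>\<^bsub>maps_at y\<^esub> gen y g v = gen y g (a \<odot>\<^bsub>W\<^esub> v)"
      using generated_add a y Hom_xx by (auto simp: gen_def rho(3) intro!: restrict_ext)
    then show ?case
      using A.smult_r_distr[OF a gen_in[OF y generated_add(1,2)] generated_in[OF y generated_add(3)]]
        generated.generated_add[OF generated_add(1) W.smult_closed[OF a generated_add(2)] generated_add(4)] by (simp only:)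
  qed
  show ?thesis
    unfolding submod_def using generated_in[OF y] generated.generated_zero add smult by blast
qed

lemma gen_generated:
  assumes "y \<in> Obj C" "g \<in> Hom C x y" "v \<in> carrier W"
  shows "gen y g v \<in> generated y"
proof -
  interpret A: left_module K "maps_at y" by (rule function_left_module[OF W.left_module_axioms])
  show ?thesis using generated.generated_add[OF assms(2,3) generated.generated_zero] A.M.r_zero[OF gen_in[OF assms]] by (simp only:)
qed

text \<open>
The subfunctor generated by \<open>W\<close> in the coinduced functor. Elements of the coinduced functor are
separated by arrows into \<open>x\<close>, and this subfunctor is in addition generated at \<open>x\<close>; the two properties
together make it simple when \<open>W\<close> is.
\<close>

definition ext_functor :: "('o, 'm, ('k, 'm \<Rightarrow> 'v) module, ('m \<Rightarrow> 'v) \<Rightarrow> ('m \<Rightarrow> 'v)) fctr" where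
  "ext_functor = \<lparr>Fob = (\<lambda>y. (maps_at y)\<lparr>carrier := generated y\<rparr>),
     Far = (\<lambda>y z k. \<lambda>\<phi>\<in>generated y. \<lambda>h\<in>Hom C z x. \<phi> (Cmp C y z x h k))\<rparr>"

lemma Fob_ext_functor [simp]:
  "val ext_functor y = generated y" "zero_at ext_functor y = \<zero>\<^bsub>maps_at y\<^esub>"
  "\<phi> \<oplus>\<^bsub>Fob ext_functor y\<^esub> \<psi> = \<phi> \<oplus>\<^bsub>maps_at y\<^esub> \<psi>" "a \<odot>\<^bsub>Fob ext_functor y\<^esub> \<phi> = a \<odot>\<^bsub>maps_at y\<^esub> \<phi>"
  by (simp_all add: ext_functor_def)

lemma Far_ext_functor:
  "\<phi> \<in> generated y \<Longrightarrow> Far ext_functor y z k \<phi> = (\<lambda>h\<in>Hom C z x. \<phi> (Cmp C y z x h k))"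
  by (simp add: ext_functor_def)

lemma ext_functor_gen:
  assumes "y \<in> Obj C" "z \<in> Obj C" "g \<in> Hom C x y" "k \<in> Hom C y z" "v \<in> carrier W"
  shows "Far ext_functor y z k (gen y g v) = gen z (Cmp C x y z k g) v"
  unfolding Far_ext_functor[OF gen_generated[OF assms(1,3,5)]]
  unfolding gen_def using assms x Cmp_Hom[of y z x k]
  by (auto intro!: restrict_ext simp: Cmp_assoc)

lemma ext_functor_generated:
  assumes y: "y \<in> Obj C" and z: "z \<in> Obj C" and k: "k \<in> Hom C y z" and "\<phi> \<in> generated y"
  shows "Far ext_functor y z k \<phi> \<in> generated z"
  using assms(4)
proof (induction rule: generated.induct)
  case generated_zero
  have "Far ext_functor y z k \<zero>\<^bsub>maps_at y\<^esub> = \<zero>\<^bsub>maps_at z\<^esub>"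
    unfolding Far_ext_functor[OF generated.generated_zero] using Cmp_Hom[OF y z x k] by (auto intro!: restrict_ext)
  then show ?case using generated.generated_zero by (simp only:)
next
  case (generated_add g v \<phi>)
  have "Far ext_functor y z k (gen y g v \<oplus>\<^bsub>maps_at y\<^esub> \<phi>)
      = Far ext_functor y z k (gen y g v) \<oplus>\<^bsub>maps_at z\<^esub> Far ext_functor y z k \<phi>"
    unfolding Far_ext_functor[OF generated_add(3)] Far_ext_functor[OF generated.generated_add[OF generated_add(1-3)]]
      Far_ext_functor[OF gen_generated[OF y generated_add(1,2)]]
    using Cmp_Hom[OF y z x k] by (auto intro!: restrict_ext)
  also have "Far ext_functor y z k (gen y g v) = gen z (Cmp C x y z k g) v"
    using ext_functor_gen y z generated_add k by blast
  finally show ?case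
    using generated.generated_add[OF Cmp_Hom[OF x y z generated_add(1) k] generated_add(2,4)] by (simp only:)
qed

lemma ext_module_functor: "module_functor C K ext_functor"
proof (rule module_functorI[OF category_axioms])
  note maps_module = function_left_module[OF W.left_module_axioms]
  fix y assume y: "y \<in> Obj C"
  show L: "left_module K (Fob ext_functor y)"
    unfolding ext_functor_def using submod_left_module[OF maps_module generated_submod[OF y]] by simp
  fix z k assume z: "z \<in> Obj C" and k: "k \<in> Hom C y z"
  note S = submodD[OF generated_submod[OF y]]
  have comp: "Cmp C y z x h k \<in> Hom C y x" if "h \<in> Hom C z x" for h using Cmp_Hom[OF y z x k that] .
  show "Far ext_functor y z k \<in> linear_maps K (Fob ext_functor y) (Fob ext_functor z)"
  proof (rule linear_mapsI)
    show "Far ext_functor y z k \<in> extensional (val ext_functor y)"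
      by (simp add: ext_functor_def)
    fix \<phi> \<psi> assume *: "\<phi> \<in> val ext_functor y" "\<psi> \<in> val ext_functor y"
    then have "\<phi> \<in> generated y" "\<psi> \<in> generated y" "\<phi> \<oplus>\<^bsub>maps_at y\<^esub> \<psi> \<in> generated y" using S(3) by auto
    then show "Far ext_functor y z k (\<phi> \<oplus>\<^bsub>Fob ext_functor y\<^esub> \<psi>) =
        Far ext_functor y z k \<phi> \<oplus>\<^bsub>Fob ext_functor z\<^esub> Far ext_functor y z k \<psi>"
      unfolding Fob_ext_functor by (simp only: Far_ext_functor) (auto simp: comp intro!: restrict_ext)
  next
    fix a \<phi> assume *: "a \<in> carrier K" "\<phi> \<in> val ext_functor y"
    then have "\<phi> \<in> generated y" "a \<odot>\<^bsub>maps_at y\<^esub> \<phi> \<in> generated y" using S(4) by auto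
    then show "Far ext_functor y z k (a \<odot>\<^bsub>Fob ext_functor y\<^esub> \<phi>) = a \<odot>\<^bsub>Fob ext_functor z\<^esub> Far ext_functor y z k \<phi>"
      unfolding Fob_ext_functor by (simp only: Far_ext_functor) (auto simp: comp intro!: restrict_ext)
  qed (use ext_functor_generated[OF y z k] in simp)
next
  fix y \<phi> assume y: "y \<in> Obj C" and "\<phi> \<in> val ext_functor y"
  then have \<phi>: "\<phi> \<in> generated y" by simp
  show "Far ext_functor y y (Idn C y) \<phi> = \<phi>"
    unfolding Far_ext_functor[OF \<phi>]
    by (rule extensionalityI[of _ "Hom C y x"])
      (use generated_in[OF y \<phi>] y x in \<open>auto simp: Cmp_Idn_right PiE_def\<close>)
next
  fix y z w f g \<phi>
  assume *: "y \<in> Obj C" "z \<in> Obj C" "w \<in> Obj C" "f \<in> Hom C y z" "g \<in> Hom C z w"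
    and "\<phi> \<in> val ext_functor y"
  then have \<phi>: "\<phi> \<in> generated y" by simp
  show "Far ext_functor y w (Cmp C y z w g f) \<phi> = Far ext_functor z w g (Far ext_functor y z f \<phi>)"
    unfolding Far_ext_functor[OF ext_functor_generated[OF *(1,2,4) \<phi>]] unfolding Far_ext_functor[OF \<phi>]
    using * x Cmp_Hom[OF *(2,3) x *(5)] by (auto intro!: restrict_ext simp: Cmp_assoc)
qed

definition \<eta> :: "'v \<Rightarrow> 'm \<Rightarrow> 'v" where "\<eta> v = gen x (Idn C x) v"

lemma gen_x:
  assumes "f \<in> Hom C x x" "v \<in> carrier W"
  shows "gen x f v = \<eta> (\<rho> f v)"
  unfolding \<eta>_def gen_def using assms x by (auto simp: rho_Cmp Cmp_Idn_right intro!: restrict_ext)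

lemma eta_Idn: "v \<in> carrier W \<Longrightarrow> \<eta> v (Idn C x) = v"
  using x Idn_Hom by (simp add: \<eta>_def gen_def Cmp_Idn_right rho_Idn)

lemma eta_inj: "inj_on \<eta> (carrier W)"
  by (rule inj_on_inverseI[where g = "\<lambda>\<phi>. \<phi> (Idn C x)"]) (rule eta_Idn)

lemma eta_generated: "v \<in> carrier W \<Longrightarrow> \<eta> v \<in> generated x"
  unfolding \<eta>_def by (rule gen_generated[OF x Idn_Hom[OF x]])

lemma eta_zero: "\<eta> \<zero>\<^bsub>W\<^esub> = \<zero>\<^bsub>maps_at x\<^esub>"
  using x by (auto simp: \<eta>_def gen_def Cmp_Idn_right rho_zero intro!: restrict_ext)

lemma eta_add: "\<lbrakk>u \<in> carrier W; v \<in> carrier W\<rbrakk> \<Longrightarrow> \<eta> (u \<oplus>\<^bsub>W\<^esub> v) = \<eta> u \<oplus>\<^bsub>maps_at x\<^esub> \<eta> v"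
  using x by (auto simp: \<eta>_def gen_def Cmp_Idn_right rho intro!: restrict_ext)

lemma eta_smult: "\<lbrakk>a \<in> carrier K; v \<in> carrier W\<rbrakk> \<Longrightarrow> \<eta> (a \<odot>\<^bsub>W\<^esub> v) = a \<odot>\<^bsub>maps_at x\<^esub> \<eta> v"
  using x by (auto simp: \<eta>_def gen_def Cmp_Idn_right rho intro!: restrict_ext)

lemma eta_image: "\<eta> ` carrier W = generated x"
proof
  show "\<eta> ` carrier W \<subseteq> generated x" using eta_generated by blast
  show "generated x \<subseteq> \<eta> ` carrier W"
  proof
    fix \<phi> assume "\<phi> \<in> generated x"
    then show "\<phi> \<in> \<eta> ` carrier W"
    proof (induction rule: generated.induct)
      case generated_zero
      show ?case unfolding eta_zero[symmetric] by (rule imageI) simp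
    next
      case (generated_add g v \<phi>)
      then obtain w where w: "w \<in> carrier W" "\<phi> = \<eta> w" by blast
      have "gen x g v \<oplus>\<^bsub>maps_at x\<^esub> \<phi> = \<eta> (\<rho> g v \<oplus>\<^bsub>W\<^esub> w)"
        using gen_x[OF generated_add(1,2)] eta_add[OF rho(1)[OF generated_add(1,2)] w(1)] w(2) by (simp only:)
      then show ?case using rho(1)[OF generated_add(1,2)] w(1) by (metis W.M.a_closed imageI)
    qed
  qed
qed

lemma Far_eta: "\<lbrakk>y \<in> Obj C; g \<in> Hom C x y; v \<in> carrier W\<rbrakk> \<Longrightarrow> Far ext_functor x y g (\<eta> v) = gen y g v"
  unfolding \<eta>_def using ext_functor_gen[OF x _ Idn_Hom[OF x]] by (simp add: Cmp_Idn_right x)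

lemma Far_x_eta: "\<lbrakk>f \<in> Hom C x x; v \<in> carrier W\<rbrakk> \<Longrightarrow> Far ext_functor x x f (\<eta> v) = \<eta> (\<rho> f v)"
  using Far_eta[OF x] gen_x by simp

text \<open>
A subfunctor \<open>N\<close> meets the value at \<open>x\<close> in zero or everything. In the first case it vanishes, as
\<open>\<phi>(h)\<close> is the value at the identity of the image of \<open>\<phi>\<close> under \<open>h\<close>; in the second it contains the
generators.
\<close>

theorem ext_simple_functor:
  assumes nonzero: "carrier W \<noteq> {\<zero>\<^bsub>W\<^esub>}"
    and simple: "\<And>U. \<lbrakk>submod K W U; \<And>f v. \<lbrakk>f \<in> Hom C x x; v \<in> U\<rbrakk> \<Longrightarrow> \<rho> f v \<in> U\<rbrakk>
      \<Longrightarrow> U = {\<zero>\<^bsub>W\<^esub>} \<or> U = carrier W"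
  shows "simple_functor C K ext_functor"
  unfolding simple_functor_iff[OF category_axioms]
proof (intro conjI allI impI ext_module_functor)
  obtain v where v: "v \<in> carrier W" "v \<noteq> \<zero>\<^bsub>W\<^esub>"
    using nonzero_element[OF W.left_module_axioms nonzero] by blast
  then have "\<eta> v \<noteq> \<zero>\<^bsub>maps_at x\<^esub>" using inj_onD[OF eta_inj] eta_zero W.M.zero_closed by metis
  then have "val ext_functor x \<noteq> {zero_at ext_functor x}"
    unfolding Fob_ext_functor using eta_generated[OF v(1)] by blast
  then show "\<exists>x\<in>Obj C. val ext_functor x \<noteq> {zero_at ext_functor x}" using x by blast
  fix N assume N: "subfctr C K ext_functor N"
  note Nx = submodD[OF subfctrD(1)[OF N x], unfolded Fob_ext_functor]
  let ?U = "{v \<in> carrier W. \<eta> v \<in> N x}"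
  have "submod K W ?U"
    unfolding submod_def
  proof (intro conjI ballI; (elim CollectE conjE)?)
    show "\<zero>\<^bsub>W\<^esub> \<in> ?U" using Nx(2) by (simp only: eta_zero W.M.zero_closed mem_Collect_eq simp_thms)
    show "u \<oplus>\<^bsub>W\<^esub> v \<in> ?U" if "u \<in> carrier W" "\<eta> u \<in> N x" "v \<in> carrier W" "\<eta> v \<in> N x" for u v
      using Nx(3)[OF that(2,4)] that by (simp only: eta_add W.M.a_closed mem_Collect_eq simp_thms)
    show "a \<odot>\<^bsub>W\<^esub> v \<in> ?U" if "a \<in> carrier K" "v \<in> carrier W" "\<eta> v \<in> N x" for a v
      using Nx(4)[OF that(1,3)] that by (simp only: eta_smult W.smult_closed mem_Collect_eq simp_thms)
  qed blast
  moreover have "\<rho> f v \<in> ?U" if "f \<in> Hom C x x" "v \<in> ?U" for f v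
    using subfctrD(2)[OF N x x that(1), of "\<eta> v"] Far_x_eta[OF that(1), of v] rho(1)[OF that(1)] that(2) by auto
  ultimately consider "?U = {\<zero>\<^bsub>W\<^esub>}" | "?U = carrier W" using simple by blast
  then show "(\<forall>y\<in>Obj C. N y = {zero_at ext_functor y}) \<or> (\<forall>y\<in>Obj C. N y = val ext_functor y)"
  proof cases
    case 1
    have "\<phi> = \<zero>\<^bsub>maps_at y\<^esub>" if y: "y \<in> Obj C" and \<phi>: "\<phi> \<in> N y" for y \<phi>
    proof -
      have \<phi>s: "\<phi> \<in> generated y" using submodD(1)[OF subfctrD(1)[OF N y] \<phi>] by simp
      have "\<phi> h = \<zero>\<^bsub>W\<^esub>" if h: "h \<in> Hom C y x" for h
      proof -
        have "Far ext_functor y x h \<phi> \<in> N x" by (rule subfctrD(2)[OF N y x h \<phi>])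
        moreover obtain v where v: "v \<in> carrier W" "Far ext_functor y x h \<phi> = \<eta> v"
          using ext_functor_generated[OF y x h \<phi>s] eta_image by blast
        ultimately have "v = \<zero>\<^bsub>W\<^esub>" using 1 by auto
        then have "Far ext_functor y x h \<phi> (Idn C x) = \<zero>\<^bsub>W\<^esub>" using v eta_Idn by simp
        then show ?thesis
          unfolding Far_ext_functor[OF \<phi>s] using Idn_Hom[OF x] Cmp_Idn_left[OF y x h] by simp
      qed
      then show ?thesis
        using generated_in[OF y \<phi>s] by (intro extensionalityI[of _ "Hom C y x"]) (auto simp: PiE_def)
    qed
    then have "N y = {zero_at ext_functor y}" if "y \<in> Obj C" for y
      unfolding Fob_ext_functor using submodD(2)[OF subfctrD(1)[OF N that], unfolded Fob_ext_functor] that by blast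
    then show ?thesis by blast
  next
    case 2
    have "\<phi> \<in> N y" if y: "y \<in> Obj C" and "\<phi> \<in> generated y" for y \<phi>
      using that(2)
    proof (induction rule: generated.induct)
      case generated_zero
      show ?case using submodD(2)[OF subfctrD(1)[OF N y]] unfolding Fob_ext_functor .
    next
      case (generated_add g v \<phi>)
      have "gen y g v \<in> N y"
        using subfctrD(2)[OF N x y generated_add(1), of "\<eta> v"] Far_eta[OF y generated_add(1,2)] 2 generated_add(2) by auto
      then show ?case using submodD(3)[OF subfctrD(1)[OF N y]] generated_add(4) unfolding Fob_ext_functor by blast
    qed
    then have "N y = val ext_functor y" if "y \<in> Obj C" for y
      unfolding Fob_ext_functor using submodD(1)[OF subfctrD(1)[OF N that]] that by auto
    then show ?thesis by blast
  qed
qed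

end

section \<open>Cardinality of the values\<close>

text \<open>
The map \<open>a \<mapsto> a\<^sup>2 - a\<close> takes the value \<open>0\<close> twice. On a finite field it is therefore not surjective,
and for a missing value \<open>c\<close> the polynomial \<open>X\<^sup>2 - X - c\<close> has no root.
\<close>

lemma algebraically_closed_infinite:
  assumes "algebraically_closed K"
  shows "infinite (carrier K)"
proof
  interpret K: algebraically_closed K by fact
  assume fin: "finite (carrier K)"
  let ?q = "\<lambda>a. a \<otimes>\<^bsub>K\<^esub> a \<ominus>\<^bsub>K\<^esub> a"
  have "?q ` carrier K \<subseteq> carrier K" by auto
  moreover have "\<not> inj_on ?q (carrier K)"
  proof
    assume "inj_on ?q (carrier K)"
    moreover have "?q \<one>\<^bsub>K\<^esub> = ?q \<zero>\<^bsub>K\<^esub>" by (simp add: K.minus_eq K.r_neg)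
    ultimately show False using inj_onD[of ?q "carrier K" "\<one>\<^bsub>K\<^esub>" "\<zero>\<^bsub>K\<^esub>"] by simp
  qed
  ultimately have "?q ` carrier K \<noteq> carrier K"
    using fin by (metis eq_card_imp_inj_on)
  then obtain c where c: "c \<in> carrier K" "\<And>a. a \<in> carrier K \<Longrightarrow> ?q a \<noteq> c" by blast
  \<comment> \<open>Coefficient lists start with the leading coefficient.\<close>
  let ?p = "[\<one>\<^bsub>K\<^esub>, \<ominus>\<^bsub>K\<^esub> \<one>\<^bsub>K\<^esub>, \<ominus>\<^bsub>K\<^esub> c]"
  have p: "?p \<in> carrier (poly_ring K)"
    using c by (auto simp: univ_poly_carrier[symmetric] polynomial_def)
  have "size (K.roots ?p) = degree ?p"
    using K.roots_over_carrier[OF p] by (simp add: K.splitted_def)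
  then have "K.roots ?p \<noteq> {#}" by auto
  then obtain a where "a \<in># K.roots ?p" by blast
  then have "K.is_root ?p a" using K.roots_mem_iff_is_root[OF p] by simp
  then have a: "a \<in> carrier K" and "K.eval ?p a = \<zero>\<^bsub>K\<^esub>" by (auto simp: K.is_root_def)
  then have "(a \<otimes>\<^bsub>K\<^esub> a) \<oplus>\<^bsub>K\<^esub> ((\<ominus>\<^bsub>K\<^esub> \<one>\<^bsub>K\<^esub>) \<otimes>\<^bsub>K\<^esub> a \<oplus>\<^bsub>K\<^esub> \<ominus>\<^bsub>K\<^esub> c) = \<zero>\<^bsub>K\<^esub>"
    using c by (simp add: numeral_2_eq_2)
  then have "?q a \<oplus>\<^bsub>K\<^esub> \<ominus>\<^bsub>K\<^esub> c = \<zero>\<^bsub>K\<^esub>"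
    using a c by (simp add: K.minus_eq K.a_assoc K.l_minus)
  then have "?q a = c"
    using a c by (metis K.add.inv_closed K.m_closed K.minus_closed K.minus_equality K.minus_minus)
  then show False using c(2)[OF a] by simp
qed

lemma infinite_vector_space:
  assumes K: "field K" and inf: "infinite (carrier K)"
    and W: "left_module K W" "carrier W \<noteq> {\<zero>\<^bsub>W\<^esub>}"
  shows "infinite (carrier W)"
proof
  interpret K: field K by fact
  interpret W: left_module K W by fact
  assume fin: "finite (carrier W)"
  obtain v where v: "v \<in> carrier W" "v \<noteq> \<zero>\<^bsub>W\<^esub>" using nonzero_element[OF W] by blast
  have "inj_on (\<lambda>a. a \<odot>\<^bsub>W\<^esub> v) (carrier K)"
  proof (rule inj_onI, rule ccontr)
    fix a b assume ab: "a \<in> carrier K" "b \<in> carrier K" "a \<odot>\<^bsub>W\<^esub> v = b \<odot>\<^bsub>W\<^esub> v" "a \<noteq> b"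
    let ?c = "a \<oplus>\<^bsub>K\<^esub> \<ominus>\<^bsub>K\<^esub> b"
    have c: "?c \<in> Units K" using ab K.field_Units K.r_right_minus_eq[of a b] by (auto simp: K.minus_eq)
    have "?c \<odot>\<^bsub>W\<^esub> v = \<zero>\<^bsub>W\<^esub>"
      using ab v by (simp add: W.smult_l_distr W.smult_l_minus W.M.r_neg)
    then have "(inv\<^bsub>K\<^esub> ?c \<otimes>\<^bsub>K\<^esub> ?c) \<odot>\<^bsub>W\<^esub> v = \<zero>\<^bsub>W\<^esub>"
      using c v K.Units_closed[OF c] K.Units_inv_closed[OF c] by (simp only: W.smult_assoc1 W.smult_r_null)
    then show False using v K.Units_l_inv[OF c] by simp
  qed
  moreover have "(\<lambda>a. a \<odot>\<^bsub>W\<^esub> v) ` carrier K \<subseteq> carrier W" using v by auto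
  ultimately show False using inf fin finite_imageD finite_subset by blast
qed

lemma finite_power_inj:
  assumes "finite R" and inf: "infinite W"
  shows "\<exists>j. inj_on j (R \<rightarrow>\<^sub>E W) \<and> j ` (R \<rightarrow>\<^sub>E W) \<subseteq> W"
  using assms(1)
proof (induction R)
  case empty
  obtain w where "w \<in> W" using inf by fastforce
  then show ?case by (intro exI[of _ "\<lambda>_. w"]) auto
next
  case (insert r R)
  obtain j where j: "inj_on j (R \<rightarrow>\<^sub>E W)" "j ` (R \<rightarrow>\<^sub>E W) \<subseteq> W" using insert by blast
  obtain p where p: "inj_on p (W \<times> W)" "p ` (W \<times> W) \<subseteq> W"
    using card_of_Times_same_infinite[OF inf] ordIso_imp_ordLeq card_of_ordLeq[of "W \<times> W" W] by blast
  let ?k = "\<lambda>\<phi>. p (\<phi> r, j (restrict \<phi> R))"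
  have in_R: "restrict \<phi> R \<in> R \<rightarrow>\<^sub>E W" "\<phi> r \<in> W" if "\<phi> \<in> insert r R \<rightarrow>\<^sub>E W" for \<phi>
    using that by auto
  have "inj_on ?k (insert r R \<rightarrow>\<^sub>E W)"
  proof (rule inj_onI)
    fix \<phi> \<psi> assume \<phi>: "\<phi> \<in> insert r R \<rightarrow>\<^sub>E W" and \<psi>: "\<psi> \<in> insert r R \<rightarrow>\<^sub>E W" and "?k \<phi> = ?k \<psi>"
    then have "(\<phi> r, j (restrict \<phi> R)) = (\<psi> r, j (restrict \<psi> R))"
      using j(2) in_R[OF \<phi>] in_R[OF \<psi>] by (intro inj_onD[OF p(1)]) auto
    then have r: "\<phi> r = \<psi> r" and R: "restrict \<phi> R = restrict \<psi> R"
      using inj_onD[OF j(1)] in_R[OF \<phi>] in_R[OF \<psi>] by auto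
    show "\<phi> = \<psi>"
    proof (rule PiE_ext[OF \<phi> \<psi>])
      fix a assume "a \<in> insert r R"
      then show "\<phi> a = \<psi> a" using r fun_cong[OF R, of a] by auto
    qed
  qed
  moreover have "?k ` (insert r R \<rightarrow>\<^sub>E W) \<subseteq> W"
  proof (rule image_subsetI)
    fix \<phi> assume "\<phi> \<in> insert r R \<rightarrow>\<^sub>E W"
    then have "(\<phi> r, j (restrict \<phi> R)) \<in> W \<times> W"
      using in_R[of \<phi>] image_subset_iff[THEN iffD1, OF j(2)] by simp
    then show "?k \<phi> \<in> W" using p(2) by (rule subsetD[OF _ imageI, rotated])
  qed
  ultimately show ?case by blast
qed

context End_representation
begin

lemma generated_equivariant:
  assumes y: "y \<in> Obj C" and f: "f \<in> Hom C x x" and h: "h \<in> Hom C y x" and "\<phi> \<in> generated y"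
  shows "\<phi> (Cmp C y x x f h) = \<rho> f (\<phi> h)"
  using assms(4)
proof (induction rule: generated.induct)
  case generated_zero
  then show ?case using rho_zero[OF f] h Cmp_Hom[OF y x x h f] by simp
next
  case (generated_add g v \<phi>)
  have "gen y g v (Cmp C y x x f h) = \<rho> f (gen y g v h)"
    using generated_add(1,2) f h Cmp_Hom[OF y x x h f] Hom_xx[OF y generated_add(1) h] y x
    by (simp add: gen_def Cmp_assoc rho_Cmp)
  then show ?case
    using generated_add(4) f h Cmp_Hom[OF y x x h f] gen_in[OF y generated_add(1,2)] generated_in[OF y generated_add(3)]
      rho(2)[OF f] by (auto simp: PiE_mem[where T = "\<lambda>_. carrier W"])
qed

text \<open>
The generator given by \<open>g\<close> is nonzero at \<open>h\<close> only if \<open>h g\<close> is invertible, and then \<open>h\<close> has a section.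
\<close>

lemma generated_support:
  assumes y: "y \<in> Obj C" and h: "h \<in> Hom C y x" and "\<phi> \<in> generated y"
    and non_iso: "\<And>f v. \<lbrakk>f \<in> Hom C x x; \<not> iso_arrow C x x f; v \<in> carrier W\<rbrakk> \<Longrightarrow> \<rho> f v = \<zero>\<^bsub>W\<^esub>"
    and no_section: "\<And>s. s \<in> Hom C x y \<Longrightarrow> Cmp C x y x h s \<noteq> Idn C x"
  shows "\<phi> h = \<zero>\<^bsub>W\<^esub>"
  using assms(3)
proof (induction rule: generated.induct)
  case (generated_add g v \<phi>)
  have "\<not> iso_arrow C x x (Cmp C x y x h g)"
  proof
    assume "iso_arrow C x x (Cmp C x y x h g)"
    then obtain u where u: "u \<in> Hom C x x" "Cmp C x x x (Cmp C x y x h g) u = Idn C x"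
      by (auto simp: iso_arrow_def)
    then show False
      using no_section[of "Cmp C x x y g u"] Cmp_assoc[OF x x y x u(1) generated_add(1) h]
        Cmp_Hom[OF x x y u(1) generated_add(1)] by simp
  qed
  then have "gen y g v h = \<zero>\<^bsub>W\<^esub>"
    using non_iso Hom_xx[OF y generated_add(1) h] generated_add(2) h by (simp add: gen_def)
  then show ?case using generated_add(4) h by simp
qed (use h in simp)

text \<open>
A function in the span vanishes at every \<open>h\<close> without a section. If \<open>h\<close> has a section \<open>s\<close> and
if \<open>r : y \<rightarrow> x\<close> with section \<open>t\<close> splits the same idempotent \<open>s h = t r\<close>, then \<open>h = (h t) r\<close> with the
endomorphism \<open>h t\<close> of \<open>x\<close>, so the value at \<open>r\<close> determines the one at \<open>h\<close>. Hence one retraction \<open>r\<close> for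
each idempotent of the finite monoid \<open>End(y)\<close> that splits through \<open>x\<close> is enough.
\<close>

lemma generated_determined:
  assumes y: "y \<in> Obj C" and fin: "finite (Hom C y y)"
    and non_iso: "\<And>f v. \<lbrakk>f \<in> Hom C x x; \<not> iso_arrow C x x f; v \<in> carrier W\<rbrakk> \<Longrightarrow> \<rho> f v = \<zero>\<^bsub>W\<^esub>"
  shows "\<exists>R. finite R \<and> R \<subseteq> Hom C y x \<and> inj_on (\<lambda>\<phi>. restrict \<phi> R) (generated y)"
proof -
  define P where "P e r \<longleftrightarrow> r \<in> Hom C y x \<and>
      (\<exists>s\<in>Hom C x y. Cmp C x y x r s = Idn C x \<and> Cmp C y x y s r = e)" for e r
  define R where "R = (\<lambda>e. SOME r. P e r) ` {e \<in> Hom C y y. \<exists>r. P e r}"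
  have PR: "P e (SOME r. P e r)" if "\<exists>r. P e r" for e using someI_ex[OF that] .
  have "finite R" using fin by (simp add: R_def)
  moreover have "R \<subseteq> Hom C y x" using PR by (auto simp: R_def P_def)
  moreover have "inj_on (\<lambda>\<phi>. restrict \<phi> R) (generated y)"
  proof (rule inj_onI)
    fix \<phi> \<psi> assume \<phi>: "\<phi> \<in> generated y" and \<psi>: "\<psi> \<in> generated y" and eq: "restrict \<phi> R = restrict \<psi> R"
    have "\<phi> h = \<psi> h" if h: "h \<in> Hom C y x" for h
    proof (cases "\<exists>s\<in>Hom C x y. Cmp C x y x h s = Idn C x")
      case True
      then obtain s where s: "s \<in> Hom C x y" "Cmp C x y x h s = Idn C x" by blast
      define e where "e = Cmp C y x y s h"
      have e: "e \<in> Hom C y y" unfolding e_def by (rule Cmp_Hom[OF y x y h s(1)])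
      have "P e h" using h s by (auto simp: P_def e_def)
      then have "\<exists>r. P e r" by blast
      then obtain r where r: "r \<in> R" "P e r" using PR e by (auto simp: R_def)
      then obtain t where rH: "r \<in> Hom C y x" and t: "t \<in> Hom C x y" "Cmp C y x y t r = e"
        by (auto simp: P_def)
      have ht: "Cmp C x y x h t \<in> Hom C x x" by (rule Hom_xx[OF y t(1) h])
      have "Cmp C y x x (Cmp C x y x h t) r = Cmp C y y x h e"
        using Cmp_assoc[OF y x y x rH t(1) h] t(2) by simp
      also have "\<dots> = h"
        unfolding e_def using Cmp_assoc[OF y x y x h s(1) h] s(2) Cmp_Idn_left[OF y x h] by simp
      finally have "\<phi> h = \<rho> (Cmp C x y x h t) (\<phi> r)" "\<psi> h = \<rho> (Cmp C x y x h t) (\<psi> r)"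
        using generated_equivariant[OF y ht rH \<phi>] generated_equivariant[OF y ht rH \<psi>] by simp_all
      moreover have "\<phi> r = \<psi> r" using fun_cong[OF eq, of r] r(1) by simp
      ultimately show ?thesis by simp
    next
      case False
      then show ?thesis
        using generated_support[OF y h \<phi> non_iso] generated_support[OF y h \<psi> non_iso] by simp
    qed
    then show "\<phi> = \<psi>"
      using generated_in[OF y \<phi>] generated_in[OF y \<psi>]
      by (intro PiE_ext[of \<phi> "Hom C y x" "\<lambda>_. carrier W" \<psi>]) auto
  qed
  ultimately show ?thesis by blast
qed

lemma generated_embeds:
  assumes y: "y \<in> Obj C" and fin: "finite (Hom C y y)" and inf: "infinite (carrier W)"
    and non_iso: "\<And>f v. \<lbrakk>f \<in> Hom C x x; \<not> iso_arrow C x x f; v \<in> carrier W\<rbrakk> \<Longrightarrow> \<rho> f v = \<zero>\<^bsub>W\<^esub>"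
  shows "\<exists>j :: ('m \<Rightarrow> 'v) \<Rightarrow> 'v. inj_on j (generated y)"
proof -
  obtain R where R: "finite R" "R \<subseteq> Hom C y x" "inj_on (\<lambda>\<phi>. restrict \<phi> R) (generated y)"
    using generated_determined[OF y fin non_iso] by blast
  obtain j :: "('m \<Rightarrow> 'v) \<Rightarrow> 'v" where j: "inj_on j (R \<rightarrow>\<^sub>E carrier W)"
    using finite_power_inj[OF R(1) inf] by blast
  have "(\<lambda>\<phi>. restrict \<phi> R) ` generated y \<subseteq> R \<rightarrow>\<^sub>E carrier W"
  proof
    fix \<psi> assume "\<psi> \<in> (\<lambda>\<phi>. restrict \<phi> R) ` generated y"
    then obtain \<phi> where "\<phi> \<in> generated y" "\<psi> = restrict \<phi> R" by blast
    then show "\<psi> \<in> R \<rightarrow>\<^sub>E carrier W" using generated_in[OF y, of \<phi>] R(2) by auto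
  qed
  then have "inj_on (j \<circ> (\<lambda>\<phi>. restrict \<phi> R)) (generated y)"
    using R(3) j by (meson comp_inj_on inj_on_subset)
  then show ?thesis by blast
qed

end

section \<open>Simple functors with prescribed apex\<close>

context category
begin

text \<open>
The representation of \<open>Aut(x)\<close> is extended to \<open>End(x)\<close> by zero; this is multiplicative since the
nonunits form an ideal.
\<close>

theorem simple_functor_exists:
  fixes K :: "('k, 'a) ring_scheme" and M :: "('m \<Rightarrow> 'k, 'v) module"
  assumes K: "field K" "infinite (carrier K)" and fin: "\<And>y. y \<in> Obj C \<Longrightarrow> finite (Hom C y y)"
    and x: "x \<in> Obj C" and M: "simple_object (left_modules (group_algebra K (Aut C x))) M"
  shows "\<exists>F. simple_functor C K F \<and> apex C F x \<and>
    (M, value_rep C F x) \<in> iso_rel (left_modules (group_algebra K (Aut C x)))"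
proof -
  interpret K: field K by (rule K)
  have cK: "cring K" ..
  interpret A: finite_group_algebra "Aut C x" K by (rule finite_group_algebra_Aut[OF cK x fin[OF x]])
  have M_mod: "left_module A.KG M" and M0: "carrier M \<noteq> {\<zero>\<^bsub>M\<^esub>}"
    and M_simple: "\<And>N. submod A.KG M N \<Longrightarrow> N = {\<zero>\<^bsub>M\<^esub>} \<or> N = carrier M"
    using M unfolding simple_left_module_iff by blast+
  interpret M: left_module A.KG M by (rule M_mod)
  let ?W = "scalar_restriction K (Aut C x) M"
  have W: "left_module K ?W" by (rule A.scalar_restriction_module[OF M_mod])
  define \<rho> where "\<rho> f = (\<lambda>v\<in>carrier M. if iso_arrow C x x f
      then basis_elt K (Aut C x) \<one>\<^bsub>K\<^esub> f \<odot>\<^bsub>M\<^esub> v else \<zero>\<^bsub>M\<^esub>)" for f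
  note \<delta>_in = A.basis_elt_in
  have \<delta>_mult: "A.\<delta> a f \<odot>\<^bsub>M\<^esub> (A.\<delta> b g \<odot>\<^bsub>M\<^esub> v) = A.\<delta> (a \<otimes>\<^bsub>K\<^esub> b) (Cmp C x x x f g) \<odot>\<^bsub>M\<^esub> v"
    if "a \<in> carrier K" "b \<in> carrier K" "iso_arrow C x x f" "iso_arrow C x x g" "v \<in> carrier M" for a b f g v
    using A.basis_elt_mult[of a b f g] M.smult_assoc1[of "A.\<delta> a f" "A.\<delta> b g" v] that \<delta>_in by simp
  interpret E: monoid "End C x" by (rule End_monoid[OF x])
  have iso_Cmp: "iso_arrow C x x (Cmp C x x x f g) \<longleftrightarrow> iso_arrow C x x f \<and> iso_arrow C x x g"
    if "f \<in> Hom C x x" "g \<in> Hom C x x" for f g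
    using E.finite_Units_mult_iff[of f g] that fin[OF x] unfolding Units_End by (simp add: End_def)
  interpret R: End_representation C K ?W x \<rho>
  proof (intro End_representation.intro category_axioms W End_representation_axioms.intro x)
    fix f assume f: "f \<in> Hom C x x"
    show "\<rho> f \<in> linear_maps K ?W ?W"
    proof (rule linear_mapsI)
      fix a v assume a: "a \<in> carrier K" and v: "v \<in> carrier ?W"
      have "A.\<delta> \<one>\<^bsub>K\<^esub> f \<odot>\<^bsub>M\<^esub> (A.\<delta> a (Idn C x) \<odot>\<^bsub>M\<^esub> v) = A.\<delta> a (Idn C x) \<odot>\<^bsub>M\<^esub> (A.\<delta> \<one>\<^bsub>K\<^esub> f \<odot>\<^bsub>M\<^esub> v)"
        if "iso_arrow C x x f"
        using a v x f that iso_arrow_Idn[OF x] by (simp add: \<delta>_mult Cmp_Idn_left Cmp_Idn_right)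
      then show "\<rho> f (a \<odot>\<^bsub>?W\<^esub> v) = a \<odot>\<^bsub>?W\<^esub> \<rho> f v"
        using a v \<delta>_in by (simp add: \<rho>_def)
    qed (auto simp: \<rho>_def \<delta>_in M.smult_r_distr)
  next
    fix f g v assume "f \<in> Hom C x x" "g \<in> Hom C x x" "v \<in> carrier ?W"
    then show "\<rho> (Cmp C x x x f g) v = \<rho> f (\<rho> g v)"
      by (auto simp: \<rho>_def iso_Cmp \<delta>_mult \<delta>_in)
  next
    fix v assume "v \<in> carrier ?W"
    then show "\<rho> (Idn C x) v = v"
      using M.smult_one[of v] iso_arrow_Idn[OF x] by (simp add: \<rho>_def)
  qed
  have non_iso: "\<rho> f v = \<zero>\<^bsub>?W\<^esub>" if "f \<in> Hom C x x" "\<not> iso_arrow C x x f" "v \<in> carrier ?W" for f v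
    using that by (simp add: \<rho>_def)
  have S: "simple_functor C K R.ext_functor"
  proof (rule R.ext_simple_functor)
    fix U assume U: "submod K ?W U" and st: "\<And>f v. \<lbrakk>f \<in> Hom C x x; v \<in> U\<rbrakk> \<Longrightarrow> \<rho> f v \<in> U"
    have "A.\<delta> \<one>\<^bsub>K\<^esub> f \<odot>\<^bsub>M\<^esub> v \<in> U" if "iso_arrow C x x f" "v \<in> U" for f v
      using st[OF iso_arrow_Hom[OF that(1)] that(2)] submodD(1)[OF U that(2)] that(1) by (simp add: \<rho>_def)
    then have "submod A.KG M U" unfolding A.submod_iff[OF M_mod] using U by simp
    then show "U = {\<zero>\<^bsub>?W\<^esub>} \<or> U = carrier ?W" using M_simple by simp
  qed (use M0 in simp)
  have "infinite (carrier ?W)" by (rule infinite_vector_space[OF K W]) (use M0 in simp)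
  then have "\<forall>y\<in>Obj C. \<exists>j :: ('m \<Rightarrow> 'v) \<Rightarrow> 'v. inj_on j (R.generated y)"
    using R.generated_embeds[OF _ fin _ non_iso] by blast
  then obtain j :: "'o \<Rightarrow> ('m \<Rightarrow> 'v) \<Rightarrow> 'v" where j: "\<And>y. y \<in> Obj C \<Longrightarrow> inj_on (j y) (R.generated y)"
    by metis
  then have j': "\<And>y. y \<in> Obj C \<Longrightarrow> inj_on (j y) (val R.ext_functor y)" by simp
  define F where "F = transport_functor j R.ext_functor"
  have F: "simple_functor C K F"
    unfolding F_def by (rule transport_simple_functor[OF S j'])
  note Ff = simple_functorD(1)[OF F]
  note Fx = module_functorD(1)[OF Ff x]
  define \<psi> where "\<psi> = (\<lambda>v\<in>carrier M. j x (R.\<eta> v))"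
  have carrier_F: "val F x = j x ` R.generated x"
    by (simp add: F_def transport_functor_simps transport_module_simps)
  have bij: "bij_betw \<psi> (carrier M) (val F x)"
  proof -
    have "inj_on (j x \<circ> R.\<eta>) (carrier M)"
      using comp_inj_on[OF R.eta_inj] R.eta_image j[OF x] by simp
    moreover have "(j x \<circ> R.\<eta>) ` carrier M = val F x"
      unfolding carrier_F image_comp[symmetric] using R.eta_image by simp
    ultimately have "bij_betw (j x \<circ> R.\<eta>) (carrier M) (val F x)" by (simp add: bij_betw_def)
    then show ?thesis by (rule bij_betw_cong[THEN iffD1, rotated]) (simp add: \<psi>_def)
  qed
  have eta_in: "R.\<eta> v \<in> val R.ext_functor x" if "v \<in> carrier M" for v
    using R.eta_generated that by simp
  have Far_F: "Far F x x f (\<psi> v) = \<psi> (\<rho> f v)" if "f \<in> Hom C x x" "v \<in> carrier M" for f v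
  proof -
    have "\<rho> f v \<in> carrier M" using R.rho(1)[OF that(1)] that(2) by simp
    then show ?thesis
      using transport_functor_simps(2)[where j = j and F = R.ext_functor, OF j'[OF x] eta_in[OF that(2)]] R.Far_x_eta[OF that(1)] that(2)
      by (simp add: F_def \<psi>_def)
  qed
  have \<psi>_lin: "\<psi> \<in> linear_maps K ?W (Fob F x)"
  proof (rule linear_mapsI)
    show "\<psi> v \<in> val F x" if "v \<in> carrier ?W" for v
      using bij that by (auto simp: bij_betw_def)
    show "\<psi> (u \<oplus>\<^bsub>?W\<^esub> v) = \<psi> u \<oplus>\<^bsub>Fob F x\<^esub> \<psi> v" if "u \<in> carrier ?W" "v \<in> carrier ?W" for u v
    proof -
      have "R.\<eta> (u \<oplus>\<^bsub>?W\<^esub> v) = R.\<eta> u \<oplus>\<^bsub>Fob R.ext_functor x\<^esub> R.\<eta> v"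
        using R.eta_add[OF that] unfolding R.Fob_ext_functor .
      then show ?thesis
        using transport_module_simps(3)[where j = "j x" and M = "Fob R.ext_functor x", OF j'[OF x] eta_in eta_in, of u v] that
        by (simp add: \<psi>_def F_def transport_functor_simps)
    qed
    show "\<psi> (a \<odot>\<^bsub>?W\<^esub> v) = a \<odot>\<^bsub>Fob F x\<^esub> \<psi> v" if "a \<in> carrier K" "v \<in> carrier ?W" for a v
    proof -
      have "R.\<eta> (a \<odot>\<^bsub>?W\<^esub> v) = a \<odot>\<^bsub>Fob R.ext_functor x\<^esub> R.\<eta> v"
        using R.eta_smult[OF that] unfolding R.Fob_ext_functor .
      then show ?thesis
        using transport_module_simps(4)[where j = "j x" and M = "Fob R.ext_functor x", OF j'[OF x] eta_in, of v a] that \<delta>_in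
        by (simp add: \<psi>_def F_def transport_functor_simps)
    qed
  qed (simp add: \<psi>_def)
  have \<psi>0: "\<psi> \<zero>\<^bsub>M\<^esub> = zero_at F x" using linear_zero[OF W Fx \<psi>_lin] by simp
  have "apex C F x"
    unfolding apex_def
  proof (intro conjI ballI impI x)
    obtain v where v: "v \<in> carrier M" "v \<noteq> \<zero>\<^bsub>M\<^esub>" using nonzero_element[OF M_mod M0] by blast
    then have "\<psi> v \<noteq> \<psi> \<zero>\<^bsub>M\<^esub>" using inj_onD[OF bij_betw_imp_inj_on[OF bij], of v "\<zero>\<^bsub>M\<^esub>"] by auto
    then show "val F x \<noteq> {zero_at F x}" using v(1) \<psi>0 bij by (auto simp: bij_betw_def)
    fix f w assume f: "f \<in> Hom C x x" "\<not> iso_arrow C x x f" and "w \<in> val F x"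
    then obtain v where "v \<in> carrier M" "w = \<psi> v" using bij by (auto simp: bij_betw_def)
    then show "Far F x x f w = zero_at F x" using Far_F[OF f(1)] non_iso[OF f] \<psi>0 by simp
  qed
  moreover have "\<psi> \<in> linear_maps A.KG M (value_rep C F x)"
    unfolding value_rep_linear_iff[OF cK x fin[OF x] Ff M_mod]
    using \<psi>_lin Far_F iso_arrow_Hom by (auto simp: \<rho>_def)
  then have "(M, value_rep C F x) \<in> iso_rel (left_modules A.KG)"
    unfolding iso_left_module_iff using M_mod value_rep_smult(1)[OF cK x fin[OF x] Ff] bij by auto
  ultimately show ?thesis using F by blast
qed

end

text \<open>
A simple representation of \<open>Aut(rep c)\<close> corresponds to the simple functor with apex \<open>rep c\<close> and this
value there, which is unique up to isomorphism.
\<close>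

theorem proposition7:
  fixes K :: "('k, 'a) ring_scheme"
    and C :: "('o, 'm) cat"
    and rep :: "'o set \<Rightarrow> 'o"
    and \<iota> :: "'k \<Rightarrow> 'v"
  assumes K: "algebraically_closed K"
    and C: "category C"
    and split: "idempotents_split C"
    and fin: "\<And>x. x \<in> Obj C \<Longrightarrow> finite (Hom C x x)"
    and rep: "\<And>c. c \<in> Iso C \<Longrightarrow> rep c \<in> c"
    and universe: "inj_on \<iota> (carrier K)"
  shows "\<exists>\<Phi>. bij_betw \<Phi>
    (SIGMA c:Iso C. Irr (left_modules (group_algebra K (Aut C (rep c))) ::
       (('m \<Rightarrow> 'k, 'v) module, 'v \<Rightarrow> 'v) cat))
    (Irr (\<F> C K :: (('o, 'm, ('k, 'v) module, 'v \<Rightarrow> 'v) fctr, 'o \<Rightarrow> 'v \<Rightarrow> 'v) cat))"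
proof -
  interpret C: category C by (rule C)
  interpret K: algebraically_closed K by (rule K)
  have cK: "cring K" ..
  have fK: "field K" ..
  let ?E = "iso_rel (functor_category C (left_modules K)) ::
    (('o, 'm, ('k, 'v) module, 'v \<Rightarrow> 'v) fctr) rel"
  define L where "L c = (left_modules (group_algebra K (Aut C (rep c))) :: (('m \<Rightarrow> 'k, 'v) module, 'v \<Rightarrow> 'v) cat)" for c
  have E: "equiv {F. module_functor C K F} ?E"
    using category.iso_rel_equiv[OF functor_category_category[OF left_modules_category, of C]]
    by (simp add: functor_category_def)
  have L: "equiv (Obj (L c)) (iso_rel (L c))" for c
    unfolding L_def by (rule category.iso_rel_equiv[OF left_modules_category])
  have rep_Obj: "rep c \<in> Obj C" and rep_class: "c = iso_rel C `` {rep c}" if c: "c \<in> Iso C" for c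
  proof -
    obtain x where x: "x \<in> Obj C" "c = iso_rel C `` {x}"
      using c unfolding Iso_def by (rule quotientE)
    then have r: "(x, rep c) \<in> iso_rel C" using rep[OF c] by simp
    show "rep c \<in> Obj C" using r by (simp add: iso_rel_def)
    show "c = iso_rel C `` {rep c}" using equiv_class_eq[OF C.iso_rel_equiv r] x by simp
  qed
  have "\<forall>c\<in>Iso C. \<forall>M. \<exists>F. simple_object (L c) M \<longrightarrow> simple_functor C K F \<and> apex C F (rep c) \<and>
      (M, value_rep C F (rep c)) \<in> iso_rel (L c)"
    using C.simple_functor_exists[OF fK algebraically_closed_infinite[OF K] fin rep_Obj]
    unfolding L_def by blast
  then obtain S where S: "\<And>c M. \<lbrakk>c \<in> Iso C; simple_object (L c) M\<rbrakk> \<Longrightarrow> simple_functor C K (S c M) \<and>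
      apex C (S c M) (rep c) \<and> (M, value_rep C (S c M) (rep c)) \<in> iso_rel (L c)"
    by metis
  define m where "m c A = (SOME M. simple_object (L c) M \<and> A = iso_rel (L c) `` {M})" for c A
  have m: "simple_object (L c) (m c A)" "A = iso_rel (L c) `` {m c A}" if "A \<in> Irr (L c)" for c A
  proof -
    have "\<exists>M. simple_object (L c) M \<and> A = iso_rel (L c) `` {M}"
      using that unfolding Irr_def by (auto elim: quotientE)
    then show "simple_object (L c) (m c A)" "A = iso_rel (L c) `` {m c A}"
      unfolding m_def by (metis (mono_tags, lifting) someI_ex)+
  qed
  define T where "T c A = S c (m c A)" for c A
  have T: "simple_functor C K (T c A)" "apex C (T c A) (rep c)"
    "A = iso_rel (L c) `` {value_rep C (T c A) (rep c)}" if "c \<in> Iso C" "A \<in> Irr (L c)" for c A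
  proof -
    note S' = S[OF that(1) m(1)[OF that(2)], folded T_def]
    show "simple_functor C K (T c A)" "apex C (T c A) (rep c)" using S' by blast+
    have "(m c A, value_rep C (T c A) (rep c)) \<in> iso_rel (L c)" using S' by blast
    from equiv_class_eq[OF L this] show "A = iso_rel (L c) `` {value_rep C (T c A) (rep c)}"
      by (simp only: m(2)[OF that(2), symmetric])
  qed
  define \<Phi> where "\<Phi> = (\<lambda>(c, A). ?E `` {T c A})"
  have "bij_betw \<Phi> (SIGMA c:Iso C. Irr (L c)) (Irr (functor_category C (left_modules K)))"
    unfolding bij_betw_def
  proof
    show "inj_on \<Phi> (SIGMA c:Iso C. Irr (L c))"
    proof (rule inj_onI, clarify)
      fix c A c' A'
      assume c: "c \<in> Iso C" and A: "A \<in> Irr (L c)" and c': "c' \<in> Iso C" and A': "A' \<in> Irr (L c')"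
        and eq: "\<Phi> (c, A) = \<Phi> (c', A')"
      note Tc = T[OF c A] and Tc' = T[OF c' A']
      have iso: "(T c A, T c' A') \<in> ?E"
        using eq eq_equiv_class[OF _ E] C.simple_functorD(1)[OF Tc'(1)] by (simp add: \<Phi>_def)
      \<comment> \<open>Isomorphic functors have the same apexes, and these form a single isomorphism class.\<close>
      have "apex C (T c' A') (rep c)" by (rule C.apex_iso_functor[OF iso Tc(2)])
      then have "(rep c, rep c') \<in> iso_rel C" by (rule C.apex_unique[OF Tc'(1) _ Tc'(2)])
      then have cc: "c = c'"
        using equiv_class_eq[OF C.iso_rel_equiv] rep_class[OF c] rep_class[OF c'] by metis
      have "(value_rep C (T c A) (rep c), value_rep C (T c' A') (rep c)) \<in> iso_rel (L c)"
        using C.iso_simple_functor_iff[OF cK fin[OF rep_Obj[OF c]] Tc(1) Tc'(1) Tc(2)] Tc'(2) iso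
        by (simp add: cc L_def)
      then have "iso_rel (L c) `` {value_rep C (T c A) (rep c)} =
          iso_rel (L c') `` {value_rep C (T c' A') (rep c')}"
        using equiv_class_eq[OF L] by (simp add: cc)
      then have "A = A'" by (simp only: Tc(3)[symmetric] Tc'(3)[symmetric])
      then show "c = c' \<and> A = A'" using cc by simp
    qed
    show "\<Phi> ` (SIGMA c:Iso C. Irr (L c)) = Irr (functor_category C (left_modules K))"
    proof
      show "\<Phi> ` (SIGMA c:Iso C. Irr (L c)) \<subseteq> Irr (functor_category C (left_modules K))"
        using T(1) by (auto simp: \<Phi>_def Irr_def intro!: quotientI)
      show "Irr (functor_category C (left_modules K)) \<subseteq> \<Phi> ` (SIGMA c:Iso C. Irr (L c))"
      proof
        fix B :: "('o, 'm, ('k, 'v) module, 'v \<Rightarrow> 'v) fctr set"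
        assume "B \<in> Irr (functor_category C (left_modules K))"
        then obtain F where F: "simple_functor C K F" and B: "B = ?E `` {F}"
          unfolding Irr_def by (auto elim: quotientE)
        obtain x where x: "apex C F x" using C.apex_exists[OF split fin F] by blast
        define c where "c = iso_rel C `` {x}"
        have c: "c \<in> Iso C" unfolding c_def Iso_def by (rule quotientI[OF apexD(1)[OF x]])
        have rc: "apex C F (rep c)"
          using C.apex_iso_object[OF C.simple_functorD(1)[OF F] x] rep[OF c] by (simp add: c_def)
        let ?A = "iso_rel (L c) `` {value_rep C F (rep c)}"
        have A: "?A \<in> Irr (L c)"
          unfolding Irr_def L_def
          by (intro quotientI CollectI C.value_rep_simple[OF cK fin[OF rep_Obj[OF c]] F rc])
        note Tc = T[OF c A]
        have "value_rep C (T c ?A) (rep c) \<in> Obj (L c)"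
          using C.value_rep_simple[OF cK fin[OF rep_Obj[OF c]] Tc(1,2)]
          unfolding L_def simple_object_def by blast
        then have "(value_rep C F (rep c), value_rep C (T c ?A) (rep c)) \<in> iso_rel (L c)"
          using eq_equiv_class[OF Tc(3) L] by simp
        then have "(F, T c ?A) \<in> ?E"
          using C.iso_simple_functor_iff[OF cK fin[OF rep_Obj[OF c]] F Tc(1) rc Tc(2)] by (simp add: L_def)
        then have "B = \<Phi> (c, ?A)" unfolding B \<Phi>_def using equiv_class_eq[OF E] by simp
        then show "B \<in> \<Phi> ` (SIGMA c:Iso C. Irr (L c))" using c A by blast
      qed
    qed
  qed
  then show ?thesis unfolding L_def \<F>_def by blast
qed

end
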